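(* Let $n\ge2$ and let $F:\mathcal S_n\to\mathbb R$ be uniformly elliptic and positively homogeneous of degree one (as in the context), with scaling exponent $\alpha^*(F)$ and upward-pointing fundamental solution $\Phi$; let $\alpha^*(\tilde F)$ and $\tilde\Phi$ be the scaling exponent and upward-pointing fundamental solution of the dual operator $\tilde F(M):=-F(-M)$. Suppose $u\in C(\mathbb R^n\setminus B_1)$ is a viscosity solution of $$F(D^2u)=0\quad\text{in }\mathbb R^n\setminus\bar B_1.$$ If $u$ is bounded above or below in $\mathbb R^n\setminus B_1$, then precisely one of the following five alternatives holds. (i) $u_\infty:=\lim_{|x|\to\infty}u(x)$ exists (as a real number), and $\min_{\partial B_r}u\le u_\infty\le\max_{\partial B_r}u$ for all $r>1$. (ii) $\alpha^*(F)>0$, $u_\infty:=\lim_{|x|\to\infty}u(x)$ exists, and $\dfrac{u(x)-u_\infty}{\Phi(x)}\to a$ as $|x|\to\infty$ for some constant $a>0$. (iii) $\alpha^*(\tilde F)>0$, $u_\infty:=\lim_{|x|\to\infty}u(x)$ exists, and $\dfrac{u(x)-u_\infty}{-\tilde\Phi(x)}\to a$ as $|x|\to\infty$ for some constant $a>0$. (iv) $\alpha^*(F)\le0$, and there are constants $a,C>0$ such that $a\Phi-C\le u\le a\Phi+C$ in $\mathbb R^n\setminus B_2$. (v) $\alpha^*(\tilde F)\le0$, and there are constants $a,C>0$ such that $-a\tilde\Phi-C\le u\le-a\tilde\Phi+C$ in $\mathbb R^n\setminus B_2$.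
   Context: $\mathcal S_n$ is the set of real symmetric $n\times n$ matrices and $B_r=\{x\in\mathbb R^n:|x|<r\}$. The map $F:\mathcal S_n\to\mathbb R$ satisfies, for some constants $0<\lambda\le\Lambda$: (uniform ellipticity) $\lambda\,\mathrm{trace}(N)\le F(M-N)-F(M)\le\Lambda\,\mathrm{trace}(N)$ for all $M,N\in\mathcal S_n$ with $N$ nonnegative definite; (positive homogeneity) $F(tM)=tF(M)$ for all $t\ge0$ and $M\in\mathcal S_n$. All equations and inequalities are understood in the viscosity sense (sign convention of $-\Delta$: subsolution means $F(D^2u)\le0$, supersolution means $F(D^2u)\ge 0$). The dual operator $\tilde F(M):=-F(-M)$ satisfies the same hypotheses. Spaces of homogeneous functions: for $\alpha\in[-1,\infty)\setminus\{0\}$, $H_\alpha^+$ is the set of $v\in C(\mathbb R^n\setminus\{0\})$ with $\alpha v>0$ and $\sigma^\alpha v(\sigma x)=v(x)$ for all $\sigma>0$, $x\ne0$; $H_0^+$ is the set of $v\in C(\mathbb R^n\setminus\{0\})$ with $v(\sigma x)+\log\sigma=v(x)$ for all $\sigma>0$, $x\neq0$. Scaling exponent: $\alpha^*(F):=\sup\{\alpha\in(-1,\infty)\setminus\{0\}:\text{there exists }v\in H_\alpha^+\text{ with }F(D^2v)\ge0\text{ in }\mathbb R^n\setminus\{0\}\}$, which is a finite number $>-1$. Fundamental solution: it is known that there is a unique $\Phi\in H^+_{\alpha^*(F)}$ solving $F(D^2\Phi)=0$ in $\mathbb R^n\setminus\{0\}$ with the normalization $\min_{\partial B_1}(\mathrm{sign}(\alpha^*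 )\Phi)=1$ if $\alpha^*=\alpha^*(F)\ne0$, and $\int_{\partial B_1}\Phi=0$ if $\alpha^*(F)=0$. This $\Phi$ is called the upward-pointing fundamental solution of $F$. (Thus $\Phi>0$, $\Phi(x)\to0$ as $|x|\to\infty$ if $\alpha^*(F)>0$, and $\Phi(x)\to-\infty$ as $|x|\to\infty$ if $\alpha^*(F)\le0$.) *)

theory Defs
  imports "HOL-Analysis.Analysis"
begin

text \<open>Operators are total functions on \<^typ>\<open>real ^ 'n ^ 'n\<close>; all conditions on them, and all
  evaluations of them, concern symmetric matrices only.\<close>

definition symmetric_matrix :: "real ^ 'n ^ 'n \<Rightarrow> bool" where
  "symmetric_matrix M \<longleftrightarrow> transpose M = M"

definition nonneg_definite :: "real ^ 'n ^ 'n \<Rightarrow> bool" where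
  "nonneg_definite N \<longleftrightarrow> symmetric_matrix N \<and> (\<forall>x. 0 \<le> x \<bullet> (N *v x))"

definition uniformly_elliptic :: "(real ^ 'n ^ 'n \<Rightarrow> real) \<Rightarrow> bool" where
  "uniformly_elliptic F \<longleftrightarrow>
     (\<exists>lam Lam. 0 < lam \<and> lam \<le> Lam \<and>
        (\<forall>M N. symmetric_matrix M \<and> nonneg_definite N \<longrightarrow>
           lam * trace N \<le> F (M - N) - F M \<and> F (M - N) - F M \<le> Lam * trace N))"

definition positively_homogeneous :: "(real ^ 'n ^ 'n \<Rightarrow> real) \<Rightarrow> bool" where
  "positively_homogeneous F \<longleftrightarrow>
     (\<forall>t\<ge>0. \<forall>M. symmetric_matrix M \<longrightarrow> F (t *\<^sub>R M) = t * F M)"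

definition dual_operator :: "(real ^ 'n ^ 'n \<Rightarrow> real) \<Rightarrow> real ^ 'n ^ 'n \<Rightarrow> real" where
  "dual_operator F M = - F (- M)"

text \<open>\<open>\<phi>\<close> is twice continuously differentiable on the open set \<open>U\<close>, with gradient \<open>g\<close> and
  Hessian \<open>H\<close>; the matrices \<open>H x\<close> are then symmetric by Schwarz's theorem.\<close>

definition C2_on :: "(real ^ 'n) set \<Rightarrow> (real ^ 'n \<Rightarrow> real) \<Rightarrow> (real ^ 'n \<Rightarrow> real ^ 'n)
    \<Rightarrow> (real ^ 'n \<Rightarrow> real ^ 'n ^ 'n) \<Rightarrow> bool" where
  "C2_on U \<phi> g H \<longleftrightarrow> open U
     \<and> (\<forall>x\<in>U. (\<phi> has_derivative (\<lambda>h. g x \<bullet> h)) (at x))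
     \<and> (\<forall>x\<in>U. (g has_derivative (\<lambda>h. H x *v h)) (at x))
     \<and> continuous_on U H"

text \<open>Continuous viscosity sub- and supersolutions in an open set \<open>\<Omega>\<close>, with the sign convention
  of the negative Laplacian. Since the neighbourhood \<open>U\<close> of \<open>x\<close> is arbitrary, touching on \<open>U\<close>
  amounts to a local extremum of \<open>u - \<phi>\<close> at \<open>x\<close>.\<close>

definition viscosity_subsolution ::
    "(real ^ 'n ^ 'n \<Rightarrow> real) \<Rightarrow> (real ^ 'n) set \<Rightarrow> (real ^ 'n \<Rightarrow> real) \<Rightarrow> bool" where
  "viscosity_subsolution F \<Omega> u \<longleftrightarrow> continuous_on \<Omega> u \<and>
     (\<forall>U \<phi> g H x. U \<subseteq> \<Omega> \<and> C2_on U \<phi> g H \<and> x \<in> U \<and> (\<forall>y\<in>U. u y - \<phi> y \<le> u x - \<phi> x)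
        \<longrightarrow> F (H x) \<le> 0)"

definition viscosity_supersolution ::
    "(real ^ 'n ^ 'n \<Rightarrow> real) \<Rightarrow> (real ^ 'n) set \<Rightarrow> (real ^ 'n \<Rightarrow> real) \<Rightarrow> bool" where
  "viscosity_supersolution F \<Omega> u \<longleftrightarrow> continuous_on \<Omega> u \<and>
     (\<forall>U \<phi> g H x. U \<subseteq> \<Omega> \<and> C2_on U \<phi> g H \<and> x \<in> U \<and> (\<forall>y\<in>U. u x - \<phi> x \<le> u y - \<phi> y)
        \<longrightarrow> 0 \<le> F (H x))"

definition viscosity_solution ::
    "(real ^ 'n ^ 'n \<Rightarrow> real) \<Rightarrow> (real ^ 'n) set \<Rightarrow> (real ^ 'n \<Rightarrow> real) \<Rightarrow> bool" where
  "viscosity_solution F \<Omega> u \<longleftrightarrow> viscosity_subsolution F \<Omega> u \<and> viscosity_supersolution F \<Omega> u"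

text \<open>The space \<open>H\<^sub>\<alpha>\<^sup>+\<close>, used for \<open>\<alpha> \<ge> -1\<close> only. The value of \<open>v\<close> at the origin is irrelevant.\<close>

definition H_plus :: "real \<Rightarrow> (real ^ 'n \<Rightarrow> real) set" where
  "H_plus \<alpha> = {v. continuous_on (- {0}) v \<and>
     (if \<alpha> = 0 then (\<forall>\<sigma>>0. \<forall>x. x \<noteq> 0 \<longrightarrow> v (\<sigma> *\<^sub>R x) + ln \<sigma> = v x)
      else (\<forall>x. x \<noteq> 0 \<longrightarrow> \<alpha> * v x > 0) \<and>
           (\<forall>\<sigma>>0. \<forall>x. x \<noteq> 0 \<longrightarrow> \<sigma> powr \<alpha> * v (\<sigma> *\<^sub>R x) = v x))}"

definition scaling_exponent :: "(real ^ 'n ^ 'n \<Rightarrow> real) \<Rightarrow> real" where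
  "scaling_exponent F =
     Sup {\<alpha>. -1 < \<alpha> \<and> \<alpha> \<noteq> 0 \<and> (\<exists>v\<in>H_plus \<alpha>. viscosity_supersolution F (- {0}) v)}"

text \<open>Surface measure of the unit sphere, from polar coordinates: the measure of a Borel set
  \<open>A\<close> is \<open>n\<close> times the volume of the cone \<open>{t x | x \<in> A \<inter> S, 0 < t < 1}\<close>. Recall that
  \<open>sgn x = x / |x|\<close>.\<close>

definition sphere_measure :: "(real ^ 'n) measure" where
  "sphere_measure = scale_measure (of_nat CARD('n))
     (distr (restrict_space lborel (ball 0 1 - {0})) borel sgn)"

text \<open>The infimum over the unit sphere is a minimum, by continuity and compactness.\<close>

definition upward_fundamental_solution ::
    "(real ^ 'n ^ 'n \<Rightarrow> real) \<Rightarrow> (real ^ 'n \<Rightarrow> real) \<Rightarrow> bool" where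
  "upward_fundamental_solution F \<Phi> \<longleftrightarrow>
     \<Phi> \<in> H_plus (scaling_exponent F) \<and> viscosity_solution F (- {0}) \<Phi> \<and>
     (if scaling_exponent F \<noteq> 0
      then (INF x\<in>sphere 0 1. sgn (scaling_exponent F) * \<Phi> x) = 1
      else (LINT x|sphere_measure. \<Phi> x) = 0)"

end

theory Submission
  imports Defs "HOL-Complex_Analysis.Great_Picard"
begin

text \<open>The comparison principle comes from the theorem on sums; in its proof, a second-order expansion
  of a function with Lipschitz gradient, off a negligible set and along one sequence of scales,
  replaces Alexandrov's theorem. The Ishii--Lions doubling of variables bounds the Lipschitz
  constant of a solution by its oscillation, which together with barriers yields the Harnack
  inequality for solutions, first on balls and, as \<open>n \<ge> 2\<close>, on spheres.

  By duality (\<open>u\<close> solves \<open>F\<close> if and only if \<open>- u\<close> solves the dual operator) one may take \<open>u\<close> bounded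
  below. By Harnack \<open>u\<close> has a limit \<open>l\<close> or tends to infinity. If \<open>u\<close> converges and \<open>u > l\<close> on
  some sphere, comparison bounds \<open>u - l\<close> below and above by multiples of \<open>\<Phi>\<close>; let \<open>a\<close> be the
  lower limit of \<open>(u - l) / \<Phi>\<close>. Rescalings of \<open>u - l\<close> at points where the ratio is nearly \<open>a\<close> converge to
  a solution above \<open>a \<Phi>\<close> that touches it, so they agree by strong comparison; hence \<open>u - l \<le> (a + \<epsilon>) \<Phi>\<close>
  on large spheres, and outside them by comparison. If \<open>u\<close> tends to infinity, the same argument
  applies to \<open>u\<close> and minus the dual fundamental solution, with Harnack in place of the blow-down limit when
  the growth is logarithmic.\<close>

section \<open>Second-order expansions\<close>

text \<open>At a maximum of \<open>u x - v y\<close> minus a penalty neither function need have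
  second derivatives; this obstacle shapes the first half. An expansion with error
  \<open>\<tau> * s\<^sup>2\<close> on a single ball of radius \<open>s\<close> suffices, since
  enlarging the Hessian by a multiple of \<tau> turns it into genuine touching; so convergence along
  the scales \<open>(1/2)^k\<close> is enough, and that follows from the parallelogram law for
  increments of the gradient. As \<open>F\<close> sees only the Hessian, the points and gradients
  produced by the theorem on sums need not be recorded. Since \<open>F\<close> is nonlinear, a
  difference of two solutions is not a solution: only constants may be added and positive factors
  applied. Hence \<open>u\<close> is compared with multiples of \<Phi> through touching and strong
  comparison. For \<alpha> = 0 a dilation changes \<Phi> by an additive constant instead of a
  factor, which destroys the blow-down; errors small against the logarithm are then accepted. The
  alternatives exclude each other by their behaviour at infinity: a limit \<open>l\<close> with
  \<open>u - l\<close> not eventually of one strict sign, a limit approached strictly from above or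
  strictly from below, divergence to minus or to plus infinity.\<close>

lemma nn_integral_lborel_translate:
  fixes f :: "'a::euclidean_space \<Rightarrow> ennreal"
  assumes "f \<in> borel_measurable borel"
  shows "(\<integral>\<^sup>+x. f (x + c) \<partial>lborel) = (\<integral>\<^sup>+x. f x \<partial>lborel)"
proof -
  have "(\<integral>\<^sup>+x. f x \<partial>lborel) = (\<integral>\<^sup>+x. f x \<partial>(distr lborel borel ((+) c)))"
    by (simp add: lborel_distr_plus)
  also have "\<dots> = (\<integral>\<^sup>+x. f (c + x) \<partial>lborel)"
    using assms by (subst nn_integral_distr) auto
  finally show ?thesis by (simp add: add.commute)
qed

text \<open>The parallelogram law for increments of \<open>G\<close>, integrated and translated,
  reads \<open>b (Suc k) + a k = 4 * a (Suc k)\<close>. So \<open>4 ^ k * b (Suc k)\<close>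
  telescopes, and \<open>4 ^ k * a k\<close> is bounded by the Lipschitz constant and the compact
  support. Hence the weighted squares of the second differences are summable at almost every point.
  The shift \<open>h'\<close> is there because the blow-up limit must have vanishing second
  differences around every point, not only around 0.\<close>

lemma second_difference_AE_tendsto:
  fixes G :: "'a::euclidean_space \<Rightarrow> 'b::euclidean_space"
  assumes lip: "\<And>x y. norm (G x - G y) \<le> K * norm (x - y)"
    and supp: "\<And>x. norm x \<ge> R \<Longrightarrow> G x = 0" and R: "R > 0"
  shows "AE x in lborel. (\<lambda>k. 2 ^ k *\<^sub>R (G (x + (1/2)^k *\<^sub>R (h' + 2 *\<^sub>R h))
      - 2 *\<^sub>R G (x + (1/2)^k *\<^sub>R (h' + h)) + G (x + (1/2)^k *\<^sub>R h'))) \<longlonglongrightarrow> 0"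
proof -
  define t :: "nat \<Rightarrow> real" where "t k = (1/2)^k" for k
  have t0: "t k > 0" and t1: "t k \<le> 1" for k
    by (auto simp: t_def power_le_one)
  have K0: "K \<ge> 0"
  proof -
    obtain b :: 'a where "b \<in> Basis" by fastforce
    then have "norm b = 1" by simp
    moreover have "0 \<le> K * norm (b - 0)" using lip[of b 0] norm_ge_zero order_trans by blast
    ultimately show ?thesis by simp
  qed
  have contG: "continuous_on UNIV G"
    by (rule lipschitz_on_continuous_on[of K]) (auto intro!: lipschitz_onI simp: dist_norm lip K0)
  define D where "D k x = G (x + t k *\<^sub>R (h' + 2 *\<^sub>R h)) - 2 *\<^sub>R G (x + t k *\<^sub>R (h' + h))
      + G (x + t k *\<^sub>R h')" for k x
  define a where "a k = (\<integral>\<^sup>+x. ennreal ((norm (G (x + t k *\<^sub>R h) - G x))\<^sup>2) \<partial>lborel)" for k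
  define b where "b k = (\<integral>\<^sup>+x. ennreal ((norm (D k x))\<^sup>2) \<partial>lborel)" for k
  have mG[measurable]: "G \<in> borel_measurable borel"
    using contG by (rule borel_measurable_continuous_onI)
  have mD: "D k \<in> borel_measurable borel" for k
    unfolding D_def using mG by measurable
  have shift: "(\<integral>\<^sup>+x. ennreal ((norm (G (x + c + s *\<^sub>R h) - G (x + c)))\<^sup>2) \<partial>lborel)
      = (\<integral>\<^sup>+x. ennreal ((norm (G (x + s *\<^sub>R h) - G x))\<^sup>2) \<partial>lborel)" for c s
    by (intro nn_integral_lborel_translate[of "\<lambda>x. ennreal ((norm (G (x + s *\<^sub>R h) - G x))\<^sup>2)" c]) measurable
  have step: "b (Suc k) + a k = 4 * a (Suc k)" for k
  proof -
    let ?s = "t (Suc k)"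
    have ts: "t k = 2 * ?s" by (simp add: t_def)
    have pw: "(norm (D (Suc k) x))\<^sup>2 + (norm (G (x + ?s *\<^sub>R h' + t k *\<^sub>R h) - G (x + ?s *\<^sub>R h')))\<^sup>2
       = 2 * (norm (G (x + ?s *\<^sub>R (h' + h) + ?s *\<^sub>R h) - G (x + ?s *\<^sub>R (h' + h))))\<^sup>2
       + 2 * (norm (G (x + ?s *\<^sub>R h' + ?s *\<^sub>R h) - G (x + ?s *\<^sub>R h')))\<^sup>2" for x
    proof -
      have e1: "x + ?s *\<^sub>R h' + t k *\<^sub>R h = x + ?s *\<^sub>R (h' + 2 *\<^sub>R h)"
        and e2: "x + ?s *\<^sub>R (h' + h) + ?s *\<^sub>R h = x + ?s *\<^sub>R (h' + 2 *\<^sub>R h)"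
        and e3: "x + ?s *\<^sub>R h' + ?s *\<^sub>R h = x + ?s *\<^sub>R (h' + h)"
        by (simp_all add: ts algebra_simps flip: scaleR_2)
      show ?thesis unfolding D_def e1 e2 e3
        by (simp add: power2_norm_eq_inner inner_simps inner_commute algebra_simps)
    qed
    have "b (Suc k) + a k = (\<integral>\<^sup>+x. ennreal ((norm (D (Suc k) x))\<^sup>2)
        + ennreal ((norm (G (x + ?s *\<^sub>R h' + t k *\<^sub>R h) - G (x + ?s *\<^sub>R h')))\<^sup>2) \<partial>lborel)"
      unfolding a_def b_def using mD[of "Suc k"]
      by (subst shift[symmetric, of _ "?s *\<^sub>R h'"], subst nn_integral_add) auto
    also have "\<dots> = (\<integral>\<^sup>+x. 2 * ennreal ((norm (G (x + ?s *\<^sub>R (h' + h) + ?s *\<^sub>R h) - G (x + ?s *\<^sub>R (h' + h))))\<^sup>2)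
       + 2 * ennreal ((norm (G (x + ?s *\<^sub>R h' + ?s *\<^sub>R h) - G (x + ?s *\<^sub>R h')))\<^sup>2) \<partial>lborel)"
      using pw by (intro nn_integral_cong)
        (simp add: ennreal_mult' flip: ennreal_plus, simp add: ennreal_mult' ennreal_plus)
    also have "\<dots> = 2 * a (Suc k) + 2 * a (Suc k)"
      unfolding a_def using mG
      by (subst nn_integral_add; (subst nn_integral_cmult)?; (subst nn_integral_cmult)?;
          (subst shift)?; (subst shift)?; measurable)
    also have "\<dots> = 4 * a (Suc k)" by (simp flip: distrib_right)
    finally show ?thesis .
  qed
  \<comment> \<open>The increment over \<open>t k *\<^sub>R h\<close> vanishes outside the ball of
    radius \<open>R + norm h\<close>, because \<open>t k \<le> 1\<close>, and is at most
    \<open>K * norm h * t k\<close> inside; the weight \<open>4 ^ k\<close> cancels the square of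
    \<open>t k\<close>.\<close>
  define C where "C = ennreal ((K * norm h)\<^sup>2) * emeasure lborel (cball (0::'a) (R + norm h))"
  have Cfin: "C < \<infinity>"
    unfolding C_def using emeasure_lborel_cball_finite[of "0::'a" "R + norm h"]
    by (simp add: ennreal_mult_less_top)
  have abound: "4 ^ k * a k \<le> C" for k
  proof -
    have "ennreal ((norm (G (x + t k *\<^sub>R h) - G x))\<^sup>2)
        \<le> ennreal ((K * norm h)\<^sup>2 * (1/4)^k) * indicator (cball 0 (R + norm h)) x" for x
    proof (cases "norm x \<le> R + norm h")
      case True
      have "norm (G (x + t k *\<^sub>R h) - G x) \<le> K * norm h * t k"
        using lip[of "x + t k *\<^sub>R h" x] t0[of k] by (simp add: mult_ac)
      then have "(norm (G (x + t k *\<^sub>R h) - G x))\<^sup>2 \<le> (K * norm h * t k)\<^sup>2"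
        by (intro power_mono) auto
      also have "\<dots> = (K * norm h)\<^sup>2 * (1/4)^k"
        by (simp add: power_mult_distrib t_def power2_eq_square flip: power_mult_distrib)
      finally show ?thesis using True by (simp add: ennreal_leI)
    next
      case False
      have "t k * norm h \<le> norm h" using t1[of k] t0[of k] by (simp add: mult_left_le_one_le)
      then have "norm (x + t k *\<^sub>R h) \<ge> R"
        using False norm_triangle_ineq2[of x "- t k *\<^sub>R h"] t0[of k] by simp
      moreover have "norm x \<ge> R" using False norm_ge_zero[of h] by linarith
      ultimately show ?thesis by (simp add: supp)
    qed
    then have "a k \<le> (\<integral>\<^sup>+x. ennreal ((K * norm h)\<^sup>2 * (1/4)^k) * indicator (cball (0::'a) (R + norm h)) x \<partial>lborel)"
      unfolding a_def by - (rule nn_integral_mono, blast)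
    also have "\<dots> = ennreal ((K * norm h)\<^sup>2 * (1/4)^k) * emeasure lborel (cball (0::'a) (R + norm h))"
      by (subst nn_integral_cmult_indicator) auto
    finally have "4 ^ k * a k \<le> ennreal (4 ^ k) * (ennreal ((K * norm h)\<^sup>2 * (1/4)^k) * emeasure lborel (cball (0::'a) (R + norm h)))"
      by (simp add: mult_left_mono ennreal_power[symmetric] flip: ennreal_numeral)
    also have "\<dots> = C"
      unfolding C_def mult.assoc[symmetric]
      by (subst ennreal_mult'[symmetric]) (auto simp: power_divide)
    finally show ?thesis .
  qed
  have partial: "(\<Sum>k<N. 4 ^ k * b (Suc k)) + a 0 = 4 ^ N * a N" for N
  proof (induction N)
    case 0 then show ?case by simp
  next
    case (Suc N)
    have "(\<Sum>k<Suc N. 4 ^ k * b (Suc k)) + a 0 = 4 ^ N * b (Suc N) + 4 ^ N * a N"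
      using Suc by (simp add: algebra_simps)
    also have "\<dots> = 4 ^ N * (4 * a (Suc N))" by (simp add: step[symmetric] distrib_left)
    finally show ?case by (simp add: mult_ac)
  qed
  have "(\<Sum>k. 4 ^ k * b (Suc k)) \<le> C"
  proof (rule suminf_le_const)
    show "summable (\<lambda>k. 4 ^ k * b (Suc k))" by simp
    show "(\<Sum>k<N. 4 ^ k * b (Suc k)) \<le> C" for N
    proof -
      have "(\<Sum>k<N. 4 ^ k * b (Suc k)) \<le> (\<Sum>k<N. 4 ^ k * b (Suc k)) + a 0" by (rule le_iff_add[THEN iffD2]) blast
      also have "\<dots> \<le> C" unfolding partial by (rule abound)
      finally show ?thesis .
    qed
  qed
  moreover have "(\<Sum>k. 4 ^ k * b (Suc k)) = (\<integral>\<^sup>+x. (\<Sum>k. 4 ^ k * ennreal ((norm (D (Suc k) x))\<^sup>2)) \<partial>lborel)"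
  proof -
    have [measurable]: "(\<lambda>x. ennreal ((norm (D (Suc k) x))\<^sup>2)) \<in> borel_measurable lborel" for k
      using mD[of "Suc k"] by measurable
    have "4 ^ k * b (Suc k) = (\<integral>\<^sup>+x. 4 ^ k * ennreal ((norm (D (Suc k) x))\<^sup>2) \<partial>lborel)" for k
      unfolding b_def by (rule nn_integral_cmult[symmetric]) measurable
    then show ?thesis by (simp only:) (rule nn_integral_suminf[symmetric], measurable)
  qed
  ultimately have "(\<integral>\<^sup>+x. (\<Sum>k. 4 ^ k * ennreal ((norm (D (Suc k) x))\<^sup>2)) \<partial>lborel) \<noteq> \<infinity>"
    using Cfin by (metis leD)
  then have "AE x in lborel. (\<Sum>k. 4 ^ k * ennreal ((norm (D (Suc k) x))\<^sup>2)) \<noteq> \<infinity>"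
    using mD by (intro nn_integral_noteq_infinite) measurable
  then show ?thesis
  proof eventually_elim
    case (elim x)
    have "(\<Sum>k. ennreal (4 ^ k * (norm (D (Suc k) x))\<^sup>2)) \<noteq> top"
      using elim by (simp add: ennreal_mult' flip: ennreal_power)
    then have "summable (\<lambda>k. 4 ^ k * (norm (D (Suc k) x))\<^sup>2)"
      by (intro summable_suminf_not_top) auto
    then have "(\<lambda>k. 4 ^ k * (norm (D (Suc k) x))\<^sup>2) \<longlonglongrightarrow> 0"
      by (rule summable_LIMSEQ_zero)
    then have "(\<lambda>k. sqrt (4 ^ k * (norm (D (Suc k) x))\<^sup>2)) \<longlonglongrightarrow> sqrt 0"
      by (rule tendsto_real_sqrt)
    moreover have "sqrt (4 ^ k * (norm (D (Suc k) x))\<^sup>2) = 2 ^ k * norm (D (Suc k) x)" for k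
      by (simp add: real_sqrt_mult real_sqrt_power)
    ultimately have "(\<lambda>k. 2 * (2 ^ k * norm (D (Suc k) x))) \<longlonglongrightarrow> 2 * 0"
      by (intro tendsto_mult) auto
    then have "(\<lambda>k. norm (2 ^ Suc k *\<^sub>R D (Suc k) x)) \<longlonglongrightarrow> 0"
      by (simp add: mult_ac)
    then have "(\<lambda>k. 2 ^ Suc k *\<^sub>R D (Suc k) x) \<longlonglongrightarrow> 0"
      by (rule tendsto_norm_zero_cancel)
    then have "(\<lambda>k. 2 ^ k *\<^sub>R D k x) \<longlonglongrightarrow> 0"
      by (rule LIMSEQ_imp_Suc)
    then show ?case unfolding D_def t_def .
  qed
qed

text \<open>The extension is \<open>L x = n A (x / n)\<close> for any \<open>n \<ge> |x|\<close>.\<close>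

lemma additive_on_cball_imp_linear:
  fixes A :: "'a::real_normed_vector \<Rightarrow> 'b::real_normed_vector"
  assumes add: "\<And>x y. norm x \<le> 1 \<Longrightarrow> norm y \<le> 1 \<Longrightarrow> norm (x + y) \<le> 1 \<Longrightarrow> A (x + y) = A x + A y"
    and bd: "\<And>x. norm x \<le> 1 \<Longrightarrow> norm (A x) \<le> K * norm x"
  obtains L where "linear L" "\<And>x. norm x \<le> 1 \<Longrightarrow> L x = A x"
proof -
  have mul: "A (real m *\<^sub>R x) = real m *\<^sub>R A x" if "norm (real m *\<^sub>R x) \<le> 1" for m x
    using that
  proof (induction m)
    case 0
    then show ?case using bd[of 0] by simp
  next
    case (Suc m)
    have le: "norm (real m *\<^sub>R x) \<le> norm (real (Suc m) *\<^sub>R x)" "norm x \<le> norm (real (Suc m) *\<^sub>R x)"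
      unfolding norm_scaleR by (auto intro: mult_right_mono simp: distrib_right)
    have "A (real m *\<^sub>R x + x) = A (real m *\<^sub>R x) + A x"
      using Suc.prems le by (intro add) (auto simp: algebra_simps)
    then show ?case using Suc le by (simp add: algebra_simps)
  qed
  define N where "N x = Suc (nat \<lceil>norm x\<rceil>)" for x :: 'a
  have N: "norm x \<le> real (N x)" "N x \<ge> 1" for x
    unfolding N_def by linarith+
  define L where "L x = real (N x) *\<^sub>R A (x /\<^sub>R real (N x))" for x
  have small: "norm (x /\<^sub>R real n) \<le> 1" if "norm x \<le> real n" "n \<ge> 1" for x :: 'a and n
    using that by (simp add: field_simps)
  have L: "L x = real n *\<^sub>R A (x /\<^sub>R real n)" if n: "norm x \<le> real n" "n \<ge> 1" for x n
  proof -
    let ?y = "x /\<^sub>R real (n * N x)"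
    have e1: "x /\<^sub>R real (N x) = real n *\<^sub>R ?y" and e2: "x /\<^sub>R real n = real (N x) *\<^sub>R ?y"
      using n N[of x] by (auto simp: field_simps)
    have "A (real n *\<^sub>R ?y) = real n *\<^sub>R A ?y"
      by (rule mul, subst e1[symmetric], rule small) (use N in auto)
    moreover have "A (real (N x) *\<^sub>R ?y) = real (N x) *\<^sub>R A ?y"
      by (rule mul, subst e2[symmetric], rule small) (use n in auto)
    ultimately show ?thesis unfolding L_def e1 e2 by (simp add: mult.commute)
  qed
  have Ladd: "L (x + y) = L x + L y" for x y
  proof -
    define n where "n = N x + N y"
    have n: "norm x \<le> real n" "norm y \<le> real n" "norm (x + y) \<le> real n" "n \<ge> 1"
      using N[of x] N[of y] norm_triangle_ineq[of x y] by (auto simp: n_def)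
    have "A ((x + y) /\<^sub>R real n) = A (x /\<^sub>R real n) + A (y /\<^sub>R real n)"
      using add[OF small[OF n(1,4)] small[OF n(2,4)]] small[OF n(3,4)] by (simp only: scaleR_add_right)
    then show ?thesis using n by (simp add: L scaleR_add_right)
  qed
  have Lbd: "norm (L x) \<le> K * norm x" for x
  proof -
    have "norm (L x) \<le> real (N x) * (K * norm (x /\<^sub>R real (N x)))"
      unfolding L_def using bd[OF small[OF N(1) N(2), of x]] by (simp add: mult_left_mono)
    also have "\<dots> = K * norm x" using N(2)[of x] by simp
    finally show ?thesis .
  qed
  have Lnat: "L (real m *\<^sub>R x) = real m *\<^sub>R L x" for m x
  proof (induction m)
    case 0 then show ?case using Lbd[of 0] by simp
  next
    case (Suc m) then show ?case using Ladd[of "real m *\<^sub>R x" x] by (simp add: algebra_simps)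
  qed
  have Lneg: "L (- x) = - L x" for x
    using Ladd[of x "- x"] Lbd[of 0] by (simp add: eq_neg_iff_add_eq_0 add.commute)
  have Lint: "L (of_int j *\<^sub>R x) = of_int j *\<^sub>R L x" for j x
  proof (cases "j \<ge> 0")
    case True then show ?thesis using Lnat[of "nat j" x] by simp
  next
    case False then show ?thesis using Lnat[of "nat (- j)" x] Lneg[of "of_int j *\<^sub>R x"] by simp
  qed
  \<comment> \<open>Integer homogeneity leaves only the fractional part \<open>r\<close> of
    \<open>real n * c\<close>, so \<open>n\<close> times the defect stays below
    \<open>2 * (K * norm x)\<close> for every \<open>n\<close>; hence the defect is 0.\<close>
  have Lscale: "L (c *\<^sub>R x) = c *\<^sub>R L x" for c x
  proof (rule ccontr)
    assume "L (c *\<^sub>R x) \<noteq> c *\<^sub>R L x"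
    then have pos: "norm (L (c *\<^sub>R x) - c *\<^sub>R L x) > 0" by simp
    have K0: "0 \<le> K * norm x" using Lbd[of x] norm_ge_zero order_trans by blast
    obtain n :: nat where n: "real n * norm (L (c *\<^sub>R x) - c *\<^sub>R L x) > 2 * (K * norm x)"
      using reals_Archimedean3[OF pos] by blast
    define r where "r = real n * c - of_int \<lfloor>real n * c\<rfloor>"
    have r: "0 \<le> r" "r \<le> 1" unfolding r_def by linarith+
    have "(real n * c) *\<^sub>R x = of_int \<lfloor>real n * c\<rfloor> *\<^sub>R x + r *\<^sub>R x"
      unfolding r_def by (simp add: algebra_simps)
    then have "real n *\<^sub>R L (c *\<^sub>R x) = of_int \<lfloor>real n * c\<rfloor> *\<^sub>R L x + L (r *\<^sub>R x)"
      using Lnat[of n "c *\<^sub>R x"] Ladd Lint by simp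
    then have "real n *\<^sub>R (L (c *\<^sub>R x) - c *\<^sub>R L x) = L (r *\<^sub>R x) - r *\<^sub>R L x"
      unfolding r_def by (simp add: algebra_simps)
    then have "real n * norm (L (c *\<^sub>R x) - c *\<^sub>R L x) = norm (L (r *\<^sub>R x) - r *\<^sub>R L x)"
      by (metis norm_scaleR abs_of_nat)
    also have "\<dots> \<le> norm (L (r *\<^sub>R x)) + norm (r *\<^sub>R L x)" by (rule norm_triangle_ineq4)
    also have "\<dots> \<le> r * (K * norm x) + r * (K * norm x)"
      using Lbd[of "r *\<^sub>R x"] mult_left_mono[OF Lbd[of x] r(1)] r by (simp add: mult_ac)
    also have "\<dots> \<le> 2 * (K * norm x)" using mult_right_mono[OF r(2) K0] by linarith
    finally show False using n by simp
  qed
  show thesis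
  proof
    show "linear L" by (rule linearI) (auto simp: Ladd Lscale)
    show "L x = A x" if "norm x \<le> 1" for x using L[of x 1] that by simp
  qed
qed

text \<open>\<open>\<Gamma> n\<close> stands for difference quotients of a gradient at the
  \<open>n\<close>-th scale. Arzela-Ascoli gives a uniform limit on the unit ball; its second
  differences vanish, which is Jensen's equation, and with value 0 at 0 it is additive, hence
  linear. Second differences are controlled on a dense set \<open>E\<close> only, because an
  almost-everywhere statement can serve countably many directions; the common Lipschitz constant
  extends the control to all of them.\<close>

lemma affine_blowup_subsequence:
  fixes \<Gamma> :: "nat \<Rightarrow> 'a::euclidean_space \<Rightarrow> 'b::euclidean_space"
  assumes lip: "\<And>n x y. norm (\<Gamma> n x - \<Gamma> n y) \<le> K * norm (x - y)"
    and zero: "\<And>n. \<Gamma> n 0 = 0"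
    and dense: "\<And>X::'a set. open X \<Longrightarrow> X \<noteq> {} \<Longrightarrow> \<exists>d\<in>E. d \<in> X"
    and diff: "\<And>h h'. h \<in> E \<Longrightarrow> h' \<in> E \<Longrightarrow>
      (\<lambda>n. \<Gamma> n (h' + 2 *\<^sub>R h) - 2 *\<^sub>R \<Gamma> n (h' + h) + \<Gamma> n h') \<longlonglongrightarrow> 0"
  obtains L k where "linear L" "strict_mono (k :: nat \<Rightarrow> nat)"
    "\<And>e. e > 0 \<Longrightarrow> \<exists>N. \<forall>n\<ge>N. \<forall>h. norm h \<le> 1 \<longrightarrow> norm (\<Gamma> (k n) h - L h) < e"
proof -
  have K0: "K \<ge> 0"
  proof -
    obtain b :: 'a where "b \<in> Basis" by fastforce
    then have "norm b = 1" by simp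
    moreover have "0 \<le> K * norm (b - 0)" using lip[of 0 b 0] norm_ge_zero order_trans by blast
    ultimately show ?thesis by simp
  qed
  have bd: "norm (\<Gamma> n x) \<le> K * norm x" for n x using lip[of n x 0] zero by simp
  have diff': "(\<lambda>n. \<Gamma> n (h' + 2 *\<^sub>R h) - 2 *\<^sub>R \<Gamma> n (h' + h) + \<Gamma> n h') \<longlonglongrightarrow> 0" for h h'
  proof (rule LIMSEQ_I)
    fix r :: real assume r: "0 < r"
    \<comment> \<open>Moving both directions by less than \<open>s\<close> changes the three terms
      by at most 3, 4 and 1 times \<open>r / 16\<close>, in all \<open>r / 2\<close>, which fits
      beside the \<open>r / 4\<close> from the dense directions.\<close>
    define s where "s = r / (16 * (K + 1))"
    have s: "s > 0" using r K0 by (simp add: s_def)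
    have Ks: "K * s \<le> r / 16" unfolding s_def using K0 r
      by (simp add: field_simps)
    obtain d where d: "d \<in> E" "norm (d - h) < s" using dense[of "ball h s"] s by (auto simp: dist_norm norm_minus_commute)
    obtain d' where d': "d' \<in> E" "norm (d' - h') < s" using dense[of "ball h' s"] s by (auto simp: dist_norm norm_minus_commute)
    obtain N where N: "\<And>n. n \<ge> N \<Longrightarrow> norm (\<Gamma> n (d' + 2 *\<^sub>R d) - 2 *\<^sub>R \<Gamma> n (d' + d) + \<Gamma> n d' - 0) < r / 4"
      using LIMSEQ_D[OF diff[OF d(1) d'(1)], of "r/4"] r by auto
    have "norm (\<Gamma> n (h' + 2 *\<^sub>R h) - 2 *\<^sub>R \<Gamma> n (h' + h) + \<Gamma> n h' - 0) < r" if "n \<ge> N" for n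
    proof -
      have n1: "norm ((d' + 2 *\<^sub>R d) - (h' + 2 *\<^sub>R h)) \<le> 3 * s"
        using norm_triangle_ineq[of "d' - h'" "2 *\<^sub>R (d - h)"] d d' unfolding norm_scaleR by (simp add: algebra_simps)
      have n2: "norm ((d' + d) - (h' + h)) \<le> 2 * s"
        using norm_triangle_ineq[of "d' - h'" "d - h"] d d' by (simp add: algebra_simps)
      have b1: "norm (\<Gamma> n (d' + 2 *\<^sub>R d) - \<Gamma> n (h' + 2 *\<^sub>R h)) \<le> 3 * (r / 16)"
        using lip[of n "d' + 2 *\<^sub>R d" "h' + 2 *\<^sub>R h"] mult_left_mono[OF n1 K0] Ks by linarith
      have b2: "norm (2 *\<^sub>R (\<Gamma> n (d' + d) - \<Gamma> n (h' + h))) \<le> 4 * (r / 16)"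
        using lip[of n "d' + d" "h' + h"] mult_left_mono[OF n2 K0] Ks
        unfolding norm_scaleR by simp
      have b3: "norm (\<Gamma> n d' - \<Gamma> n h') \<le> r / 16"
        using lip[of n d' h'] mult_left_mono[OF less_imp_le[OF d'(2)] K0] Ks by linarith
      let ?P = "\<Gamma> n (d' + 2 *\<^sub>R d) - 2 *\<^sub>R \<Gamma> n (d' + d) + \<Gamma> n d'"
      have "\<Gamma> n (h' + 2 *\<^sub>R h) - 2 *\<^sub>R \<Gamma> n (h' + h) + \<Gamma> n h'
        = ?P - (\<Gamma> n (d' + 2 *\<^sub>R d) - \<Gamma> n (h' + 2 *\<^sub>R h)) + 2 *\<^sub>R (\<Gamma> n (d' + d) - \<Gamma> n (h' + h)) - (\<Gamma> n d' - \<Gamma> n h')"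
        by (simp add: algebra_simps)
      also have "norm \<dots> \<le> norm ?P + norm (\<Gamma> n (d' + 2 *\<^sub>R d) - \<Gamma> n (h' + 2 *\<^sub>R h))
          + norm (2 *\<^sub>R (\<Gamma> n (d' + d) - \<Gamma> n (h' + h))) + norm (\<Gamma> n d' - \<Gamma> n h')"
        by (intro order_trans[OF norm_triangle_ineq4] add_mono order_trans[OF norm_triangle_ineq] order_refl)
      also have "\<dots> < r" using N[OF that] b1 b2 b3 r by simp
      finally show ?thesis by simp
    qed
    then show "\<exists>N. \<forall>n\<ge>N. norm (\<Gamma> n (h' + 2 *\<^sub>R h) - 2 *\<^sub>R \<Gamma> n (h' + h) + \<Gamma> n h' - 0) < r" by blast
  qed
  obtain A k where A: "continuous_on (cball 0 1) A" and k: "strict_mono (k :: nat \<Rightarrow> nat)"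
    and conv: "\<And>e. 0 < e \<Longrightarrow> \<exists>N. \<forall>n x. n \<ge> N \<and> x \<in> cball 0 1 \<longrightarrow> norm (\<Gamma> (k n) x - A x) < e"
  proof (rule Arzela_Ascoli[of "cball (0::'a) 1" \<Gamma> K])
    show "norm (\<Gamma> n x) \<le> K" if "x \<in> cball 0 1" for n x
      using bd[of n x] mult_left_mono[of "norm x" 1 K] K0 that by simp
    show "\<exists>d>0. \<forall>n y. y \<in> cball 0 1 \<and> norm (x - y) < d \<longrightarrow> norm (\<Gamma> n x - \<Gamma> n y) < e" if "e > 0" for x e
    proof (intro exI conjI allI impI)
      show "0 < e / (K + 1)" using that K0 by simp
      fix n y assume "y \<in> cball 0 1 \<and> norm (x - y) < e / (K + 1)"
      then have "(K + 1) * norm (x - y) < e" using K0 by (simp add: field_simps)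
      moreover have "K * norm (x - y) \<le> (K + 1) * norm (x - y)" by (simp add: mult_right_mono)
      ultimately show "norm (\<Gamma> n x - \<Gamma> n y) < e" using lip[of n x y] by linarith
    qed
  qed auto
  have pt: "(\<lambda>n. \<Gamma> (k n) x) \<longlonglongrightarrow> A x" if "norm x \<le> 1" for x
    using conv that by (intro LIMSEQ_I) (meson mem_cball_0)
  have A0: "A 0 = 0" using pt[of 0] zero by (simp add: LIMSEQ_const_iff)
  have mid: "A (h' + 2 *\<^sub>R h) - 2 *\<^sub>R A (h' + h) + A h' = 0"
    if "norm h' \<le> 1" "norm (h' + h) \<le> 1" "norm (h' + 2 *\<^sub>R h) \<le> 1" for h h'
  proof (rule LIMSEQ_unique)
    show "(\<lambda>n. \<Gamma> (k n) (h' + 2 *\<^sub>R h) - 2 *\<^sub>R \<Gamma> (k n) (h' + h) + \<Gamma> (k n) h') \<longlonglongrightarrow> A (h' + 2 *\<^sub>R h) - 2 *\<^sub>R A (h' + h) + A h'"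
      using pt that by (intro tendsto_intros)
    show "(\<lambda>n. \<Gamma> (k n) (h' + 2 *\<^sub>R h) - 2 *\<^sub>R \<Gamma> (k n) (h' + h) + \<Gamma> (k n) h') \<longlonglongrightarrow> 0"
      using LIMSEQ_subseq_LIMSEQ[OF diff'[of h' h] k] by (simp add: o_def)
  qed
  have add: "A (x + y) = A x + A y" if n: "norm x \<le> 1" "norm y \<le> 1" "norm (x + y) \<le> 1" for x y
  proof -
    let ?m = "(1/2) *\<^sub>R (x + y)"
    have m: "norm ?m \<le> 1" using n(3) by (simp only: norm_scaleR)
    have "A (x + y) - 2 *\<^sub>R A ?m + A 0 = 0" using mid[of 0 ?m] m n by simp
    moreover have e: "x + (1/2) *\<^sub>R (y - x) = ?m"
      by (simp add: algebra_simps) (simp flip: scaleR_add_left)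
    have "A y - 2 *\<^sub>R A ?m + A x = 0" using mid[of x "(1/2) *\<^sub>R (y - x)"] m n unfolding e by simp
    ultimately have "A (x + y) - 2 *\<^sub>R A ?m = A y - 2 *\<^sub>R A ?m + A x" using A0 by simp
    then show ?thesis by (simp add: algebra_simps)
  qed
  have Abd: "norm (A x) \<le> K * norm x" if "norm x \<le> 1" for x
    using bd by (intro LIMSEQ_le_const2[OF tendsto_norm[OF pt[OF that]]]) auto
  obtain L where L: "linear L" "\<And>x. norm x \<le> 1 \<Longrightarrow> L x = A x"
    using additive_on_cball_imp_linear[of A K, OF add Abd] by blast
  show thesis
  proof (rule that[OF L(1) k])
    show "\<exists>N. \<forall>n\<ge>N. \<forall>h. norm h \<le> 1 \<longrightarrow> norm (\<Gamma> (k n) h - L h) < e" if "e > 0" for e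
      using conv[OF that] L(2) by fastforce
  qed
qed


lemma radial_Taylor_bound:
  fixes f :: "'a::real_inner \<Rightarrow> real"
  assumes f: "\<And>x. norm x < r \<Longrightarrow> (f has_derivative (\<lambda>h. P x \<bullet> h)) (at x)"
    and P: "\<And>x. norm x < r \<Longrightarrow> norm (P x - P 0 - L x) \<le> e"
    and L: "linear L" and h: "norm h < r"
  shows "\<bar>f h - f 0 - P 0 \<bullet> h - (1/2) * (h \<bullet> L h)\<bar> \<le> e * norm h"
proof -
  define g where "g s = f (s *\<^sub>R h) - s * (P 0 \<bullet> h) - s\<^sup>2 / 2 * (h \<bullet> L h)" for s :: real
  have in_r: "norm (s *\<^sub>R h) < r" if "0 \<le> s" "s \<le> 1" for s
    using h that mult_right_mono[of s 1 "norm h"] by simp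
  have dg: "(g has_real_derivative (P (s *\<^sub>R h) - P 0 - L (s *\<^sub>R h)) \<bullet> h) (at s)" if "0 \<le> s" "s \<le> 1" for s
  proof -
    have "((\<lambda>s. f (s *\<^sub>R h)) has_derivative (\<lambda>t. P (s *\<^sub>R h) \<bullet> (t *\<^sub>R h))) (at s)"
      using f[OF in_r[OF that]]
      by (rule has_derivative_compose[rotated]) (auto intro!: derivative_eq_intros)
    then have "((\<lambda>s. f (s *\<^sub>R h)) has_real_derivative P (s *\<^sub>R h) \<bullet> h) (at s)"
      by (simp add: has_field_derivative_def mult_commute_abs)
    then show ?thesis unfolding g_def
      by (auto intro!: derivative_eq_intros simp: linear_cmul[OF L] inner_simps inner_commute algebra_simps)
  qed
  obtain s where s: "0 < s" "s < 1" "g 1 - g 0 = (1 - 0) * ((P (s *\<^sub>R h) - P 0 - L (s *\<^sub>R h)) \<bullet> h)"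
    using MVT2[of 0 1 g "\<lambda>s. (P (s *\<^sub>R h) - P 0 - L (s *\<^sub>R h)) \<bullet> h"] dg by auto
  have "\<bar>g 1 - g 0\<bar> \<le> norm (P (s *\<^sub>R h) - P 0 - L (s *\<^sub>R h)) * norm h"
    using s(3) Cauchy_Schwarz_ineq2 by simp
  also have "\<dots> \<le> e * norm h"
    using P[OF in_r] s by (intro mult_right_mono) auto
  finally show ?thesis by (simp add: g_def)
qed

text \<open>The product with the cutoff is Lipschitz because \<open>P\<close> is bounded by
  \<open>M\<close> wherever the cutoff is nonzero. This supplies the compact support that
  \<open>second_difference_AE_tendsto\<close> asks for.\<close>

lemma cutoff_Lipschitz:
  fixes P :: "'a::real_normed_vector \<Rightarrow> 'b::real_normed_vector"
  assumes lip: "\<And>x y. norm (P x - P y) \<le> K * norm (x - y)" and K: "K \<ge> 0" and R: "R > 0"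
  obtains G K' where "\<And>x. norm x \<le> R \<Longrightarrow> G x = P x" "\<And>x. norm x \<ge> R + 1 \<Longrightarrow> G x = 0"
    "\<And>x y. norm (G x - G y) \<le> K' * norm (x - y)"
proof -
  define \<eta> where "\<eta> x = max 0 (min 1 (R + 1 - norm x))" for x :: 'a
  define M where "M = norm (P 0) + K * (R + 1)"
  have \<eta>: "0 \<le> \<eta> x" "\<eta> x \<le> 1" "norm x \<le> R \<Longrightarrow> \<eta> x = 1" "norm x \<ge> R + 1 \<Longrightarrow> \<eta> x = 0" for x
    by (auto simp: \<eta>_def)
  have \<eta>lip: "\<bar>\<eta> x - \<eta> y\<bar> \<le> norm (x - y)" for x y
    unfolding \<eta>_def using norm_triangle_ineq3[of x y] by linarith
  have key: "norm (\<eta> x *\<^sub>R P x - \<eta> y *\<^sub>R P y) \<le> (M + K) * norm (x - y)" if "norm y \<le> R + 1" for x y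
  proof -
    have "norm (P y) \<le> norm (P 0) + norm (P y - P 0)"
      by (metis norm_triangle_sub add.commute)
    also have "\<dots> \<le> M"
      unfolding M_def using lip[of y 0] mult_left_mono[OF that K] by simp
    finally have M: "norm (P y) \<le> M" .
    have "\<eta> x *\<^sub>R P x - \<eta> y *\<^sub>R P y = (\<eta> x - \<eta> y) *\<^sub>R P y + \<eta> x *\<^sub>R (P x - P y)"
      by (simp add: algebra_simps)
    also have "norm \<dots> \<le> \<bar>\<eta> x - \<eta> y\<bar> * norm (P y) + \<eta> x * norm (P x - P y)"
      using norm_triangle_ineq[of "(\<eta> x - \<eta> y) *\<^sub>R P y" "\<eta> x *\<^sub>R (P x - P y)"] \<eta>(1)[of x] by simp
    also have "\<dots> \<le> norm (x - y) * M + 1 * (K * norm (x - y))"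
      using \<eta>lip M lip \<eta>(1,2)[of x] by (intro add_mono mult_mono) auto
    finally show ?thesis by (simp add: algebra_simps)
  qed
  show thesis
  proof (rule that[of "\<lambda>x. \<eta> x *\<^sub>R P x" "M + K"])
    show "norm (\<eta> x *\<^sub>R P x - \<eta> y *\<^sub>R P y) \<le> (M + K) * norm (x - y)" for x y
    proof -
      have MK: "M + K \<ge> 0" unfolding M_def using K R by simp
      consider "norm y \<le> R + 1" | "norm x \<le> R + 1" | "norm x \<ge> R + 1" "norm y \<ge> R + 1" by linarith
      then show ?thesis
      proof cases
        case 2 then show ?thesis using key[of x y] by (simp add: norm_minus_commute)
      qed (use key MK \<eta> in auto)
    qed
  qed (use \<eta> in auto)
qed

text \<open>A substitute for Alexandrov's theorem: only one sequence of scales is controlled.\<close>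

lemma second_order_expansion_off_negligible:
  fixes \<Psi> :: "'a::euclidean_space \<Rightarrow> real"
  assumes der: "\<And>x. (\<Psi> has_derivative (\<lambda>h. P x \<bullet> h)) (at x)"
    and lip: "\<And>x y. norm (P x - P y) \<le> K * norm (x - y)"
  obtains N where "negligible N"
    "\<And>x. x \<notin> N \<Longrightarrow> \<exists>L. linear L \<and> (\<forall>\<delta>>0. \<forall>\<rho>>0. \<exists>r. 0 < r \<and> r < \<rho> \<and>
      (\<forall>h. norm h \<le> r \<longrightarrow> \<bar>\<Psi> (x + h) - \<Psi> x - P x \<bullet> h - (1/2) * (h \<bullet> L h)\<bar> \<le> \<delta> * r\<^sup>2))"
proof -
  have K0: "K \<ge> 0"
  proof -
    obtain b :: 'a where "b \<in> Basis" by fastforce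
    then have "norm b = 1" by simp
    moreover have "0 \<le> K * norm (b - 0)" using lip[of b 0] norm_ge_zero order_trans by blast
    ultimately show ?thesis by simp
  qed
  obtain E :: "'a set" where E: "countable E" "\<And>X. open X \<Longrightarrow> X \<noteq> {} \<Longrightarrow> \<exists>d\<in>E. d \<in> X"
    using countable_dense_exists by blast
  define \<Gamma> where "\<Gamma> x n h = 2 ^ n *\<^sub>R (P (x + (1/2)^n *\<^sub>R h) - P x)" for x :: 'a and n :: nat and h
  \<comment> \<open>The directions range over the countable set \<open>E\<close>, so that the
    exceptional null sets can be united.\<close>
  define good where "good x \<longleftrightarrow> (\<forall>h\<in>E. \<forall>h'\<in>E.
      (\<lambda>n. \<Gamma> x n (h' + 2 *\<^sub>R h) - 2 *\<^sub>R \<Gamma> x n (h' + h) + \<Gamma> x n h') \<longlonglongrightarrow> 0)" for x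
  have AE_R: "AE x in lborel. norm x < real j + 1 \<longrightarrow> good x" for j :: nat
  proof -
    define R where "R = real j + 1"
    have "R > 0" by (simp add: R_def)
    obtain G K' where G: "\<And>x. norm x \<le> R \<Longrightarrow> G x = P x" "\<And>x. norm x \<ge> R + 1 \<Longrightarrow> G x = 0"
      "\<And>x y. norm (G x - G y) \<le> K' * norm (x - y)"
      using cutoff_Lipschitz[OF lip K0 \<open>R > 0\<close>] by blast
    have "AE x in lborel. (\<lambda>k. 2 ^ k *\<^sub>R (G (x + (1/2)^k *\<^sub>R (h' + 2 *\<^sub>R h))
      - 2 *\<^sub>R G (x + (1/2)^k *\<^sub>R (h' + h)) + G (x + (1/2)^k *\<^sub>R h'))) \<longlonglongrightarrow> 0" for h h'
      using G \<open>R > 0\<close> by (intro second_difference_AE_tendsto[of G K' "R + 1"]) auto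
    then have "AE x in lborel. \<forall>h\<in>E. \<forall>h'\<in>E. (\<lambda>k. 2 ^ k *\<^sub>R (G (x + (1/2)^k *\<^sub>R (h' + 2 *\<^sub>R h))
      - 2 *\<^sub>R G (x + (1/2)^k *\<^sub>R (h' + h)) + G (x + (1/2)^k *\<^sub>R h'))) \<longlonglongrightarrow> 0"
      using E(1) by (simp add: AE_ball_countable)
    then show ?thesis
    proof eventually_elim
      case (elim x)
      show ?case
      proof
        assume "norm x < real j + 1"
        then have x: "norm x < R" by (simp add: R_def)
        have ev: "\<forall>\<^sub>F k in sequentially. norm (x + (1/2)^k *\<^sub>R h) \<le> R" for h
        proof -
          have "(\<lambda>k. norm (x + (1/2)^k *\<^sub>R h)) \<longlonglongrightarrow> norm (x + 0 *\<^sub>R h)"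
            by (intro tendsto_intros LIMSEQ_power_zero) auto
          then have "\<forall>\<^sub>F k in sequentially. norm (x + (1/2)^k *\<^sub>R h) < R"
            using x by (intro order_tendstoD) auto
          then show ?thesis by eventually_elim simp
        qed
        show "good x" unfolding good_def
        proof (intro ballI)
          fix h h' assume "h \<in> E" "h' \<in> E"
          show "(\<lambda>n. \<Gamma> x n (h' + 2 *\<^sub>R h) - 2 *\<^sub>R \<Gamma> x n (h' + h) + \<Gamma> x n h') \<longlonglongrightarrow> 0"
          proof (rule Lim_transform_eventually)
            show "(\<lambda>k. 2 ^ k *\<^sub>R (G (x + (1/2)^k *\<^sub>R (h' + 2 *\<^sub>R h))
               - 2 *\<^sub>R G (x + (1/2)^k *\<^sub>R (h' + h)) + G (x + (1/2)^k *\<^sub>R h'))) \<longlonglongrightarrow> 0"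
              using elim \<open>h \<in> E\<close> \<open>h' \<in> E\<close> by blast
            show "\<forall>\<^sub>F k in sequentially. 2 ^ k *\<^sub>R (G (x + (1/2)^k *\<^sub>R (h' + 2 *\<^sub>R h))
               - 2 *\<^sub>R G (x + (1/2)^k *\<^sub>R (h' + h)) + G (x + (1/2)^k *\<^sub>R h'))
               = \<Gamma> x k (h' + 2 *\<^sub>R h) - 2 *\<^sub>R \<Gamma> x k (h' + h) + \<Gamma> x k h'"
              using ev[of "h' + 2 *\<^sub>R h"] ev[of "h' + h"] ev[of h']
            proof eventually_elim
              case (elim k)
              show ?case unfolding \<Gamma>_def G(1)[OF elim(1)] G(1)[OF elim(2)] G(1)[OF elim(3)]
                by (simp add: algebra_simps flip: scaleR_2)
            qed
          qed
        qed
      qed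
    qed
  qed
  then have "AE x in lborel. \<forall>j. norm x < real j + 1 \<longrightarrow> good x"
    by (intro AE_all_countable[THEN iffD2] allI)
  then have "AE x in lborel. good x"
  proof eventually_elim
    case (elim x)
    obtain j :: nat where "norm x < real j" using reals_Archimedean2 by blast
    then show ?case using elim[rule_format, of j] by simp
  qed
  then obtain N where N: "N \<in> null_sets lborel" "{x. \<not> good x} \<subseteq> N"
    unfolding eventually_ae_filter by auto
  show thesis
  proof (rule that[of N])
    show "negligible N" using N(1) by (simp add: negligible_iff_null_sets null_sets_completionI)
    fix x assume "x \<notin> N"
    then have "good x" using N by blast
    have \<Gamma>lip: "norm (\<Gamma> x n y - \<Gamma> x n z) \<le> K * norm (y - z)" for n y z
    proof -
      have "\<Gamma> x n y - \<Gamma> x n z = 2 ^ n *\<^sub>R (P (x + (1/2)^n *\<^sub>R y) - P (x + (1/2)^n *\<^sub>R z))"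
        by (simp add: \<Gamma>_def algebra_simps)
      then have "norm (\<Gamma> x n y - \<Gamma> x n z) = 2 ^ n * norm (P (x + (1/2)^n *\<^sub>R y) - P (x + (1/2)^n *\<^sub>R z))"
        by simp
      also have "\<dots> \<le> 2 ^ n * (K * norm ((x + (1/2)^n *\<^sub>R y) - (x + (1/2)^n *\<^sub>R z)))"
        by (intro mult_left_mono lip) auto
      also have "(x + (1/2)^n *\<^sub>R y) - (x + (1/2)^n *\<^sub>R z) = (1/2)^n *\<^sub>R (y - z)"
        by (simp add: algebra_simps)
      finally show ?thesis by (simp add: power_divide)
    qed
    obtain L k where L: "linear L" and k: "strict_mono (k :: nat \<Rightarrow> nat)" and
      conv: "\<And>e. e > 0 \<Longrightarrow> \<exists>N. \<forall>n\<ge>N. \<forall>h. norm h \<le> 1 \<longrightarrow> norm (\<Gamma> x (k n) h - L h) < e"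
      using affine_blowup_subsequence[of "\<Gamma> x" K E, OF \<Gamma>lip _ E(2)] \<open>good x\<close>
      unfolding good_def by (auto simp: \<Gamma>_def)
    show "\<exists>L. linear L \<and> (\<forall>\<delta>>0. \<forall>\<rho>>0. \<exists>r. 0 < r \<and> r < \<rho> \<and>
      (\<forall>h. norm h \<le> r \<longrightarrow> \<bar>\<Psi> (x + h) - \<Psi> x - P x \<bullet> h - (1/2) * (h \<bullet> L h)\<bar> \<le> \<delta> * r\<^sup>2))"
    proof (intro exI[of _ L] conjI L allI impI)
      fix \<epsilon> \<rho> :: real assume \<epsilon>: "\<epsilon> > 0" and \<rho>: "\<rho> > 0"
      \<comment> \<open>The factor 4 pays for passing from the radius \<open>t\<close>, where the
        gradient is controlled, to \<open>t / 2\<close>, where the strict inequality in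
        \<open>radial_Taylor_bound\<close> is available.\<close>
      define \<delta> where "\<delta> = \<epsilon> / 4"
      have \<delta>: "\<delta> > 0" using \<epsilon> by (simp add: \<delta>_def)
      obtain n0 where n0: "\<And>n h. n \<ge> n0 \<Longrightarrow> norm h \<le> 1 \<Longrightarrow> norm (\<Gamma> x (k n) h - L h) < \<delta>"
        using conv[OF \<delta>] by blast
      obtain n1 where n1: "(1/2::real) ^ n1 < \<rho>" using real_arch_pow_inv[OF \<rho>, of "1/2"] by auto
      define n where "n = max n0 n1"
      define t where "t = (1/2::real) ^ k n"
      have "k n \<ge> n1" using seq_suble[OF k, of n] by (simp add: n_def)
      then have "t \<le> (1/2) ^ n1" unfolding t_def by (intro power_decreasing) auto
      then have t: "t > 0" "t < \<rho>" using n1 by (simp add: t_def, linarith)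
      have grad: "norm (P (x + y) - P x - L y) \<le> \<delta> * t" if "norm y \<le> t" for y
      proof -
        have "norm (\<Gamma> x (k n) (y /\<^sub>R t) - L (y /\<^sub>R t)) < \<delta>"
          using t that by (intro n0) (auto simp: n_def field_simps)
        moreover have "\<Gamma> x (k n) (y /\<^sub>R t) - L (y /\<^sub>R t) = (P (x + y) - P x - L y) /\<^sub>R t"
          using t(1) unfolding \<Gamma>_def linear_cmul[OF L] t_def
          by (simp add: power_divide algebra_simps)
        ultimately have "norm (P (x + y) - P x - L y) / t < \<delta>"
          using t by (simp add: divide_inverse mult.commute)
        then show ?thesis using t by (simp add: pos_divide_less_eq)
      qed
      have half: "\<bar>\<Psi> (x + h) - \<Psi> x - P x \<bullet> h - (1/2) * (h \<bullet> L h)\<bar> \<le> \<delta> * (t / 2)\<^sup>2 * 4" if "norm h \<le> t / 2" for h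
      proof -
        have "\<bar>\<Psi> (x + h) - \<Psi> (x + 0) - P (x + 0) \<bullet> h - (1/2) * (h \<bullet> L h)\<bar> \<le> (\<delta> * t) * norm h"
        proof (rule radial_Taylor_bound[of t "\<lambda>y. \<Psi> (x + y)" "\<lambda>y. P (x + y)"])
          show "((\<lambda>y. \<Psi> (x + y)) has_derivative (\<lambda>h. P (x + y) \<bullet> h)) (at y)" for y
            by (rule has_derivative_compose[OF _ der, of "\<lambda>y. x + y" "\<lambda>y. y" y UNIV])
              (auto intro!: derivative_eq_intros)
        qed (use grad L that t in auto)
        also have "\<dots> \<le> (\<delta> * t) * t" using that t \<delta> by (intro mult_left_mono) auto
        finally show ?thesis by (simp add: power2_eq_square)
      qed
      show "\<exists>r>0. r < \<rho> \<and> (\<forall>h. norm h \<le> r \<longrightarrow> \<bar>\<Psi> (x + h) - \<Psi> x - P x \<bullet> h - (1/2) * (h \<bullet> L h)\<bar> \<le> \<epsilon> * r\<^sup>2)"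
        using t half by (intro exI[of _ "t/2"]) (auto simp: \<delta>_def)
    qed
  qed
qed

text \<open>The expansions at \<open>x\<close> and at \<open>y\<close> are compared at the common
  point \<open>y + w\<close>, where \<open>w\<close> has the length of \<open>d = y - x\<close> and
  the direction of \<open>P y - P x\<close>. The remainders involve \<open>norm w\<close>,
  \<open>norm (d + w)\<close>, which is at most \<open>2 * norm d\<close>, and
  \<open>norm d\<close>; hence the factor 1 + 4 + 1 = 6.\<close>

lemma C11_gradient:
  fixes f :: "'a::real_inner \<Rightarrow> real"
  assumes "\<And>x. \<exists>p. \<forall>h. \<bar>f (x + h) - f x - p \<bullet> h\<bar> \<le> C * (norm h)\<^sup>2"
  obtains P where "\<And>x. (f has_derivative (\<lambda>h. P x \<bullet> h)) (at x)"
    "\<And>x y. norm (P x - P y) \<le> 6 * C * norm (x - y)"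
proof -
  obtain P where P: "\<And>x h. \<bar>f (x + h) - f x - P x \<bullet> h\<bar> \<le> C * (norm h)\<^sup>2"
    using assms by metis
  have der: "(f has_derivative (\<lambda>h. P x \<bullet> h)) (at x)" for x
  proof (rule has_derivativeI_sandwich[of 1])
    show "bounded_linear (\<lambda>h. P x \<bullet> h)" by (rule bounded_linear_inner_right)
    show "norm ((f y - f x) - (P x \<bullet> (y - x))) / norm (y - x) \<le> C * norm (y - x)" if "y \<noteq> x" for y
      using P[of x "y - x"] that by (simp add: divide_le_eq power2_eq_square mult_ac)
    show "((\<lambda>y. C * norm (y - x)) \<longlongrightarrow> 0) (at x)"
      by (auto intro!: tendsto_eq_intros)
  qed auto
  have lip: "norm (P x - P y) \<le> 6 * C * norm (x - y)" for x y
  proof (cases "x = y \<or> P x = P y")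
    case True
    have "0 \<le> C * (norm (x - y))\<^sup>2" using P[of x "x - y"] abs_ge_zero order_trans
      by blast
    then have "x \<noteq> y \<Longrightarrow> 0 \<le> C" by (simp add: zero_le_mult_iff)
    then show ?thesis using True by (cases "x = y") auto
  next
    case False
    then have ne: "P y \<noteq> P x" "y \<noteq> x" by auto
    define d where "d = y - x"
    define w where "w = (norm d / norm (P y - P x)) *\<^sub>R (P y - P x)"
    have d0: "norm d > 0" using ne by (simp add: d_def)
    have w: "norm w = norm d" using ne by (simp add: w_def)
    have C0: "C \<ge> 0" 
    proof -
      have "0 \<le> C * (norm d)\<^sup>2" using P[of x d] abs_ge_zero order_trans by blast
      then show ?thesis using d0 by (simp add: zero_le_mult_iff)
    qed
    have e: "f (y + w) = f (x + (d + w))" "f (x + d) = f y" by (simp_all add: d_def)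
    have "norm (d + w) \<le> 2 * norm d" using norm_triangle_ineq[of d w] w by simp
    then have "(norm (d + w))\<^sup>2 \<le> (2 * norm d)\<^sup>2" by (rule power_mono) simp
    then have dw: "C * (norm (d + w))\<^sup>2 \<le> C * (4 * (norm d)\<^sup>2)" using C0
      by (intro mult_left_mono) (simp_all add: power_mult_distrib)
    have "(P y - P x) \<bullet> w \<le> C * (norm w)\<^sup>2 + C * (norm (d + w))\<^sup>2 + C * (norm d)\<^sup>2"
      using P[of y w] P[of x "d + w"] P[of x d] unfolding e by (simp add: inner_simps abs_le_iff)
    also have "\<dots> \<le> 6 * C * (norm d)\<^sup>2" using dw w by simp
    also have "(P y - P x) \<bullet> w = norm d * norm (P y - P x)"
      using ne by (simp add: w_def dot_square_norm power2_eq_square)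
    finally have "norm d * norm (P y - P x) \<le> norm d * (6 * C * norm d)"
      by (simp add: power2_eq_square mult_ac)
    then show ?thesis using d0 by (simp add: d_def norm_minus_commute)
  qed
  show thesis using that[OF der lip] .
qed

section \<open>Sup-convolutions and their semiconcave envelopes\<close>

definition sup_convolution :: "real \<Rightarrow> 'a::euclidean_space set \<Rightarrow> ('a \<Rightarrow> real) \<Rightarrow> 'a \<Rightarrow> real" where
  "sup_convolution K D u x = (SUP z\<in>D. u z - K / 2 * (norm (z - x))\<^sup>2)"

text \<open>The smallest function \<open>g\<close> above \<open>sup_convolution K D u\<close> such that
  \<open>g - K / 2 |x|\<^sup>2\<close> is concave, as an infimal convolution.\<close>

definition semiconcave_envelope :: "real \<Rightarrow> 'a::euclidean_space set \<Rightarrow> ('a \<Rightarrow> real) \<Rightarrow> 'a \<Rightarrow> real" where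
  "semiconcave_envelope K D u x =
     (INF y. sup_convolution (K / 2) D u y + K / 2 * (norm (x - y))\<^sup>2)"

context
  fixes D :: "'a::euclidean_space set" and u :: "'a \<Rightarrow> real"
  assumes D: "compact D" "D \<noteq> {}" and u: "continuous_on D u"
begin

lemma sup_convolution_attained:
  obtains z where "z \<in> D" "sup_convolution k D u x = u z - k / 2 * (norm (z - x))\<^sup>2"
    "\<And>z'. z' \<in> D \<Longrightarrow> u z' - k / 2 * (norm (z' - x))\<^sup>2 \<le> sup_convolution k D u x"
proof -
  have "continuous_on D (\<lambda>z. u z - k / 2 * (norm (z - x))\<^sup>2)"
    by (intro continuous_intros u)
  then obtain z where z: "z \<in> D" "\<And>z'. z' \<in> D \<Longrightarrow> u z' - k / 2 * (norm (z' - x))\<^sup>2 \<le> u z - k / 2 * (norm (z - x))\<^sup>2"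
    using continuous_attains_sup[OF D] by meson
  have "sup_convolution k D u x = u z - k / 2 * (norm (z - x))\<^sup>2"
    unfolding sup_convolution_def by (rule cSup_eq_maximum) (use z in auto)
  then show thesis using that z by simp
qed

lemma sup_convolution_ge:
  "z \<in> D \<Longrightarrow> u z - k / 2 * (norm (z - x))\<^sup>2 \<le> sup_convolution k D u x"
  using sup_convolution_attained[of k x] by metis

lemma continuous_sup_convolution:
  assumes k: "k \<ge> 0"
  shows "continuous_on UNIV (sup_convolution k D u)"
proof -
  obtain B where B: "\<And>z. z \<in> D \<Longrightarrow> norm z \<le> B" "B \<ge> 0"
    using compact_imp_bounded[OF D(1)] unfolding bounded_pos by (meson less_imp_le)
  have key: "sup_convolution k D u x \<le> sup_convolution k D u y + k / 2 * ((2 * B + norm x + norm y) * norm (x - y))" for x y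
  proof -
    obtain z where z: "z \<in> D" "sup_convolution k D u x = u z - k / 2 * (norm (z - x))\<^sup>2"
      using sup_convolution_attained by metis
    have "(norm (z - y))\<^sup>2 - (norm (z - x))\<^sup>2 = (2 *\<^sub>R z - x - y) \<bullet> (x - y)"
      by (simp add: power2_norm_eq_inner inner_simps inner_commute algebra_simps)
    also have "\<dots> \<le> norm (2 *\<^sub>R z - x - y) * norm (x - y)" by (rule norm_cauchy_schwarz)
    also have "\<dots> \<le> (2 * B + norm x + norm y) * norm (x - y)"
      using norm_triangle_ineq4[of "2 *\<^sub>R z - x" y] norm_triangle_ineq4[of "2 *\<^sub>R z" x] B(1)[OF z(1)]
      by (intro mult_right_mono) auto
    finally have "k / 2 * (norm (z - y))\<^sup>2 \<le> k / 2 * (norm (z - x))\<^sup>2 + k / 2 * ((2 * B + norm x + norm y) * norm (x - y))"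
      using k by (simp add: mult_left_mono flip: distrib_left)
    then show ?thesis using sup_convolution_ge[OF z(1), of k y] z(2) by linarith
  qed
  show ?thesis unfolding continuous_on_def
  proof (intro ballI)
    fix x :: 'a
    let ?e = "\<lambda>y. k / 2 * ((2 * B + norm x + norm y) * norm (x - y))"
    have t: "(?e \<longlongrightarrow> ?e x) (at x within UNIV)" by (intro tendsto_intros)
    have "((\<lambda>y. sup_convolution k D u y - sup_convolution k D u x) \<longlongrightarrow> 0) (at x within UNIV)"
    proof (rule tendsto_sandwich)
      show "((\<lambda>y. - ?e y) \<longlongrightarrow> 0) (at x within UNIV)" "(?e \<longlongrightarrow> 0) (at x within UNIV)"
        using t tendsto_minus[OF t] by simp_all
      show "\<forall>\<^sub>F y in at x within UNIV. - ?e y \<le> sup_convolution k D u y - sup_convolution k D u x"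
        using key[of x] by (intro always_eventually) (simp add: algebra_simps)
      show "\<forall>\<^sub>F y in at x within UNIV. sup_convolution k D u y - sup_convolution k D u x \<le> ?e y"
        using key[of _ x] by (intro always_eventually) (simp add: algebra_simps norm_minus_commute)
    qed
    then show "(sup_convolution k D u \<longlongrightarrow> sup_convolution k D u x) (at x within UNIV)"
      by (simp add: Lim_null[symmetric])
  qed
qed

lemma sup_convolution_semiconvex:
  "2 * sup_convolution k D u y \<le> sup_convolution k D u (y + d) + sup_convolution k D u (y - d) + k * (norm d)\<^sup>2"
proof -
  obtain z where z: "z \<in> D" "sup_convolution k D u y = u z - k / 2 * (norm (z - y))\<^sup>2"
    using sup_convolution_attained[of k y] by metis
  have e: "(norm (z - (y + d)))\<^sup>2 + (norm (z - (y - d)))\<^sup>2 = 2 * (norm (z - y))\<^sup>2 + 2 * (norm d)\<^sup>2"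
    unfolding power2_norm_eq_inner by (simp add: inner_simps inner_commute algebra_simps)
  have "k / 2 * (norm (z - (y + d)))\<^sup>2 + k / 2 * (norm (z - (y - d)))\<^sup>2 = k * (norm (z - y))\<^sup>2 + k * (norm d)\<^sup>2"
    using arg_cong[OF e, of "\<lambda>t. k / 2 * t"] by (simp add: algebra_simps)
  then show ?thesis using sup_convolution_ge[OF z(1), of k "y + d"] sup_convolution_ge[OF z(1), of k "y - d"] z(2)
    by linarith
qed

context
  fixes K :: real
  assumes K: "K > 0"
begin

text \<open>The inner convolution falls off at most like \<open>K / 4\<close> times a squared
  distance, slower than the penalty \<open>K / 2\<close> grows, so the infimum can be restricted to
  a ball around \<open>x\<close>. The radius \<open>R\<close> makes the surplus
  \<open>K / 8 * (norm (x - y'))\<^sup>2\<close> exceed \<open>Q\<close>, the gap between the value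
  at \<open>x\<close> and the crude lower bound.\<close>

lemma semiconcave_envelope_attained:
  obtains y where "semiconcave_envelope K D u x = sup_convolution (K / 2) D u y + K / 2 * (norm (x - y))\<^sup>2"
    "\<And>y'. semiconcave_envelope K D u x \<le> sup_convolution (K / 2) D u y' + K / 2 * (norm (x - y'))\<^sup>2"
proof -
  let ?U = "sup_convolution (K / 2) D u"
  let ?g = "\<lambda>y. ?U y + K / 2 * (norm (x - y))\<^sup>2"
  obtain z where z: "z \<in> D" using D by blast
  define Q where "Q = ?U x - u z + 3 * K / 4 * (norm (z - x))\<^sup>2"
  define R where "R = sqrt (max 0 (8 / K * Q))"
  have R0: "R \<ge> 0" by (simp add: R_def)
  have cont: "continuous_on (cball x R) ?g"
    using continuous_on_subset[OF continuous_sup_convolution[of "K/2"]] K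
    by (intro continuous_intros) auto
  obtain y where y: "\<And>y'. y' \<in> cball x R \<Longrightarrow> ?g y \<le> ?g y'"
    using continuous_attains_inf[OF compact_cball _ cont] R0 by force
  have out: "?g y \<le> ?g y'" for y'
  proof (cases "y' \<in> cball x R")
    case False
    then have "R\<^sup>2 \<le> (norm (x - y'))\<^sup>2" using R0 by (intro power_mono) (auto simp: dist_norm)
    moreover have "8 / K * Q \<le> R\<^sup>2" by (simp add: R_def)
    ultimately have "8 / K * Q \<le> (norm (x - y'))\<^sup>2" by linarith
    then have far: "Q \<le> K / 8 * (norm (x - y'))\<^sup>2"
      using K by (simp add: field_simps)
    have "0 \<le> (norm (2 *\<^sub>R (z - x) - (x - y')))\<^sup>2" by simp
    then have this0: "(norm (z - y'))\<^sup>2 \<le> 3 * (norm (z - x))\<^sup>2 + 3 / 2 * (norm (x - y'))\<^sup>2"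
      unfolding power2_norm_eq_inner by (simp add: inner_simps inner_commute field_simps)
    from this0 have "K / 4 * (norm (z - y'))\<^sup>2 \<le> 3 * K / 4 * (norm (z - x))\<^sup>2 + 3 * K / 8 * (norm (x - y'))\<^sup>2"
      using mult_left_mono[OF this0, of "K / 4"] K by (simp add: algebra_simps)
    moreover have "u z - K / 4 * (norm (z - y'))\<^sup>2 \<le> ?U y'"
      using sup_convolution_ge[OF z, of "K/2" y'] by simp
    ultimately have "?g x \<le> ?g y'" using far by (simp add: Q_def)
    then show ?thesis using y[of x] R0 by simp
  qed (rule y)
  have "semiconcave_envelope K D u x = ?g y"
    unfolding semiconcave_envelope_def by (rule cInf_eq_minimum) (use out in auto)
  then show thesis using that out by simp
qed

lemma semiconcave_envelope_le:
  "semiconcave_envelope K D u x \<le> sup_convolution (K / 2) D u y + K / 2 * (norm (x - y))\<^sup>2"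
  using semiconcave_envelope_attained[of x] by metis

text \<open>This explains the parameter \<open>K / 2\<close> of the inner convolution: its kernel
  \<open>K / 4\<close> at \<open>z - y\<close> is dominated by \<open>K / 2\<close> at
  \<open>z - x\<close> plus \<open>K / 2\<close> at \<open>x - y\<close>, by the parallelogram
  law.\<close>

lemma sup_convolution_le_envelope: "sup_convolution K D u x \<le> semiconcave_envelope K D u x"
proof -
  obtain y where y: "semiconcave_envelope K D u x = sup_convolution (K / 2) D u y + K / 2 * (norm (x - y))\<^sup>2"
    using semiconcave_envelope_attained by metis
  obtain z where z: "z \<in> D" "sup_convolution K D u x = u z - K / 2 * (norm (z - x))\<^sup>2"
    using sup_convolution_attained[of K x] by metis
  have "0 \<le> (norm ((z - x) - (x - y)))\<^sup>2" by simp
  then have this0: "(norm (z - y))\<^sup>2 \<le> 2 * (norm (z - x))\<^sup>2 + 2 * (norm (x - y))\<^sup>2"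
    unfolding power2_norm_eq_inner by (simp add: inner_simps inner_commute algebra_simps)
  from this0 have "K / 4 * (norm (z - y))\<^sup>2 \<le> K / 2 * (norm (z - x))\<^sup>2 + K / 2 * (norm (x - y))\<^sup>2"
    using mult_left_mono[OF this0, of "K / 4"] K by (simp add: algebra_simps)
  then show ?thesis using sup_convolution_ge[OF z(1), of "K/2" y] y z(2) by simp
qed

text \<open>Semiconcavity puts \<open>q\<close> below a paraboloid of opening \<open>K\<close> that
  meets it at \<open>x\<close>; the vertex \<open>y\<close> of the paraboloid serves as competitor
  in the infimum. If \<open>z\<close> attains the inner convolution at \<open>y\<close>, then at the
  midpoint \<open>m\<close> of \<open>z\<close> and \<open>y\<close> the penalties with
  \<open>K / 2\<close> at \<open>z - m\<close> and at \<open>m - y\<close> add up to the single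
  penalty with \<open>K / 4\<close> at \<open>z - y\<close>.\<close>

lemma semiconcave_envelope_least:
  assumes le: "\<And>x. sup_convolution K D u x \<le> q x"
    and q: "\<And>x x'. q x' \<le> q x + p x \<bullet> (x' - x) + K / 2 * (norm (x' - x))\<^sup>2"
  shows "semiconcave_envelope K D u x \<le> q x"
proof -
  define y where "y = x - p x /\<^sub>R K"
  have q': "q x' \<le> q x + K / 2 * (norm (x' - y))\<^sup>2 - K / 2 * (norm (x - y))\<^sup>2" for x'
  proof -
    have "p x \<bullet> (x' - x) = K * ((x - y) \<bullet> (x' - x))" using K by (simp add: y_def)
    moreover have this0: "(x - y) \<bullet> (x' - x) + (norm (x' - x))\<^sup>2 / 2 = (norm (x' - y))\<^sup>2 / 2 - (norm (x - y))\<^sup>2 / 2"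
      by (simp add: power2_norm_eq_inner inner_simps inner_commute field_simps)
    from this0 have "K * ((x - y) \<bullet> (x' - x)) + K / 2 * (norm (x' - x))\<^sup>2 = K / 2 * (norm (x' - y))\<^sup>2 - K / 2 * (norm (x - y))\<^sup>2"
      using arg_cong[OF this0, of "\<lambda>t. K * t"] by (simp add: field_simps)
    ultimately show ?thesis using q[of x' x] by linarith
  qed
  obtain z where z: "z \<in> D" "sup_convolution (K/2) D u y = u z - K / 2 / 2 * (norm (z - y))\<^sup>2"
    using sup_convolution_attained[of "K/2" y] by metis
  define m where "m = (1/2) *\<^sub>R (z + y)"
  have m: "z - m = (1/2) *\<^sub>R (z - y)" "m - y = (1/2) *\<^sub>R (z - y)"
    by (simp_all add: m_def algebra_simps) (simp_all flip: scaleR_add_left)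
  have "u z - K / 2 * (norm (z - m))\<^sup>2 \<le> q x + K / 2 * (norm (m - y))\<^sup>2 - K / 2 * (norm (x - y))\<^sup>2"
    using sup_convolution_ge[OF z(1), of K m] le[of m] q'[of m] by linarith
  then have "sup_convolution (K/2) D u y + K / 2 * (norm (x - y))\<^sup>2 \<le> q x"
    unfolding z m by (simp add: power_mult_distrib power2_eq_square)
  then show ?thesis using semiconcave_envelope_le[of x y] by linarith
qed

text \<open>Infimal convolution preserves semiconvexity, with a worse constant, as long as its
  kernel \<open>K\<close> is stronger than the semiconvexity \<open>K / 2\<close> of the inner
  function. With optimal points \<open>y + d\<close> and \<open>y - d\<close> for
  \<open>x + h\<close> and \<open>x - h\<close>, the midpoint \<open>y\<close> competes at
  \<open>x\<close>, and \<open>K / 2 * (norm d)\<^sup>2\<close> is split between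
  \<open>h - d\<close> and \<open>h\<close>.\<close>

lemma semiconcave_envelope_semiconvex:
  "2 * semiconcave_envelope K D u x
     \<le> semiconcave_envelope K D u (x + h) + semiconcave_envelope K D u (x - h) + K * (norm h)\<^sup>2"
proof -
  let ?U = "sup_convolution (K / 2) D u"
  obtain y1 where y1: "semiconcave_envelope K D u (x + h) = ?U y1 + K / 2 * (norm (x + h - y1))\<^sup>2"
    using semiconcave_envelope_attained by metis
  obtain y2 where y2: "semiconcave_envelope K D u (x - h) = ?U y2 + K / 2 * (norm (x - h - y2))\<^sup>2"
    using semiconcave_envelope_attained by metis
  define y where "y = (1/2) *\<^sub>R (y1 + y2)"
  define d where "d = (1/2) *\<^sub>R (y1 - y2)"
  have yd: "y1 = y + d" "y2 = y - d"
    by (simp_all add: y_def d_def algebra_simps) (simp_all flip: scaleR_add_left)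
  have e: "(norm (x + h - (y + d)))\<^sup>2 + (norm (x - h - (y - d)))\<^sup>2 = 2 * (norm (x - y))\<^sup>2 + 2 * (norm (h - d))\<^sup>2"
    unfolding power2_norm_eq_inner by (simp add: inner_simps inner_commute algebra_simps)
  have e': "K / 2 * (norm (x + h - (y + d)))\<^sup>2 + K / 2 * (norm (x - h - (y - d)))\<^sup>2 = K * (norm (x - y))\<^sup>2 + K * (norm (h - d))\<^sup>2"
    using arg_cong[OF e, of "\<lambda>t. K / 2 * t"] by (simp add: algebra_simps)
  have "0 \<le> (norm (2 *\<^sub>R h - d))\<^sup>2" by simp
  then have this0: "(norm d)\<^sup>2 / 2 \<le> (norm (h - d))\<^sup>2 + (norm h)\<^sup>2"
    unfolding power2_norm_eq_inner by (simp add: inner_simps inner_commute algebra_simps)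
  from this0 have d: "K / 2 * (norm d)\<^sup>2 \<le> K * (norm (h - d))\<^sup>2 + K * (norm h)\<^sup>2"
    using mult_left_mono[OF this0, of K] K by (simp add: algebra_simps)
  have "2 * ?U y \<le> ?U y1 + ?U y2 + K / 2 * (norm d)\<^sup>2"
    using sup_convolution_semiconvex[of "K/2" y d] by (simp add: yd)
  then show ?thesis
    using semiconcave_envelope_le[of x y] e' d y1 y2 unfolding yd by (simp add: algebra_simps)
qed

text \<open>An optimal point for \<open>x\<close> gives a paraboloid of opening \<open>K\<close>
  above; semiconvexity reflects this bound from \<open>- h\<close> to \<open>h\<close> at the
  further cost \<open>K * (norm h)\<^sup>2\<close>. The two sides give \<open>3/2 * K\<close>, which
  \<open>C11_gradient\<close> multiplies by 6.\<close>

lemma semiconcave_envelope_gradient: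
  obtains P where "\<And>x. (semiconcave_envelope K D u has_derivative (\<lambda>h. P x \<bullet> h)) (at x)"
    "\<And>x y. norm (P x - P y) \<le> 9 * K * norm (x - y)"
proof -
  let ?f = "semiconcave_envelope K D u"
  have "\<exists>p. \<forall>h. \<bar>?f (x + h) - ?f x - p \<bullet> h\<bar> \<le> 3 / 2 * K * (norm h)\<^sup>2" for x
  proof -
    obtain y where y: "?f x = sup_convolution (K / 2) D u y + K / 2 * (norm (x - y))\<^sup>2"
      using semiconcave_envelope_attained by metis
    define p where "p = K *\<^sub>R (x - y)"
    have up: "?f (x + h) \<le> ?f x + p \<bullet> h + K / 2 * (norm h)\<^sup>2" for h
      using semiconcave_envelope_le[of "x + h" y] y unfolding p_def power2_norm_eq_inner
      by (simp add: inner_simps inner_commute algebra_simps)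
    have "\<bar>?f (x + h) - ?f x - p \<bullet> h\<bar> \<le> 3 / 2 * K * (norm h)\<^sup>2" for h
    proof -
      have "0 \<le> K * (norm h)\<^sup>2" using K by simp
      then show ?thesis
        using up[of h] up[of "- h"] semiconcave_envelope_semiconvex[of x h]
        unfolding abs_le_iff by (simp add: algebra_simps)
    qed
    then show ?thesis by blast
  qed
  then obtain P where "\<And>x. (?f has_derivative (\<lambda>h. P x \<bullet> h)) (at x)"
    "\<And>x y. norm (P x - P y) \<le> 6 * (3 / 2 * K) * norm (x - y)"
    using C11_gradient[of ?f "3/2 * K"] by blast
  then show thesis using that[of P] by simp
qed

end

end

text \<open>Jensen's argument. The maxima of \<open>f x + g y - q (x, y) - p \<bullet> (x, y)\<close>, with \<open>f\<close>, \<open>g\<close> the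
  sup-convolutions of \<open>u\<close>, \<open>w\<close>, are also maxima for the envelopes of \<open>f\<close>, \<open>g\<close>, which have Lipschitz
  gradients; so \<open>p\<close> is a Lipschitz function of the maximum point, and a negligible set of
  points can be avoided by the choice of \<open>p\<close>.\<close>

lemma upper_expansion_at_perturbed_maximum:
  fixes u w :: "'a::euclidean_space \<Rightarrow> real" and B :: "'a \<times> 'a \<Rightarrow> 'a \<times> 'a"
  assumes r: "r > 0" and u: "continuous_on (cball 0 r) u" and w: "continuous_on (cball 0 r) w"
    and zero: "u 0 = 0" "w 0 = 0"
    and B: "linear B" "\<And>x y. x \<bullet> B y = B x \<bullet> y"
    and le: "\<And>h k. norm h \<le> r \<Longrightarrow> norm k \<le> r \<Longrightarrow> u h + w k \<le> (1/2) * ((h, k) \<bullet> B (h, k))"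
    and \<delta>: "\<delta> > 0"
  obtains z1 z2 p1 p2 A1 A2 where "norm z1 < r" "norm z2 < r" "linear A1" "linear A2"
    "\<And>\<tau> \<rho>. \<tau> > 0 \<Longrightarrow> \<rho> > 0 \<Longrightarrow> \<exists>s. 0 < s \<and> s < \<rho> \<and>
       (\<forall>h. norm h \<le> s \<longrightarrow> u (z1 + h) \<le> u z1 + p1 \<bullet> h + (1/2) * (h \<bullet> A1 h) + \<tau> * s\<^sup>2)"
    "\<And>\<tau> \<rho>. \<tau> > 0 \<Longrightarrow> \<rho> > 0 \<Longrightarrow> \<exists>s. 0 < s \<and> s < \<rho> \<and>
       (\<forall>h. norm h \<le> s \<longrightarrow> w (z2 + h) \<le> w z2 + p2 \<bullet> h + (1/2) * (h \<bullet> A2 h) + \<tau> * s\<^sup>2)"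
    "\<And>h k. h \<bullet> A1 h + k \<bullet> A2 k \<le> (h, k) \<bullet> B (h, k) + 2 * \<delta> * ((norm h)\<^sup>2 + (norm k)\<^sup>2)"
proof -
  obtain \<beta> where \<beta>: "\<beta> > 0" "\<And>x. norm (B x) \<le> \<beta> * norm x"
    using linear_bounded_pos[OF B(1)] by blast
  \<comment> \<open>In \<open>bound\<close> the summands of \<open>K / 2\<close> absorb the form of
    \<open>B\<close> in the displacement \<zeta> and, after Young's inequality, the mixed term, and
    leave a spare 1 that bounds \<zeta>. Moreover \<open>K \<ge> \<beta> + \<delta>\<close> makes
    \<open>Q\<close> semiconcave enough for \<open>semiconcave_envelope_least\<close>.\<close>
  define K where "K = \<beta> + 2 * \<beta>\<^sup>2 / \<delta> + 2 + \<delta>"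
  have K: "K > 0" "K \<ge> \<beta> + \<delta>" using \<beta> \<delta> by (auto simp: K_def add_pos_nonneg)
  let ?D = "cball (0::'a) r"
  have D: "compact ?D" "?D \<noteq> {}" using r by auto
  define f where "f = sup_convolution K ?D u"
  define g where "g = sup_convolution K ?D w"
  define fh where "fh = semiconcave_envelope K ?D u"
  define gh where "gh = semiconcave_envelope K ?D w"
  note convs = f_def g_def fh_def gh_def
  have cf: "continuous_on UNIV f" "continuous_on UNIV g"
    unfolding convs using continuous_sup_convolution[OF D u] continuous_sup_convolution[OF D w] K by auto
  have ffh: "f x \<le> fh x" "g x \<le> gh x" for x
    unfolding convs using sup_convolution_le_envelope[OF D u K(1)] sup_convolution_le_envelope[OF D w K(1)] by auto
  obtain P1 where P1: "\<And>x. (fh has_derivative (\<lambda>h. P1 x \<bullet> h)) (at x)"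
    "\<And>x y. norm (P1 x - P1 y) \<le> 9 * K * norm (x - y)"
    unfolding fh_def by (rule semiconcave_envelope_gradient[OF D u K(1)]) blast
  obtain P2 where P2: "\<And>x. (gh has_derivative (\<lambda>h. P2 x \<bullet> h)) (at x)"
    "\<And>x y. norm (P2 x - P2 y) \<le> 9 * K * norm (x - y)"
    unfolding gh_def by (rule semiconcave_envelope_gradient[OF D w K(1)]) blast
  define \<Psi> where "\<Psi> z = fh (fst z) + gh (snd z)" for z
  define P where "P z = (P1 (fst z), P2 (snd z))" for z
  have der\<Psi>: "(\<Psi> has_derivative (\<lambda>h. P z \<bullet> h)) (at z)" for z
  proof -
    have "((\<lambda>z. fh (fst z)) has_derivative (\<lambda>h. P1 (fst z) \<bullet> fst h)) (at z)"
      by (rule has_derivative_compose[OF _ P1(1)]) (auto intro!: derivative_eq_intros)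
    moreover have "((\<lambda>z. gh (snd z)) has_derivative (\<lambda>h. P2 (snd z) \<bullet> snd h)) (at z)"
      by (rule has_derivative_compose[OF _ P2(1)]) (auto intro!: derivative_eq_intros)
    ultimately show ?thesis unfolding \<Psi>_def P_def inner_prod_def by (auto intro: has_derivative_add)
  qed
  have lipP: "norm (P y - P z) \<le> 18 * K * norm (y - z)" for y z
  proof -
    have "norm (P y - P z) \<le> norm (P1 (fst y) - P1 (fst z)) + norm (P2 (snd y) - P2 (snd z))"
      using norm_Pair_le[of "P1 (fst y) - P1 (fst z)" "P2 (snd y) - P2 (snd z)"] by (simp add: P_def)
    also have "\<dots> \<le> 9 * K * norm (fst y - fst z) + 9 * K * norm (snd y - snd z)"
      by (intro add_mono P1 P2)
    also have "\<dots> \<le> 9 * K * norm (y - z) + 9 * K * norm (y - z)"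
      using norm_fst_le[of "fst y - fst z" "snd y - snd z"] norm_snd_le[of "snd y - snd z" "fst y - fst z"] K
      by (intro add_mono mult_left_mono) (auto simp: minus_prod_def)
    finally show ?thesis by simp
  qed
  obtain N where N: "negligible N"
    "\<And>x. x \<notin> N \<Longrightarrow> \<exists>L. linear L \<and> (\<forall>\<tau>>0. \<forall>\<rho>>0. \<exists>s. 0 < s \<and> s < \<rho> \<and>
      (\<forall>h. norm h \<le> s \<longrightarrow> \<bar>\<Psi> (x + h) - \<Psi> x - P x \<bullet> h - (1/2) * (h \<bullet> L h)\<bar> \<le> \<tau> * s\<^sup>2))"
    by (rule second_order_expansion_off_negligible[OF der\<Psi> lipP]) blast
  define T where "T z = P z - B z - \<delta> *\<^sub>R z" for z
  have lipT: "norm (T y - T z) \<le> (18 * K + \<beta> + \<delta>) * norm (y - z)" for y z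
  proof -
    have "T y - T z = (P y - P z) - B (y - z) - \<delta> *\<^sub>R (y - z)"
      by (simp add: T_def linear_diff[OF B(1)] algebra_simps)
    also have "norm \<dots> \<le> norm (P y - P z) + norm (B (y - z)) + \<delta> * norm (y - z)"
      using norm_triangle_ineq4[of "(P y - P z) - B (y - z)" "\<delta> *\<^sub>R (y - z)"]
        norm_triangle_ineq4[of "P y - P z" "B (y - z)"] \<delta> by simp
    finally show ?thesis using lipP[of y z] \<beta>(2)[of "y - z"] by (simp add: algebra_simps)
  qed
  have negT: "negligible (T ` N)"
    by (rule negligible_locally_Lipschitz_image[OF order_refl N(1)])
       (intro exI[of _ UNIV] exI[of _ "18 * K + \<beta> + \<delta>"] conjI ballI lipT open_UNIV UNIV_I)
  \<comment> \<open>By \<open>bound\<close>, \<open>norm \<xi>\<close> is at most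
    \<open>4 / \<delta>\<close> times and \<open>norm (Z - \<xi>)\<close> at most
    \<open>2 / sqrt \<delta>\<close> times \<open>norm p\<close>, so this radius keeps
    \<open>Z\<close> in the open ball of radius \<open>r\<close>.\<close>
  define \<rho>0 where "\<rho>0 = r / (4 / \<delta> + 2 / sqrt \<delta> + 1)"
  have \<rho>0: "\<rho>0 > 0" unfolding \<rho>0_def using r \<delta> by (simp add: add_pos_pos)
  obtain p where p: "norm p < \<rho>0" "p \<notin> T ` N"
  proof -
    have "\<not> negligible (ball (0::'a\<times>'a) \<rho>0)" using \<rho>0 by (intro open_not_negligible) auto
    then have "\<not> ball 0 \<rho>0 \<subseteq> T ` N" using negT negligible_subset by blast
    then obtain p where "p \<in> ball 0 \<rho>0" "p \<notin> T ` N" by blast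
    then show ?thesis using that[of p] by simp
  qed
  \<comment> \<open>The extra \<open>\<delta> / 2 * (z \<bullet> z)\<close> confines the maxima to a
    neighbourhood of 0 after the tilt by \<open>p\<close>.\<close>
  define Q where "Q z = (1/2) * (z \<bullet> B z) + \<delta> / 2 * (z \<bullet> z) + p \<bullet> z" for z
  have Q: "Q (z + d) = Q z + (B z + \<delta> *\<^sub>R z + p) \<bullet> d + (1/2) * (d \<bullet> B d) + \<delta> / 2 * (d \<bullet> d)" for z d
    using B(2)[of d z] by (simp add: Q_def linear_add[OF B(1)] inner_simps inner_commute field_simps)
  define W where "W z = f (fst z) + g (snd z) - Q z" for z
  have W0: "W 0 \<ge> 0"
    using sup_convolution_ge[OF D u, where z=0 and k=K and x=0] sup_convolution_ge[OF D w, where z=0 and k=K and x=0] r zero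
    by (simp add: W_def f_def g_def Q_def linear_0[OF B(1)])
  have bound: "norm \<xi> \<le> 4 * norm p / \<delta> \<and> (norm (Z - \<xi>))\<^sup>2 \<le> 4 * (norm p)\<^sup>2 / \<delta>"
    if W: "W \<xi> \<ge> 0" and Z: "fst Z \<in> ?D" "f (fst \<xi>) = u (fst Z) - K / 2 * (norm (fst Z - fst \<xi>))\<^sup>2"
       "snd Z \<in> ?D" "g (snd \<xi>) = w (snd Z) - K / 2 * (norm (snd Z - snd \<xi>))\<^sup>2" for \<xi> Z
  proof -
    define \<zeta> where "\<zeta> = Z - \<xi>"
    have n\<zeta>: "(norm \<zeta>)\<^sup>2 = (norm (fst Z - fst \<xi>))\<^sup>2 + (norm (snd Z - snd \<xi>))\<^sup>2"
      unfolding \<zeta>_def power2_norm_eq_inner inner_prod_def by simp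
    have "u (fst Z) + w (snd Z) \<le> (1/2) * (Z \<bullet> B Z)"
      using le[of "fst Z" "snd Z"] Z by simp
    then have "K / 2 * (norm \<zeta>)\<^sup>2 \<le> (1/2) * (Z \<bullet> B Z) - Q \<xi>"
      using W Z unfolding W_def n\<zeta> by (simp add: algebra_simps)
    also have "\<dots> = \<xi> \<bullet> B \<zeta> + (1/2) * (\<zeta> \<bullet> B \<zeta>) - \<delta> / 2 * (\<xi> \<bullet> \<xi>) - p \<bullet> \<xi>"
    proof -
      have "Z = \<xi> + \<zeta>" by (simp add: \<zeta>_def)
      then show ?thesis using B(2)[of \<zeta> \<xi>]
        by (simp add: Q_def linear_add[OF B(1)] inner_simps inner_commute field_simps)
    qed
    also have "\<dots> \<le> \<beta> * (norm \<xi> * norm \<zeta>) + \<beta> / 2 * (norm \<zeta>)\<^sup>2 - \<delta> / 2 * (norm \<xi>)\<^sup>2 + norm p * norm \<xi>"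
    proof -
      have "\<xi> \<bullet> B \<zeta> \<le> norm \<xi> * (\<beta> * norm \<zeta>)"
        using norm_cauchy_schwarz[of \<xi> "B \<zeta>"] mult_left_mono[OF \<beta>(2), of "norm \<xi>" \<zeta>] by simp
      moreover have "\<zeta> \<bullet> B \<zeta> \<le> norm \<zeta> * (\<beta> * norm \<zeta>)"
        using norm_cauchy_schwarz[of \<zeta> "B \<zeta>"] mult_left_mono[OF \<beta>(2), of "norm \<zeta>" \<zeta>] by simp
      moreover have "- (p \<bullet> \<xi>) \<le> norm p * norm \<xi>"
        using norm_cauchy_schwarz[of "- p" \<xi>] by simp
      ultimately show ?thesis by (simp add: power2_norm_eq_inner[symmetric] power2_eq_square mult_ac)
    qed
    also have "\<beta> * (norm \<xi> * norm \<zeta>) \<le> \<delta> / 4 * (norm \<xi>)\<^sup>2 + \<beta>\<^sup>2 / \<delta> * (norm \<zeta>)\<^sup>2"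
    proof -
      have "0 \<le> (\<delta> / 2 * norm \<xi> - \<beta> * norm \<zeta>)\<^sup>2 / \<delta>" using \<delta> by simp
      then show ?thesis using \<delta> by (simp add: power2_eq_square field_simps)
    qed
    finally have "K / 2 * (norm \<zeta>)\<^sup>2 \<le> \<delta> / 4 * (norm \<xi>)\<^sup>2 + \<beta>\<^sup>2 / \<delta> * (norm \<zeta>)\<^sup>2
        + \<beta> / 2 * (norm \<zeta>)\<^sup>2 - \<delta> / 2 * (norm \<xi>)\<^sup>2 + norm p * norm \<xi>" by simp
    moreover have "K / 2 = \<beta> / 2 + \<beta>\<^sup>2 / \<delta> + 1 + \<delta> / 2" by (simp add: K_def)
    ultimately have main: "(norm \<zeta>)\<^sup>2 + \<delta> / 4 * (norm \<xi>)\<^sup>2 + \<delta> / 2 * (norm \<zeta>)\<^sup>2 \<le> norm p * norm \<xi>"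
      by (simp add: distrib_right)
    have pos: "0 \<le> \<delta> / 2 * (norm \<zeta>)\<^sup>2" "0 \<le> (norm \<zeta>)\<^sup>2" "0 \<le> \<delta> / 4 * (norm \<xi>)\<^sup>2" using \<delta> by auto
    have \<xi>: "norm \<xi> \<le> 4 * norm p / \<delta>"
    proof (cases "\<xi> = 0")
      case False
      have "\<delta> / 4 * (norm \<xi>)\<^sup>2 \<le> norm p * norm \<xi>" using main pos by linarith
      then have "\<delta> / 4 * norm \<xi> * norm \<xi> \<le> norm p * norm \<xi>" by (simp add: power2_eq_square)
      then have "\<delta> / 4 * norm \<xi> \<le> norm p" using False mult_right_le_imp_le by force
      then show ?thesis using \<delta> by (simp add: field_simps)
    qed (use \<delta> in simp)
    have "(norm \<zeta>)\<^sup>2 \<le> norm p * norm \<xi>" using main pos by linarith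
    also have "\<dots> \<le> norm p * (4 * norm p / \<delta>)" by (intro mult_left_mono \<xi>) auto
    finally show ?thesis using \<xi> by (simp add: \<zeta>_def power2_eq_square mult_ac)
  qed
  have maximizers: "\<exists>Z. fst Z \<in> ?D \<and> f (fst \<xi>) = u (fst Z) - K / 2 * (norm (fst Z - fst \<xi>))\<^sup>2 \<and>
       snd Z \<in> ?D \<and> g (snd \<xi>) = w (snd Z) - K / 2 * (norm (snd Z - snd \<xi>))\<^sup>2" for \<xi>
  proof -
    obtain z1 where "z1 \<in> ?D" "f (fst \<xi>) = u z1 - K / 2 * (norm (z1 - fst \<xi>))\<^sup>2"
      unfolding f_def by (rule sup_convolution_attained[OF D u]) blast
    moreover obtain z2 where "z2 \<in> ?D" "g (snd \<xi>) = w z2 - K / 2 * (norm (z2 - snd \<xi>))\<^sup>2"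
      unfolding g_def by (rule sup_convolution_attained[OF D w]) blast
    ultimately show ?thesis by (intro exI[of _ "(z1, z2)"]) simp
  qed
  define R where "R = 4 * norm p / \<delta>"
  have R: "R \<ge> 0" using \<delta> by (simp add: R_def)
  have contW: "continuous_on (cball 0 R) W"
    unfolding W_def Q_def
    using linear_continuous_on[OF linear_conv_bounded_linear[THEN iffD1, OF B(1)]]
    by (intro continuous_intros continuous_on_compose2[OF cf(1)] continuous_on_compose2[OF cf(2)]) auto
  obtain \<xi> where \<xi>: "\<xi> \<in> cball 0 R" "\<And>z. z \<in> cball 0 R \<Longrightarrow> W z \<le> W \<xi>"
    using continuous_attains_sup[OF compact_cball _ contW] R by force
  have \<xi>0: "W \<xi> \<ge> 0" using \<xi>(2)[of 0] R W0 by simp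
  have max: "W z \<le> W \<xi>" for z
  proof (cases "W z \<ge> 0")
    case True
    then have "norm z \<le> R" using bound[OF True] maximizers[of z] unfolding R_def by blast
    then show ?thesis using \<xi>(2) by simp
  qed (use \<xi>0 in linarith)
  obtain Z where Z: "fst Z \<in> ?D" "f (fst \<xi>) = u (fst Z) - K / 2 * (norm (fst Z - fst \<xi>))\<^sup>2"
       "snd Z \<in> ?D" "g (snd \<xi>) = w (snd Z) - K / 2 * (norm (snd Z - snd \<xi>))\<^sup>2"
    using maximizers by blast
  have nZ: "norm Z < r"
  proof -
    have b: "norm \<xi> \<le> 4 * norm p / \<delta>" "(norm (Z - \<xi>))\<^sup>2 \<le> 4 * (norm p)\<^sup>2 / \<delta>"
      using bound[OF \<xi>0 Z] by auto
    have "norm (Z - \<xi>) \<le> sqrt (4 * (norm p)\<^sup>2 / \<delta>)" using b(2) by (rule real_le_rsqrt)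
    also have "\<dots> = 2 / sqrt \<delta> * norm p" by (simp add: real_sqrt_divide real_sqrt_mult)
    finally have "norm Z \<le> 4 * norm p / \<delta> + 2 / sqrt \<delta> * norm p"
      using b(1) norm_triangle_ineq[of \<xi> "Z - \<xi>"] by simp
    also have "\<dots> \<le> (4 / \<delta> + 2 / sqrt \<delta> + 1) * norm p" by (simp add: algebra_simps)
    also have "\<dots> < (4 / \<delta> + 2 / sqrt \<delta> + 1) * \<rho>0"
      using p(1) \<delta> by (intro mult_strict_left_mono) (auto simp: add_pos_pos)
    also have "\<dots> = r"
    proof -
      have "4 / \<delta> + 2 / sqrt \<delta> + 1 > 0" using \<delta> by (simp add: add_pos_pos)
      then show ?thesis by (simp add: \<rho>0_def)
    qed
    finally show ?thesis .
  qed
  have nZ': "norm (fst Z) < r" "norm (snd Z) < r"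
    using nZ norm_fst_le[of "fst Z" "snd Z"] norm_snd_le[of "snd Z" "fst Z"] by auto
  have semiQ: "Q (z + d) \<le> Q z + (B z + \<delta> *\<^sub>R z + p) \<bullet> d + K / 2 * (norm d)\<^sup>2" for z d
  proof -
    have "d \<bullet> B d \<le> \<beta> * (norm d)\<^sup>2"
      using norm_cauchy_schwarz[of d "B d"] mult_left_mono[OF \<beta>(2), of "norm d" d]
      by (simp add: power2_eq_square mult_ac)
    moreover have "(\<beta> + \<delta>) * (norm d)\<^sup>2 \<le> K * (norm d)\<^sup>2" using K by (intro mult_right_mono) auto
    ultimately show ?thesis unfolding Q by (simp add: power2_norm_eq_inner[symmetric] algebra_simps)
  qed
  have fg: "f x + g y \<le> Q (x, y) + W \<xi>" for x y using max[of "(x, y)"] by (simp add: W_def)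
  \<comment> \<open>One variable at a time: with the other one fixed, the right-hand side is a
    semiconcave majorant of the convolution, hence of its envelope.\<close>
  have fhg: "fh x + g y \<le> Q (x, y) + W \<xi>" for x y
  proof -
    have "fh x \<le> Q (x, y) + W \<xi> - g y"
      unfolding fh_def
    proof (rule semiconcave_envelope_least[OF D u K(1), where q = "\<lambda>x. Q (x, y) + W \<xi> - g y"
          and p = "\<lambda>x. fst (B (x, y) + \<delta> *\<^sub>R (x, y) + p)"])
      show "sup_convolution K ?D u x \<le> Q (x, y) + W \<xi> - g y" for x
        using fg[of x y] by (simp add: f_def)
      show "Q (x', y) + W \<xi> - g y \<le> Q (x, y) + W \<xi> - g y + fst (B (x, y) + \<delta> *\<^sub>R (x, y) + p) \<bullet> (x' - x)
          + K / 2 * (norm (x' - x))\<^sup>2" for x x'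
        using semiQ[of "(x, y)" "(x' - x, 0)"] by (simp add: inner_prod_def)
    qed
    then show ?thesis by simp
  qed
  have fhgh: "fh x + gh y \<le> Q (x, y) + W \<xi>" for x y
  proof -
    have "gh y \<le> Q (x, y) + W \<xi> - fh x"
      unfolding gh_def
    proof (rule semiconcave_envelope_least[OF D w K(1), where q = "\<lambda>y. Q (x, y) + W \<xi> - fh x"
          and p = "\<lambda>y. snd (B (x, y) + \<delta> *\<^sub>R (x, y) + p)"])
      show "sup_convolution K ?D w y \<le> Q (x, y) + W \<xi> - fh x" for y
        using fhg[of x y] by (simp add: g_def)
      show "Q (x, y') + W \<xi> - fh x \<le> Q (x, y) + W \<xi> - fh x + snd (B (x, y) + \<delta> *\<^sub>R (x, y) + p) \<bullet> (y' - y)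
          + K / 2 * (norm (y' - y))\<^sup>2" for y y'
        using semiQ[of "(x, y)" "(0, y' - y)"] by (simp add: inner_prod_def)
    qed
    then show ?thesis by simp
  qed
  have top: "\<Psi> z \<le> Q z + W \<xi>" for z using fhgh[of "fst z" "snd z"] by (simp add: \<Psi>_def)
  have eq: "fh (fst \<xi>) = f (fst \<xi>)" "gh (snd \<xi>) = g (snd \<xi>)"
    using top[of \<xi>] ffh(1)[of "fst \<xi>"] ffh(2)[of "snd \<xi>"] by (auto simp: W_def \<Psi>_def)
  then have eq\<Psi>: "\<Psi> \<xi> = Q \<xi> + W \<xi>" by (simp add: W_def \<Psi>_def)
  have derQ: "(Q has_derivative (\<lambda>d. (B \<xi> + \<delta> *\<^sub>R \<xi> + p) \<bullet> d)) (at \<xi>)"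
  proof -
    have bl: "bounded_linear B" by (rule linear_conv_bounded_linear[THEN iffD1, OF B(1)])
    have d1: "((\<lambda>z. z \<bullet> B z) has_derivative (\<lambda>d. \<xi> \<bullet> B d + d \<bullet> B \<xi>)) (at \<xi>)"
      by (rule has_derivative_inner[OF has_derivative_ident bounded_linear_imp_has_derivative[OF bl]])
    have d2: "((\<lambda>z. z \<bullet> z) has_derivative (\<lambda>d. \<xi> \<bullet> d + d \<bullet> \<xi>)) (at \<xi>)"
      by (rule has_derivative_inner[OF has_derivative_ident has_derivative_ident])
    have d3: "((\<lambda>z. p \<bullet> z) has_derivative (\<lambda>d. p \<bullet> d)) (at \<xi>)"
      by (rule bounded_linear_imp_has_derivative[OF bounded_linear_inner_right])
    have "(Q has_derivative (\<lambda>d. (1/2) * (\<xi> \<bullet> B d + d \<bullet> B \<xi>) + \<delta> / 2 * (\<xi> \<bullet> d + d \<bullet> \<xi>) + p \<bullet> d)) (at \<xi>)"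
      unfolding Q_def by (intro has_derivative_add has_derivative_mult_right d1 d2 d3)
    moreover have "(1/2) * (\<xi> \<bullet> B d + d \<bullet> B \<xi>) + \<delta> / 2 * (\<xi> \<bullet> d + d \<bullet> \<xi>) + p \<bullet> d = (B \<xi> + \<delta> *\<^sub>R \<xi> + p) \<bullet> d" for d
      using B(2)[of \<xi> d] by (simp add: inner_add_left inner_commute[of d])
    ultimately show ?thesis by simp
  qed
  have grad: "P \<xi> = B \<xi> + \<delta> *\<^sub>R \<xi> + p"
  proof -
    have "((\<lambda>z. \<Psi> z - Q z) has_derivative (\<lambda>d. P \<xi> \<bullet> d - (B \<xi> + \<delta> *\<^sub>R \<xi> + p) \<bullet> d)) (at \<xi>)"
      by (intro has_derivative_diff der\<Psi> derQ)
    then have "(\<lambda>d. P \<xi> \<bullet> d - (B \<xi> + \<delta> *\<^sub>R \<xi> + p) \<bullet> d) = (\<lambda>d. 0)"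
      using top eq\<Psi> by (intro differential_zero_maxmin[of \<xi> UNIV]) (auto simp: algebra_simps)
    then have "(P \<xi> - (B \<xi> + \<delta> *\<^sub>R \<xi> + p)) \<bullet> d = 0" for d
      by (metis inner_diff_left)
    then have "P \<xi> - (B \<xi> + \<delta> *\<^sub>R \<xi> + p) = 0" by (rule inner_eq_zero_iff[THEN iffD1])
    then show ?thesis by simp
  qed
  \<comment> \<open>The tilt is recovered from the maximum point, so \<open>p\<close> lying outside
    the image of \<open>N\<close> puts \<xi> outside \<open>N\<close>, where the expansion is
    available.\<close>
  then have "p = T \<xi>" by (simp add: T_def)
  then have "\<xi> \<notin> N" using p(2) by blast
  then obtain L where L: "linear L" and exp: "\<And>\<tau> \<rho>. \<tau> > 0 \<Longrightarrow> \<rho> > 0 \<Longrightarrow> \<exists>s. 0 < s \<and> s < \<rho> \<and>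
      (\<forall>h. norm h \<le> s \<longrightarrow> \<bar>\<Psi> (\<xi> + h) - \<Psi> \<xi> - P \<xi> \<bullet> h - (1/2) * (h \<bullet> L h)\<bar> \<le> \<tau> * s\<^sup>2)"
    using N(2)[of \<xi>] by blast
  define A1 where "A1 h = fst (L (h, 0))" for h
  define A2 where "A2 k = snd (L (0, k))" for k
  have lin: "linear A1" "linear A2"
  proof -
    have "L (x + y, 0) = L (x, 0) + L (y, 0)" "L (0, x + y) = L (0, x) + L (0, y)" for x y
      using linear_add[OF L, of "(x, 0)" "(y, 0)"] linear_add[OF L, of "(0, x)" "(0, y)"] by simp_all
    moreover have "L (c *\<^sub>R x, 0) = c *\<^sub>R L (x, 0)" "L (0, c *\<^sub>R x) = c *\<^sub>R L (0, x)" for c x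
      using linear_cmul[OF L, of c "(x, 0)"] linear_cmul[OF L, of c "(0, x)"] by simp_all
    ultimately show "linear A1" "linear A2" by (auto intro!: linearI simp: A1_def A2_def)
  qed
  have e1: "\<bar>fh (fst \<xi> + h) - fh (fst \<xi>) - P1 (fst \<xi>) \<bullet> h - (1/2) * (h \<bullet> A1 h)\<bar> \<le> \<tau> * s\<^sup>2"
    if "\<forall>h. norm h \<le> s \<longrightarrow> \<bar>\<Psi> (\<xi> + h) - \<Psi> \<xi> - P \<xi> \<bullet> h - (1/2) * (h \<bullet> L h)\<bar> \<le> \<tau> * s\<^sup>2" "norm h \<le> s" for h \<tau> s
    using that(1)[rule_format, of "(h, 0)"] that(2) by (simp add: \<Psi>_def P_def inner_prod_def A1_def)
  have e2: "\<bar>gh (snd \<xi> + h) - gh (snd \<xi>) - P2 (snd \<xi>) \<bullet> h - (1/2) * (h \<bullet> A2 h)\<bar> \<le> \<tau> * s\<^sup>2"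
    if "\<forall>h. norm h \<le> s \<longrightarrow> \<bar>\<Psi> (\<xi> + h) - \<Psi> \<xi> - P \<xi> \<bullet> h - (1/2) * (h \<bullet> L h)\<bar> \<le> \<tau> * s\<^sup>2" "norm h \<le> s" for h \<tau> s
    using that(1)[rule_format, of "(0, h)"] that(2) by (simp add: \<Psi>_def P_def inner_prod_def A2_def)
  show thesis
  proof (rule that[OF nZ' lin])
    fix \<tau> \<rho> :: real assume \<tau>: "\<tau> > 0" and \<rho>: "\<rho> > 0"
    obtain s where s: "0 < s" "s < min \<rho> (r - norm (fst Z))" and
      s': "\<forall>h. norm h \<le> s \<longrightarrow> \<bar>\<Psi> (\<xi> + h) - \<Psi> \<xi> - P \<xi> \<bullet> h - (1/2) * (h \<bullet> L h)\<bar> \<le> \<tau> * s\<^sup>2"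
      using exp[OF \<tau>, of "min \<rho> (r - norm (fst Z))"] \<rho> nZ' by auto
    have "u (fst Z + h) \<le> u (fst Z) + P1 (fst \<xi>) \<bullet> h + (1/2) * (h \<bullet> A1 h) + \<tau> * s\<^sup>2" if h: "norm h \<le> s" for h
    proof -
      \<comment> \<open>Shifting base point and competitor by the same \<open>h\<close> leaves the
        penalty unchanged, so the expansion at \<open>fst \<xi>\<close> bounds \<open>u\<close> from
        above near \<open>fst Z\<close>.\<close>
      have "fst Z + h \<in> ?D" using h s norm_triangle_ineq[of "fst Z" h] by simp
      then have "u (fst Z + h) - K / 2 * (norm (fst Z - fst \<xi>))\<^sup>2 \<le> f (fst \<xi> + h)"
        using sup_convolution_ge[OF D u, where z="fst Z + h" and k=K and x="fst \<xi> + h"] by (simp add: f_def)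
      then show ?thesis using e1[OF s' h] ffh(1)[of "fst \<xi> + h"] Z(2) eq(1) by linarith
    qed
    then show "\<exists>s. 0 < s \<and> s < \<rho> \<and> (\<forall>h. norm h \<le> s \<longrightarrow>
        u (fst Z + h) \<le> u (fst Z) + P1 (fst \<xi>) \<bullet> h + (1/2) * (h \<bullet> A1 h) + \<tau> * s\<^sup>2)"
      using s by auto
  next
    fix \<tau> \<rho> :: real assume \<tau>: "\<tau> > 0" and \<rho>: "\<rho> > 0"
    obtain s where s: "0 < s" "s < min \<rho> (r - norm (snd Z))" and
      s': "\<forall>h. norm h \<le> s \<longrightarrow> \<bar>\<Psi> (\<xi> + h) - \<Psi> \<xi> - P \<xi> \<bullet> h - (1/2) * (h \<bullet> L h)\<bar> \<le> \<tau> * s\<^sup>2"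
      using exp[OF \<tau>, of "min \<rho> (r - norm (snd Z))"] \<rho> nZ' by auto
    have "w (snd Z + h) \<le> w (snd Z) + P2 (snd \<xi>) \<bullet> h + (1/2) * (h \<bullet> A2 h) + \<tau> * s\<^sup>2" if h: "norm h \<le> s" for h
    proof -
      have "snd Z + h \<in> ?D" using h s norm_triangle_ineq[of "snd Z" h] by simp
      then have "w (snd Z + h) - K / 2 * (norm (snd Z - snd \<xi>))\<^sup>2 \<le> g (snd \<xi> + h)"
        using sup_convolution_ge[OF D w, where z="snd Z + h" and k=K and x="snd \<xi> + h"] by (simp add: g_def)
      then show ?thesis using e2[OF s' h] ffh(2)[of "snd \<xi> + h"] Z(4) eq(2) by linarith
    qed
    then show "\<exists>s. 0 < s \<and> s < \<rho> \<and> (\<forall>h. norm h \<le> s \<longrightarrow>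
        w (snd Z + h) \<le> w (snd Z) + P2 (snd \<xi>) \<bullet> h + (1/2) * (h \<bullet> A2 h) + \<tau> * s\<^sup>2)"
      using s by auto
  next
    fix h k :: 'a
    show "h \<bullet> A1 h + k \<bullet> A2 k \<le> (h, k) \<bullet> B (h, k) + 2 * \<delta> * ((norm h)\<^sup>2 + (norm k)\<^sup>2)"
    proof (cases "(h, k) = 0")
      case True
      then show ?thesis using linear_0[OF B(1)] by (simp add: zero_prod_def)
    next
      case False
      obtain s where s: "0 < s" and
        s': "\<forall>h. norm h \<le> s \<longrightarrow> \<bar>\<Psi> (\<xi> + h) - \<Psi> \<xi> - P \<xi> \<bullet> h - (1/2) * (h \<bullet> L h)\<bar> \<le> \<delta> / 4 * s\<^sup>2"
        using exp[of "\<delta>/4" 1] \<delta> by auto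
      \<comment> \<open>The expansion is controlled at one radius \<open>s\<close> only, so
        \<open>(h, k)\<close> is scaled to norm exactly \<open>s\<close>. The errors
        \<open>\<delta> / 4\<close>, \<open>\<delta> / 4\<close> and \<open>\<delta> / 2\<close> add
        up to \<open>\<delta> * s\<^sup>2\<close>.\<close>
      define c where "c = s / norm (h, k)"
      have c: "c > 0" using s False by (simp add: c_def)
      have nc: "norm (c *\<^sub>R (h, k)) = s" using False s by (simp add: c_def del: scaleR_Pair)
      have nh: "norm (c *\<^sub>R h) \<le> s" "norm (c *\<^sub>R k) \<le> s"
        using nc norm_fst_le[of "c *\<^sub>R h" "c *\<^sub>R k"] norm_snd_le[of "c *\<^sub>R k" "c *\<^sub>R h"] by (auto simp: scaleR_Pair)
      have s2: "s\<^sup>2 = c\<^sup>2 * ((norm h)\<^sup>2 + (norm k)\<^sup>2)"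
        unfolding nc[symmetric] by (simp add: norm_Pair power_mult_distrib distrib_left)
      have "\<Psi> (\<xi> + c *\<^sub>R (h, k)) \<le> \<Psi> \<xi> + P \<xi> \<bullet> (c *\<^sub>R (h, k)) + (1/2) * c\<^sup>2 * ((h, k) \<bullet> B (h, k)) + \<delta> / 2 * s\<^sup>2"
      proof -
        have ww: "(c *\<^sub>R (h, k)) \<bullet> (c *\<^sub>R (h, k)) = s\<^sup>2" using nc by (simp only: dot_square_norm)
        have wB: "(c *\<^sub>R (h, k)) \<bullet> B (c *\<^sub>R (h, k)) = c\<^sup>2 * ((h, k) \<bullet> B (h, k))"
          by (simp add: linear_cmul[OF B(1)] power2_eq_square del: scaleR_Pair)
        show ?thesis
          using top[of "\<xi> + c *\<^sub>R (h, k)"] eq\<Psi> Q[of \<xi> "c *\<^sub>R (h, k)", unfolded ww wB]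
          unfolding grad mult.assoc by linarith
      qed
      moreover have "\<Psi> (\<xi> + c *\<^sub>R (h, k)) = fh (fst \<xi> + c *\<^sub>R h) + gh (snd \<xi> + c *\<^sub>R k)"
        by (simp add: \<Psi>_def)
      moreover have "P \<xi> \<bullet> (c *\<^sub>R (h, k)) = P1 (fst \<xi>) \<bullet> (c *\<^sub>R h) + P2 (snd \<xi>) \<bullet> (c *\<^sub>R k)"
        by (simp add: P_def inner_prod_def)
      moreover have "\<Psi> \<xi> = fh (fst \<xi>) + gh (snd \<xi>)" by (simp add: \<Psi>_def)
      ultimately have "(1/2) * (c *\<^sub>R h \<bullet> A1 (c *\<^sub>R h)) + (1/2) * (c *\<^sub>R k \<bullet> A2 (c *\<^sub>R k))
          \<le> (1/2) * c\<^sup>2 * ((h, k) \<bullet> B (h, k)) + \<delta> * s\<^sup>2"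
        unfolding mult.assoc using e1[OF s' nh(1)] e2[OF s' nh(2)] by linarith
      then have "c\<^sup>2 * (h \<bullet> A1 h + k \<bullet> A2 k) \<le> c\<^sup>2 * ((h, k) \<bullet> B (h, k) + 2 * \<delta> * ((norm h)\<^sup>2 + (norm k)\<^sup>2))"
        unfolding s2 by (simp add: linear_cmul[OF lin(1)] linear_cmul[OF lin(2)] power2_eq_square algebra_simps)
      then show ?thesis using c by (simp add: mult_le_cancel_left_pos)
    qed
  qed
qed

section \<open>Sub- and supersolutions\<close>

text \<open>The blow-up limits come without symmetry, but only their quadratic forms enter the
  expansions, and each form has a symmetric representative.\<close>

lemma symmetric_part_of_linear:
  fixes A :: "real ^ 'n \<Rightarrow> real ^ 'n"
  assumes "linear A"
  obtains S where "symmetric_matrix S" "\<And>h. h \<bullet> (S *v h) = h \<bullet> A h"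
proof -
  let ?M = "matrix A"
  let ?S = "(1/2) *\<^sub>R (?M + transpose ?M)"
  have "transpose ?S = ?S"
    by (simp add: transpose_def vec_eq_iff add.commute)
  moreover have "h \<bullet> (?S *v h) = h \<bullet> A h" for h
  proof -
    have "h \<bullet> (transpose ?M *v h) = h \<bullet> (?M *v h)"
      by (metis dot_lmul_matrix inner_commute transpose_matrix_vector)
    moreover have "?M *v h = A h" using assms by (simp add: matrix_works)
    ultimately show ?thesis
      by (simp add: scaleR_matrix_vector_assoc[symmetric] matrix_vector_mult_add_rdistrib inner_add_right)
  qed
  ultimately show thesis using that[of ?S] by (simp add: symmetric_matrix_def)
qed

lemma symmetric_matrix_add: "symmetric_matrix A \<Longrightarrow> symmetric_matrix B \<Longrightarrow> symmetric_matrix (A + B)"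
  and symmetric_matrix_diff: "symmetric_matrix A \<Longrightarrow> symmetric_matrix B \<Longrightarrow> symmetric_matrix (A - B)"
  and symmetric_matrix_uminus: "symmetric_matrix A \<Longrightarrow> symmetric_matrix (- A)"
  and symmetric_matrix_scaleR: "symmetric_matrix A \<Longrightarrow> symmetric_matrix (c *\<^sub>R A)"
  and symmetric_matrix_mat: "symmetric_matrix (mat c)"
  by (auto simp: symmetric_matrix_def transpose_def vec_eq_iff mat_def)

lemmas symmetric_matrix_intros = symmetric_matrix_add symmetric_matrix_diff symmetric_matrix_uminus
  symmetric_matrix_scaleR symmetric_matrix_mat

lemma symmetric_matrix_inner:
  fixes X :: "real ^ 'n ^ 'n"
  shows "symmetric_matrix X \<Longrightarrow> x \<bullet> (X *v y) = (X *v x) \<bullet> y"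
  by (metis dot_lmul_matrix transpose_matrix_vector symmetric_matrix_def)

lemma mat_mult_vec: "mat c *v (x :: real ^ 'n) = c *\<^sub>R x"
  by (simp add: matrix_vector_mult_def mat_def vec_eq_iff if_distrib[of "\<lambda>t. t * _"] cong: if_cong)

lemmas matrix_form_simps = matrix_vector_mult_add_rdistrib matrix_vector_mult_diff_rdistrib
  scaleR_matrix_vector_assoc[symmetric] mat_mult_vec

lemma matrix_vector_mult_uminus: "(- X) *v (y :: real ^ 'n) = - (X *v y)"
  using matrix_vector_mult_diff_rdistrib[of 0 X y] by simp

lemma trace_simps:
  fixes A B :: "real ^ 'n ^ 'n"
  shows "trace (mat c :: real ^ 'n ^ 'n) = c * real CARD('n)"
    and "trace (A + B) = trace A + trace B" and "trace (A - B) = trace A - trace B"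
  by (simp_all add: trace_def mat_def sum.distrib sum_subtractf)

text \<open>Testing with \<open>axis i 1 + axis j 1\<close> and \<open>axis i 1 - axis j 1\<close>
  bounds each entry by the mean of two diagonal ones; the sum over all pairs produces the factor
  \<open>CARD('n)\<close>. The bound is not sharp, but the factor only enters constants.\<close>

lemma nonneg_definite_entry_le_trace:
  fixes N :: "real ^ 'n ^ 'n"
  assumes N: "nonneg_definite N" and e: "norm e = 1"
  shows "e \<bullet> (N *v e) \<le> real CARD('n) * trace N"
proof -
  have sym: "N $ i $ j = N $ j $ i" for i j
    using N by (simp add: nonneg_definite_def symmetric_matrix_def transpose_def vec_eq_iff)
  have ax: "x \<bullet> (N *v axis i 1) = (\<Sum>k\<in>UNIV. x $ k * N $ k $ i)" for x i
    by (simp add: inner_vec_def matrix_vector_mult_basis column_def)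
  have ent: "axis i 1 \<bullet> (N *v axis j 1) = N $ i $ j" for i j
    by (simp add: inner_axis' matrix_vector_mult_basis column_def)
  have diag: "0 \<le> N $ i $ i" for i using N ent[of i i] by (metis nonneg_definite_def)
  have off: "\<bar>N $ i $ j\<bar> \<le> (N $ i $ i + N $ j $ j) / 2" for i j
  proof -
    have "0 \<le> (axis i 1 + axis j 1) \<bullet> (N *v (axis i 1 + axis j 1))"
      and "0 \<le> (axis i 1 - axis j 1) \<bullet> (N *v (axis i 1 - axis j 1))"
      using N by (auto simp: nonneg_definite_def)
    then show ?thesis using sym[of i j]
      by (simp add: matrix_vector_right_distrib matrix_vector_mult_diff_distrib inner_simps ent)
  qed
  have e1: "\<bar>e $ i\<bar> \<le> 1" for i using component_le_norm_cart[of e i] e by simp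
  have "e \<bullet> (N *v e) = (\<Sum>i\<in>UNIV. \<Sum>j\<in>UNIV. e $ i * (N $ i $ j * e $ j))"
    by (simp add: inner_vec_def matrix_vector_mult_def sum_distrib_left)
  also have "\<dots> \<le> (\<Sum>i\<in>(UNIV::'n set). \<Sum>j\<in>(UNIV::'n set). (N $ i $ i + N $ j $ j) / 2)"
  proof (intro sum_mono)
    fix i j
    have "e $ i * (N $ i $ j * e $ j) \<le> \<bar>e $ i\<bar> * (\<bar>N $ i $ j\<bar> * \<bar>e $ j\<bar>)"
      by (metis abs_ge_self abs_mult)
    also have "\<dots> \<le> 1 * (\<bar>N $ i $ j\<bar> * 1)" using e1 by (intro mult_mono) auto
    finally show "e $ i * (N $ i $ j * e $ j) \<le> (N $ i $ i + N $ j $ j) / 2" using off[of i j] by simp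
  qed
  also have "\<dots> = real CARD('n) * trace N"
    by (simp add: trace_def add_divide_distrib sum.distrib sum_divide_distrib[symmetric] sum_distrib_left[symmetric])
  finally show ?thesis .
qed

lemma nonneg_definite_trace: "nonneg_definite N \<Longrightarrow> 0 \<le> trace N"
  for N :: "real ^ 'n ^ 'n"
proof -
  assume N: "nonneg_definite N"
  have "axis i 1 \<bullet> (N *v axis i 1) = N $ i $ i" for i
    by (simp add: inner_axis' matrix_vector_mult_basis column_def)
  then have "0 \<le> N $ i $ i" for i using N by (metis nonneg_definite_def)
  then show ?thesis by (simp add: trace_def sum_nonneg)
qed

section \<open>Elliptic operators and duality\<close>

locale elliptic_operator =
  fixes F :: "real ^ 'n ^ 'n \<Rightarrow> real" and lam Lam :: real
  assumes lam: "0 < lam" "lam \<le> Lam"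
    and elliptic: "\<And>M N. symmetric_matrix M \<Longrightarrow> nonneg_definite N \<Longrightarrow>
        lam * trace N \<le> F (M - N) - F M \<and> F (M - N) - F M \<le> Lam * trace N"
    and homogeneous: "\<And>t M. t \<ge> 0 \<Longrightarrow> symmetric_matrix M \<Longrightarrow> F (t *\<^sub>R M) = t * F M"

lemma elliptic_operatorI:
  assumes "uniformly_elliptic F" "positively_homogeneous F"
  obtains lam Lam where "elliptic_operator F lam Lam"
  using assms unfolding uniformly_elliptic_def positively_homogeneous_def elliptic_operator_def by metis

lemma dual_dual_operator [simp]: "dual_operator (dual_operator F) = F"
  by (simp add: dual_operator_def fun_eq_iff)

context elliptic_operator
begin

lemma dual: "elliptic_operator (dual_operator F) lam Lam"
proof
  fix M N :: "real ^ 'n ^ 'n" assume MN: "symmetric_matrix M" "nonneg_definite N"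
  have "symmetric_matrix (N - M)" using MN by (auto intro: symmetric_matrix_intros simp: nonneg_definite_def)
  then show "lam * trace N \<le> dual_operator F (M - N) - dual_operator F M \<and>
        dual_operator F (M - N) - dual_operator F M \<le> Lam * trace N"
    using elliptic[of "N - M" N] MN by (simp add: dual_operator_def)
next
  fix t :: real and M :: "real ^ 'n ^ 'n" assume "t \<ge> 0" "symmetric_matrix M"
  then show "dual_operator F (t *\<^sub>R M) = t * dual_operator F M"
    using homogeneous[of t "- M"] by (simp add: dual_operator_def symmetric_matrix_uminus)
qed (use lam in auto)

lemma F_zero [simp]: "F 0 = 0"
  using homogeneous[of 0 "mat 1"] by (simp add: symmetric_matrix_mat)

text \<open>Ellipticity is used for \<open>mat C\<close>, from \<open>X\<close>, and for
  \<open>N = mat C - X + Y\<close>, from \<open>Y\<close>, since \<open>Y - N = X - mat C\<close>.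
  The trace of \<open>N\<close> dominates its entry along \<open>e\<close>, so one direction in
  which \<open>X - Y\<close> is very negative forces \<open>F Y < F X\<close>; this drives the
  Lipschitz estimate.\<close>

lemma F_le_of_form_diff_le:
  assumes X: "symmetric_matrix X" and Y: "symmetric_matrix Y" and C: "C \<ge> 0" and e: "norm e = 1"
    and le: "\<And>h. h \<bullet> (X *v h) - h \<bullet> (Y *v h) \<le> C * (norm h)\<^sup>2"
  shows "F Y \<le> F X + Lam * real CARD('n) * C
           - lam / real CARD('n) * (C - (e \<bullet> (X *v e) - e \<bullet> (Y *v e)))"
proof -
  define N where "N = mat C - X + Y"
  have form: "h \<bullet> (N *v h) = C * (norm h)\<^sup>2 - (h \<bullet> (X *v h) - h \<bullet> (Y *v h))" for h
    by (simp add: N_def matrix_form_simps inner_simps dot_square_norm)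
  have N: "nonneg_definite N"
    unfolding nonneg_definite_def using le form X Y
    by (auto simp: N_def intro!: symmetric_matrix_intros)
  have matC: "nonneg_definite (mat C :: real ^ 'n ^ 'n)"
    using C by (auto simp: nonneg_definite_def symmetric_matrix_mat mat_mult_vec)
  have "C - (e \<bullet> (X *v e) - e \<bullet> (Y *v e)) \<le> real CARD('n) * trace N"
    using nonneg_definite_entry_le_trace[OF N e] form[of e] e by simp
  then have "lam / real CARD('n) * (C - (e \<bullet> (X *v e) - e \<bullet> (Y *v e))) \<le> lam / real CARD('n) * (real CARD('n) * trace N)"
    using lam by (intro mult_left_mono) auto
  then have t: "lam / real CARD('n) * (C - (e \<bullet> (X *v e) - e \<bullet> (Y *v e))) \<le> lam * trace N" by simp
  have "F (X - mat C) - F X \<le> Lam * (C * real CARD('n))"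
    using elliptic[OF X matC] by (simp add: trace_simps)
  moreover have "Y - N = X - mat C" by (simp add: N_def)
  then have "lam * trace N \<le> F (X - mat C) - F Y" using elliptic[OF Y N] by simp
  ultimately show ?thesis using t by (simp add: mult_ac)
qed

lemma F_strict_antimono:
  assumes X: "symmetric_matrix X" and Y: "symmetric_matrix Y" and \<eta>: "\<eta> > 0"
    and le: "\<And>h. h \<bullet> (X *v h) - h \<bullet> (Y *v h) \<le> - \<eta> * (norm h)\<^sup>2"
  shows "F Y < F X"
proof -
  define N where "N = Y - X - mat \<eta>"
  have N: "nonneg_definite N"
    unfolding nonneg_definite_def using le X Y
    by (auto simp: N_def matrix_form_simps inner_simps dot_square_norm intro!: symmetric_matrix_intros
        simp: algebra_simps)
  have N': "nonneg_definite (N + mat \<eta>)"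
    using N \<eta> by (auto simp: nonneg_definite_def matrix_form_simps inner_simps intro!: symmetric_matrix_intros add_nonneg_nonneg)
  have "lam * trace (N + mat \<eta>) \<le> F (Y - (N + mat \<eta>)) - F Y" using elliptic[OF Y N'] by simp
  moreover have "Y - (N + mat \<eta>) = X" by (simp add: N_def)
  moreover have "trace (N + mat \<eta>) > 0"
    using nonneg_definite_trace[OF N] \<eta> by (simp add: trace_simps add_nonneg_pos)
  ultimately show ?thesis using lam by (smt (verit) mult_pos_pos)
qed

end

text \<open>Testing with quadratic polynomials only makes the Hessian symmetric by definition.\<close>

definition subsol :: "(real ^ 'n ^ 'n \<Rightarrow> real) \<Rightarrow> (real ^ 'n) set \<Rightarrow> (real ^ 'n \<Rightarrow> real) \<Rightarrow> bool" where
  "subsol F \<Omega> u \<longleftrightarrow> (\<forall>z X p s. 0 < s \<and> ball z s \<subseteq> \<Omega> \<and> symmetric_matrix X \<and>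
     (\<forall>h. norm h < s \<longrightarrow> u (z + h) \<le> u z + p \<bullet> h + (1/2) * (h \<bullet> (X *v h))) \<longrightarrow> F X \<le> 0)"

text \<open>Stated through the dual operator, so that results on subsolutions transfer by
  interpreting the locale at \<open>dual_operator F\<close>.\<close>

definition supersol :: "(real ^ 'n ^ 'n \<Rightarrow> real) \<Rightarrow> (real ^ 'n) set \<Rightarrow> (real ^ 'n \<Rightarrow> real) \<Rightarrow> bool" where
  "supersol F \<Omega> u \<longleftrightarrow> subsol (dual_operator F) \<Omega> (\<lambda>x. - u x)"

definition soln :: "(real ^ 'n ^ 'n \<Rightarrow> real) \<Rightarrow> (real ^ 'n) set \<Rightarrow> (real ^ 'n \<Rightarrow> real) \<Rightarrow> bool" where
  "soln F \<Omega> u \<longleftrightarrow> continuous_on \<Omega> u \<and> subsol F \<Omega> u \<and> supersol F \<Omega> u"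

lemma subsolD:
  "subsol F \<Omega> u \<Longrightarrow> 0 < s \<Longrightarrow> ball z s \<subseteq> \<Omega> \<Longrightarrow> symmetric_matrix X \<Longrightarrow>
   (\<And>h. norm h < s \<Longrightarrow> u (z + h) \<le> u z + p \<bullet> h + (1/2) * (h \<bullet> (X *v h))) \<Longrightarrow> F X \<le> 0"
  unfolding subsol_def by blast

lemma supersolD:
  assumes "supersol F \<Omega> u" "0 < s" "ball z s \<subseteq> \<Omega>" "symmetric_matrix X"
    "\<And>h. norm h < s \<Longrightarrow> u (z + h) \<ge> u z + p \<bullet> h + (1/2) * (h \<bullet> (X *v h))"
  shows "0 \<le> F X"
proof -
  have "dual_operator F (- X) \<le> 0"
    by (rule subsolD[OF assms(1)[unfolded supersol_def] assms(2,3), where p = "- p"])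
       (use assms(4) assms(5) in \<open>force simp: symmetric_matrix_uminus matrix_vector_mult_uminus algebra_simps\<close>)+
  then show ?thesis by (simp add: dual_operator_def)
qed

lemma subsol_mono: "subsol F \<Omega> u \<Longrightarrow> \<Omega>' \<subseteq> \<Omega> \<Longrightarrow> subsol F \<Omega>' u"
  unfolding subsol_def by (meson order_trans)

lemma supersol_mono: "supersol F \<Omega> u \<Longrightarrow> \<Omega>' \<subseteq> \<Omega> \<Longrightarrow> supersol F \<Omega>' u"
  unfolding supersol_def by (rule subsol_mono)

lemma soln_mono: "soln F \<Omega> u \<Longrightarrow> \<Omega>' \<subseteq> \<Omega> \<Longrightarrow> soln F \<Omega>' u"
  unfolding soln_def by (blast intro: subsol_mono supersol_mono continuous_on_subset)

lemma soln_dual: "soln F \<Omega> u \<Longrightarrow> soln (dual_operator F) \<Omega> (\<lambda>x. - u x)"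
  unfolding soln_def supersol_def by (auto intro: continuous_on_minus)

lemma subsol_add_const: "subsol F \<Omega> u \<Longrightarrow> subsol F \<Omega> (\<lambda>x. u x + c)"
  unfolding subsol_def by (simp add: algebra_simps)

lemma soln_add_const: "soln F \<Omega> u \<Longrightarrow> soln F \<Omega> (\<lambda>x. u x + c)"
  unfolding soln_def supersol_def using subsol_add_const[of _ \<Omega> "\<lambda>x. - u x" "- c"]
  by (auto intro: continuous_on_add continuous_on_const subsol_add_const)

lemma viscosity_subsolution_imp_subsol:
  assumes "viscosity_subsolution F \<Omega> u"
  shows "subsol F \<Omega> u"
  unfolding subsol_def
proof (intro allI impI, elim conjE)
  fix z X p s
  assume s: "0 < s" and b: "ball z s \<subseteq> \<Omega>" and X: "symmetric_matrix X"
    and le: "\<forall>h. norm h < s \<longrightarrow> u (z + h) \<le> u z + p \<bullet> h + (1/2) * (h \<bullet> (X *v h))"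
  define \<phi> where "\<phi> y = p \<bullet> (y - z) + (1/2) * ((y - z) \<bullet> (X *v (y - z)))" for y
  have mv: "((\<lambda>y. X *v (y - z)) has_derivative (\<lambda>h. X *v h)) (at x)" for x
  proof -
    have "((\<lambda>y. y - z) has_derivative (\<lambda>h. h)) (at x)" by (auto intro!: derivative_eq_intros)
    then show ?thesis by (rule bounded_linear.has_derivative[OF matrix_vector_mul_bounded_linear])
  qed
  have "C2_on (ball z s) \<phi> (\<lambda>y. p + X *v (y - z)) (\<lambda>_. X)"
    unfolding C2_on_def
  proof (intro conjI ballI open_ball continuous_on_const)
    fix x
    have d0: "((\<lambda>y. y - z) has_derivative (\<lambda>h. h)) (at x)" by (auto intro!: derivative_eq_intros)
    have "(\<phi> has_derivative (\<lambda>h. p \<bullet> h + (1/2) * ((x - z) \<bullet> (X *v h) + h \<bullet> (X *v (x - z))))) (at x)"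
      unfolding \<phi>_def
      by (intro has_derivative_add has_derivative_mult_right has_derivative_inner[OF d0 mv]
          bounded_linear.has_derivative[OF bounded_linear_inner_right d0])
    moreover have "p \<bullet> h + (1/2) * ((x - z) \<bullet> (X *v h) + h \<bullet> (X *v (x - z))) = (p + X *v (x - z)) \<bullet> h" for h
      using symmetric_matrix_inner[OF X, of "x - z" h] by (simp add: inner_add_left inner_commute[of h])
    ultimately show "(\<phi> has_derivative (\<lambda>h. (p + X *v (x - z)) \<bullet> h)) (at x)" by simp
    show "((\<lambda>y. p + X *v (y - z)) has_derivative (\<lambda>h. X *v h)) (at x)"
      using has_derivative_add[OF has_derivative_const[of p] mv] by simp
  qed
  moreover have "\<forall>y\<in>ball z s. u y - \<phi> y \<le> u z - \<phi> z"
  proof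
    fix y assume "y \<in> ball z s"
    then show "u y - \<phi> y \<le> u z - \<phi> z"
      using le[rule_format, of "y - z"] by (simp add: \<phi>_def dist_norm norm_minus_commute)
  qed
  ultimately show "F X \<le> 0"
    using assms b s unfolding viscosity_subsolution_def
    by (metis (no_types, lifting) centre_in_ball)
qed

lemma viscosity_supersolution_imp_supersol:
  assumes "viscosity_supersolution F \<Omega> u"
  shows "supersol F \<Omega> u"
proof -
  have C2: "C2_on U (\<lambda>x. - \<phi> x) (\<lambda>x. - g x) (\<lambda>x. - H x)" if "C2_on U \<phi> g H" for U \<phi> g H
    unfolding C2_on_def
  proof (intro conjI ballI)
    show "open U" "continuous_on U (\<lambda>x. - H x)"
      using that unfolding C2_on_def by (auto intro: continuous_on_minus)
    fix x assume x: "x \<in> U"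
    show "((\<lambda>x. - \<phi> x) has_derivative (\<lambda>h. - g x \<bullet> h)) (at x)"
      using has_derivative_minus[of \<phi> "\<lambda>h. g x \<bullet> h" "at x"] that x unfolding C2_on_def by simp
    show "((\<lambda>x. - g x) has_derivative (\<lambda>h. - H x *v h)) (at x)"
      using has_derivative_minus[of g "\<lambda>h. H x *v h" "at x"] that x unfolding C2_on_def
      by (simp add: matrix_vector_mult_uminus)
  qed
  have "viscosity_subsolution (dual_operator F) \<Omega> (\<lambda>x. - u x)"
    unfolding viscosity_subsolution_def
  proof (intro conjI allI impI, goal_cases)
    case 1
    then show ?case using assms by (auto simp: viscosity_supersolution_def intro: continuous_on_minus)
  next
    case (2 U \<phi> g H x)
    then have "\<forall>y\<in>U. u x - - \<phi> x \<le> u y - - \<phi> y" by auto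
    then have "0 \<le> F (- H x)"
      using 2 C2[of U \<phi> g H] assms unfolding viscosity_supersolution_def by blast
    then show ?case by (simp add: dual_operator_def)
  qed
  then show ?thesis unfolding supersol_def by (rule viscosity_subsolution_imp_subsol)
qed

lemma viscosity_solution_imp_soln: "viscosity_solution F \<Omega> u \<Longrightarrow> soln F \<Omega> u"
  unfolding viscosity_solution_def soln_def
  by (auto simp: viscosity_subsolution_imp_subsol viscosity_supersolution_imp_supersol)
     (auto simp: viscosity_subsolution_def)

lemma (in elliptic_operator) subsol_scaleR:
  assumes u: "subsol F \<Omega> u" and c: "c > 0"
  shows "subsol F \<Omega> (\<lambda>x. c * u x)"
  unfolding subsol_def
proof (intro allI impI, elim conjE)
  fix z X p s
  assume s: "0 < s" and b: "ball z s \<subseteq> \<Omega>" and X: "symmetric_matrix X"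
    and le: "\<forall>h. norm h < s \<longrightarrow> c * u (z + h) \<le> c * u z + p \<bullet> h + (1/2) * (h \<bullet> (X *v h))"
  have "F ((1/c) *\<^sub>R X) \<le> 0"
  proof (rule subsolD[OF u s b, where p = "(1/c) *\<^sub>R p"])
    fix h :: "real ^ 'n" assume "norm h < s"
    then have "(1/c) * (c * u (z + h)) \<le> (1/c) * (c * u z + p \<bullet> h + (1/2) * (h \<bullet> (X *v h)))"
      using le c by (intro mult_left_mono) auto
    then show "u (z + h) \<le> u z + (1/c) *\<^sub>R p \<bullet> h + 1 / 2 * (h \<bullet> ((1/c) *\<^sub>R X *v h))"
      using c by (simp add: matrix_form_simps algebra_simps)
  qed (use X in \<open>auto intro: symmetric_matrix_intros\<close>)
  then show "F X \<le> 0" using homogeneous[of "1/c" X] c X by (simp add: divide_le_0_iff)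
qed

lemma (in elliptic_operator) subsol_rescale:
  assumes u: "subsol F \<Omega> u" and R: "R > 0"
  shows "subsol F {x. a + R *\<^sub>R x \<in> \<Omega>} (\<lambda>x. u (a + R *\<^sub>R x))"
  unfolding subsol_def
proof (intro allI impI, elim conjE)
  fix z X p s
  assume s: "0 < s" and b: "ball z s \<subseteq> {x. a + R *\<^sub>R x \<in> \<Omega>}" and X: "symmetric_matrix X"
    and le: "\<forall>h. norm h < s \<longrightarrow> u (a + R *\<^sub>R (z + h)) \<le> u (a + R *\<^sub>R z) + p \<bullet> h + (1/2) * (h \<bullet> (X *v h))"
  have "F ((1/R\<^sup>2) *\<^sub>R X) \<le> 0"
  proof (rule subsolD[OF u, where p = "(1/R) *\<^sub>R p" and z = "a + R *\<^sub>R z" and s = "R * s"])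
    show "ball (a + R *\<^sub>R z) (R * s) \<subseteq> \<Omega>"
    proof
      fix y assume "y \<in> ball (a + R *\<^sub>R z) (R * s)"
      then have n: "norm (y - (a + R *\<^sub>R z)) < R * s" by (simp add: dist_norm norm_minus_commute)
      have "(1/R) *\<^sub>R (y - a) - z = (1/R) *\<^sub>R (y - (a + R *\<^sub>R z))" using R by (simp add: algebra_simps)
      then have "norm ((1/R) *\<^sub>R (y - a) - z) = norm (y - (a + R *\<^sub>R z)) / R"
        using R by simp
      also have "\<dots> < s" using n R by (simp add: pos_divide_less_eq mult.commute)
      finally have "(1/R) *\<^sub>R (y - a) \<in> ball z s" by (simp add: dist_norm norm_minus_commute)
      then show "y \<in> \<Omega>" using b R by auto
    qed
    fix h :: "real ^ 'n" assume "norm h < R * s"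
    then have "norm ((1/R) *\<^sub>R h) < s" using R by (simp add: pos_divide_less_eq mult.commute)
    then show "u (a + R *\<^sub>R z + h) \<le> u (a + R *\<^sub>R z) + (1/R) *\<^sub>R p \<bullet> h + 1 / 2 * (h \<bullet> ((1/R\<^sup>2) *\<^sub>R X *v h))"
      using le[rule_format, of "(1/R) *\<^sub>R h"] R
      by (simp add: matrix_form_simps scaleR_right_distrib matrix_vector_mult_scaleR power2_eq_square add.assoc)
  qed (use X s R in \<open>auto intro: symmetric_matrix_intros\<close>)
  then show "F X \<le> 0" using homogeneous[of "1/R\<^sup>2" X] R X by (simp add: divide_le_0_iff)
qed

lemma (in elliptic_operator) soln_scaleR:
  assumes "soln F \<Omega> u" "c > 0"
  shows "soln F \<Omega> (\<lambda>x. c * u x)"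
proof -
  interpret d: elliptic_operator "dual_operator F" lam Lam by (rule dual)
  show ?thesis
    using subsol_scaleR[of \<Omega> u c] d.subsol_scaleR[of \<Omega> "\<lambda>x. - u x" c] assms
    unfolding soln_def supersol_def by (auto intro: continuous_on_mult_left)
qed

lemma (in elliptic_operator) soln_rescale:
  assumes u: "soln F \<Omega> u" "R > 0"
  shows "soln F {x. a + R *\<^sub>R x \<in> \<Omega>} (\<lambda>x. u (a + R *\<^sub>R x))"
proof -
  interpret d: elliptic_operator "dual_operator F" lam Lam by (rule dual)
  have "continuous_on {x. a + R *\<^sub>R x \<in> \<Omega>} (\<lambda>x. u (a + R *\<^sub>R x))"
    by (rule continuous_on_compose2[OF u(1)[unfolded soln_def, THEN conjunct1]])
       (auto intro!: continuous_intros)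
  then show ?thesis
    using subsol_rescale[of \<Omega> u R a] d.subsol_rescale[of \<Omega> "\<lambda>x. - u x" R a] u
    unfolding soln_def supersol_def by auto
qed

text \<open>Touching up to \<open>\<tau> s\<^sup>2\<close> on one ball of radius \<open>s\<close> is enough: the quadratic polynomial
  with Hessian \<open>X + 4 \<tau>\<close> touches inside that ball.\<close>

lemma subsol_approximate_touching:
  fixes u :: "real ^ 'n \<Rightarrow> real"
  assumes u: "subsol F \<Omega> u" and s: "s > 0" and b: "cball z s \<subseteq> \<Omega>" and cont: "continuous_on (cball z s) u"
    and X: "symmetric_matrix X" and \<tau>: "\<tau> > 0"
    and le: "\<And>h. norm h \<le> s \<Longrightarrow> u (z + h) \<le> u z + p \<bullet> h + (1/2) * (h \<bullet> (X *v h)) + \<tau> * s\<^sup>2"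
  shows "F (X + mat (4 * \<tau>)) \<le> 0"
proof -
  define Y where "Y = X + mat (4 * \<tau>)"
  have Y: "symmetric_matrix Y" unfolding Y_def by (intro symmetric_matrix_intros X)
  have Yf: "h \<bullet> (Y *v h) = h \<bullet> (X *v h) + 4 * \<tau> * (norm h)\<^sup>2" for h
    by (simp add: Y_def matrix_form_simps inner_add_right dot_square_norm)
  define g where "g h = u (z + h) - p \<bullet> h - (1/2) * (h \<bullet> (Y *v h))" for h
  have "continuous_on (cball 0 s) (\<lambda>h. u (z + h))"
    by (rule continuous_on_compose2[OF cont]) (auto intro!: continuous_intros simp: dist_norm)
  moreover have "continuous_on (cball 0 s) (\<lambda>h. Y *v h)"
    by (rule linear_continuous_on[OF matrix_vector_mul_bounded_linear])
  ultimately have "continuous_on (cball 0 s) g"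
    unfolding g_def by (intro continuous_intros)
  then obtain m where m: "m \<in> cball 0 s" "\<And>h. h \<in> cball 0 s \<Longrightarrow> g h \<le> g m"
    using continuous_attains_sup[of "cball 0 s" g] s by force
  \<comment> \<open>At distance \<open>s\<close> the added form contributes
    \<open>2 * \<tau> * s\<^sup>2\<close>, twice the permitted error, so the maximum of
    \<open>g\<close> is interior.\<close>
  have "norm m < s"
  proof (rule ccontr)
    assume "\<not> norm m < s"
    then have "norm m = s" using m(1) by simp
    then have "g m \<le> u z - \<tau> * s\<^sup>2" using le[of m] by (simp add: g_def Yf add_divide_distrib)
    moreover have "g 0 = u z" by (simp add: g_def)
    moreover have "g 0 \<le> g m" using m(2)[of 0] s by simp
    moreover have "\<tau> * s\<^sup>2 > 0" using \<tau> s by simp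
    ultimately show False by linarith
  qed
  have "F Y \<le> 0"
  proof (rule subsolD[OF u, where z = "z + m" and s = "s - norm m" and p = "p + Y *v m"])
    show "ball (z + m) (s - norm m) \<subseteq> \<Omega>"
    proof
      fix y assume "y \<in> ball (z + m) (s - norm m)"
      then have "norm (y - z) \<le> s" using norm_triangle_ineq[of "y - (z + m)" m] by (simp add: dist_norm norm_minus_commute)
      then show "y \<in> \<Omega>" using b by (auto simp: dist_norm norm_minus_commute)
    qed
    fix h :: "real ^ 'n" assume "norm h < s - norm m"
    then have "m + h \<in> cball 0 s" using norm_triangle_ineq[of m h] by simp
    from m(2)[OF this] show "u (z + m + h) \<le> u (z + m) + (p + Y *v m) \<bullet> h + 1 / 2 * (h \<bullet> (Y *v h))"
      using symmetric_matrix_inner[OF Y, of m h]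
      by (simp add: g_def matrix_vector_right_distrib inner_simps inner_commute[of h] add.assoc add_divide_distrib)
  qed (use \<open>norm m < s\<close> Y in auto)
  then show ?thesis by (simp add: Y_def)
qed

text \<open>\<open>X\<close> and \<open>Y\<close> belong to points near \<open>x0\<close> and
  \<open>y0\<close> rather than to these points; as \<open>F\<close> depends on the Hessian alone,
  this costs nothing and no limit of matrices is taken. After subtraction of the affine parts the
  perturbed-maximum lemma is applied with \<open>\<delta> / 4\<close>, which costs
  \<open>\<delta> / 2\<close> in the form; the correction \<open>4 * (\<delta> / 8)\<close> from
  approximate touching costs the other half.\<close>

lemma theorem_on_sums:
  fixes F :: "real ^ 'n ^ 'n \<Rightarrow> real" and B :: "(real ^ 'n) \<times> (real ^ 'n) \<Rightarrow> (real ^ 'n) \<times> (real ^ 'n)"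
  assumes r: "r > 0" and u: "subsol F (ball x0 r) u" and v: "supersol F (ball y0 r) v"
    and cu: "continuous_on (cball x0 r) u" and cv: "continuous_on (cball y0 r) v"
    and B: "linear B" "\<And>x y. x \<bullet> B y = B x \<bullet> y" and \<delta>: "\<delta> > 0"
    and le: "\<And>h k. norm h \<le> r \<Longrightarrow> norm k \<le> r \<Longrightarrow> u (x0 + h) - v (y0 + k)
        \<le> u x0 - v y0 + a \<bullet> h + b \<bullet> k + (1/2) * ((h, k) \<bullet> B (h, k))"
  obtains X Y where "symmetric_matrix X" "symmetric_matrix Y" "F X \<le> 0" "0 \<le> F Y"
    "\<And>h k. h \<bullet> (X *v h) - k \<bullet> (Y *v k) \<le> (h, k) \<bullet> B (h, k) + \<delta> * ((norm h)\<^sup>2 + (norm k)\<^sup>2)"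
proof -
  define u1 where "u1 h = u (x0 + h) - u x0 - a \<bullet> h" for h
  define w1 where "w1 k = v y0 - v (y0 + k) - b \<bullet> k" for k
  have cu1: "continuous_on (cball 0 r) u1"
    unfolding u1_def
    by (intro continuous_intros continuous_on_compose2[OF cu]) (auto simp: dist_norm)
  have cw1: "continuous_on (cball 0 r) w1"
    unfolding w1_def
    by (intro continuous_intros continuous_on_compose2[OF cv]) (auto simp: dist_norm)
  have le1: "u1 h + w1 k \<le> (1/2) * ((h, k) \<bullet> B (h, k))" if "norm h \<le> r" "norm k \<le> r" for h k
    using le[OF that] by (simp add: u1_def w1_def)
  obtain z1 z2 p1 p2 A1 A2 where z: "norm z1 < r" "norm z2 < r" and A: "linear A1" "linear A2" and
    t1: "\<And>\<tau> \<rho>. \<tau> > 0 \<Longrightarrow> \<rho> > 0 \<Longrightarrow> \<exists>s. 0 < s \<and> s < \<rho> \<and>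
       (\<forall>h. norm h \<le> s \<longrightarrow> u1 (z1 + h) \<le> u1 z1 + p1 \<bullet> h + (1/2) * (h \<bullet> A1 h) + \<tau> * s\<^sup>2)" and
    t2: "\<And>\<tau> \<rho>. \<tau> > 0 \<Longrightarrow> \<rho> > 0 \<Longrightarrow> \<exists>s. 0 < s \<and> s < \<rho> \<and>
       (\<forall>h. norm h \<le> s \<longrightarrow> w1 (z2 + h) \<le> w1 z2 + p2 \<bullet> h + (1/2) * (h \<bullet> A2 h) + \<tau> * s\<^sup>2)" and
    form: "\<And>h k. h \<bullet> A1 h + k \<bullet> A2 k \<le> (h, k) \<bullet> B (h, k) + 2 * (\<delta>/4) * ((norm h)\<^sup>2 + (norm k)\<^sup>2)"
  proof -
    have "u1 0 = 0" "w1 0 = 0" "\<delta>/4 > 0" using \<delta> by (auto simp: u1_def w1_def)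
    from upper_expansion_at_perturbed_maximum[OF r cu1 cw1 this(1,2) B le1 this(3)]
    show ?thesis using that by metis
  qed
  obtain S1 where S1: "symmetric_matrix S1" "\<And>h. h \<bullet> (S1 *v h) = h \<bullet> A1 h"
    using symmetric_part_of_linear[OF A(1)] by blast
  obtain S2 where S2: "symmetric_matrix S2" "\<And>h. h \<bullet> (S2 *v h) = h \<bullet> A2 h"
    using symmetric_part_of_linear[OF A(2)] by blast
  have inball: "cball (x + z) s \<subseteq> ball x r" if "s < r - norm z" for x z :: "real ^ 'n" and s
  proof
    fix y assume "y \<in> cball (x + z) s"
    then have "norm (y - x) < r"
      using that norm_triangle_ineq[of "y - (x + z)" z] by (simp add: dist_norm norm_minus_commute)
    then show "y \<in> ball x r" by (simp add: dist_norm norm_minus_commute)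
  qed
  have FX: "F (S1 + mat (4 * (\<delta>/8))) \<le> 0"
  proof -
    obtain s where s: "0 < s" "s < r - norm z1" and
      le: "\<And>h. norm h \<le> s \<Longrightarrow> u1 (z1 + h) \<le> u1 z1 + p1 \<bullet> h + (1/2) * (h \<bullet> A1 h) + \<delta>/8 * s\<^sup>2"
      using t1[of "\<delta>/8" "r - norm z1"] z \<delta> by auto
    show ?thesis
    proof (rule subsol_approximate_touching[OF u s(1) inball[OF s(2)] _ S1(1), where p = "p1 + a"])
      show "continuous_on (cball (x0 + z1) s) u"
        by (rule continuous_on_subset[OF cu order_trans[OF inball[OF s(2)] ball_subset_cball]])
      show "u (x0 + z1 + h) \<le> u (x0 + z1) + (p1 + a) \<bullet> h + 1 / 2 * (h \<bullet> (S1 *v h)) + \<delta>/8 * s\<^sup>2"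
        if "norm h \<le> s" for h
        using le[OF that] by (simp add: u1_def S1 inner_simps add.assoc)
    qed (use \<delta> in auto)
  qed
  have FY: "dual_operator F (S2 + mat (4 * (\<delta>/8))) \<le> 0"
  proof -
    obtain s where s: "0 < s" "s < r - norm z2" and
      le: "\<And>h. norm h \<le> s \<Longrightarrow> w1 (z2 + h) \<le> w1 z2 + p2 \<bullet> h + (1/2) * (h \<bullet> A2 h) + \<delta>/8 * s\<^sup>2"
      using t2[of "\<delta>/8" "r - norm z2"] z \<delta> by auto
    show ?thesis
    proof (rule subsol_approximate_touching[OF v[unfolded supersol_def] s(1) inball[OF s(2)] _ S2(1), where p = "p2 + b"])
      show "continuous_on (cball (y0 + z2) s) (\<lambda>x. - v x)"
        by (intro continuous_on_minus continuous_on_subset[OF cv order_trans[OF inball[OF s(2)] ball_subset_cball]])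
      show "- v (y0 + z2 + h) \<le> - v (y0 + z2) + (p2 + b) \<bullet> h + 1 / 2 * (h \<bullet> (S2 *v h)) + \<delta>/8 * s\<^sup>2"
        if "norm h \<le> s" for h
        using le[OF that] by (simp add: w1_def S2 inner_simps add.assoc)
    qed (use \<delta> in auto)
  qed
  show thesis
  proof (rule that[of "S1 + mat (4 * (\<delta>/8))" "- (S2 + mat (4 * (\<delta>/8)))"])
    show "h \<bullet> ((S1 + mat (4 * (\<delta>/8))) *v h) - k \<bullet> (- (S2 + mat (4 * (\<delta>/8))) *v k)
      \<le> (h, k) \<bullet> B (h, k) + \<delta> * ((norm h)\<^sup>2 + (norm k)\<^sup>2)" for h k
      using form[of h k]
      by (simp add: matrix_vector_mult_uminus matrix_form_simps inner_simps S1 S2 dot_square_norm algebra_simps)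
  qed (use FX FY S1 S2 in \<open>auto simp: dual_operator_def intro!: symmetric_matrix_intros\<close>)
qed

section \<open>Comparison and barriers\<close>

context elliptic_operator
begin

text \<open>Doubling of variables. Since \<open>F\<close> does not see points or gradients, a single
  penalty parameter \<open>j\<close> for which both points of the maximum are interior gives the
  contradiction; the quadratic term with \<eta> supplies the strict inequality.\<close>

theorem comparison:
  assumes \<Omega>: "open \<Omega>" "bounded \<Omega>" and u: "subsol F \<Omega> u" and v: "supersol F \<Omega> v"
    and cu: "continuous_on (closure \<Omega>) u" and cv: "continuous_on (closure \<Omega>) v"
    and le: "\<And>x. x \<in> frontier \<Omega> \<Longrightarrow> u x \<le> v x" and x1: "x1 \<in> closure \<Omega>"
  shows "u x1 \<le> v x1"
proof (rule ccontr)
  assume "\<not> u x1 \<le> v x1"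
  define m where "m = u x1 - v x1"
  have m: "m > 0" using \<open>\<not> u x1 \<le> v x1\<close> by (simp add: m_def)
  let ?S = "closure \<Omega>"
  have S: "compact ?S" using \<Omega> by (simp add: compact_closure)
  obtain R where R: "R > 0" "\<And>x. x \<in> ?S \<Longrightarrow> norm x \<le> R"
    using compact_imp_bounded[OF S] unfolding bounded_pos by blast
  \<comment> \<open>Keeps \<open>\<eta> * (norm x)\<^sup>2\<close> below \<open>m / 2\<close> on the
    closure, so that a boundary point, where \<open>u \<le> v\<close>, cannot reach the value
    \<open>m\<close>.\<close>
  define \<eta> where "\<eta> = m / (2 * R\<^sup>2)"
  have \<eta>: "\<eta> > 0" using m R by (simp add: \<eta>_def)
  have \<eta>R: "\<eta> * (norm x)\<^sup>2 \<le> m / 2" if "x \<in> ?S" for x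
  proof -
    have "(norm x)\<^sup>2 \<le> R\<^sup>2" using R(2)[OF that] by (intro power_mono) auto
    then have "\<eta> * (norm x)\<^sup>2 \<le> \<eta> * R\<^sup>2" using \<eta> by (intro mult_left_mono) auto
    then show ?thesis using R by (simp add: \<eta>_def)
  qed
  define \<phi> where "\<phi> j z = u (fst z) - v (snd z) + \<eta> * (norm (fst z))\<^sup>2 - real j / 2 * (norm (fst z - snd z))\<^sup>2"
    for j :: nat and z
  have "\<exists>z. z \<in> ?S \<times> ?S \<and> (\<forall>z'\<in>?S \<times> ?S. \<phi> j z' \<le> \<phi> j z)" for j
  proof -
    have "continuous_on (?S \<times> ?S) (\<phi> j)"
      unfolding \<phi>_def
      by (intro continuous_intros continuous_on_compose2[OF cu, of _ fst] continuous_on_compose2[OF cv, of _ snd]) auto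
    then show ?thesis
      using continuous_attains_sup[OF compact_Times[OF S S], of "\<phi> j"] x1 by blast
  qed
  then obtain z where zS: "\<And>j. z j \<in> ?S \<times> ?S" and z: "\<And>j z'. z' \<in> ?S \<times> ?S \<Longrightarrow> \<phi> j z' \<le> \<phi> j (z j)"
    by metis
  have val: "m \<le> \<phi> j (z j)" for j
  proof -
    have "m \<le> \<phi> j (x1, x1)" using \<eta> by (simp add: \<phi>_def m_def)
    also have "\<dots> \<le> \<phi> j (z j)" using x1 by (intro z) auto
    finally show ?thesis .
  qed
  obtain l \<sigma> where l: "l \<in> ?S \<times> ?S" and \<sigma>: "strict_mono \<sigma>" and lim: "(z \<circ> \<sigma>) \<longlonglongrightarrow> l"
    using seq_compactE[OF compact_imp_seq_compact[OF compact_Times[OF S S]], of z] zS by metis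
  have lim1: "(\<lambda>i. fst (z (\<sigma> i))) \<longlonglongrightarrow> fst l" and lim2: "(\<lambda>i. snd (z (\<sigma> i))) \<longlonglongrightarrow> snd l"
    using tendsto_fst[OF lim] tendsto_snd[OF lim] by (simp_all add: o_def)
  have S1: "fst (z j) \<in> ?S" "snd (z j) \<in> ?S" "fst l \<in> ?S" "snd l \<in> ?S" for j using zS[of j] l by auto
  have limu: "(\<lambda>i. u (fst (z (\<sigma> i)))) \<longlonglongrightarrow> u (fst l)"
    using cu lim1 S1 by (intro continuous_on_tendsto_compose[OF cu]) auto
  have limv: "(\<lambda>i. v (snd (z (\<sigma> i)))) \<longlonglongrightarrow> v (snd l)"
    using cv lim2 S1 by (intro continuous_on_tendsto_compose[OF cv]) auto
  have lim\<phi>: "(\<lambda>i. u (fst (z (\<sigma> i))) - v (snd (z (\<sigma> i))) + \<eta> * (norm (fst (z (\<sigma> i))))\<^sup>2)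
      \<longlonglongrightarrow> u (fst l) - v (snd l) + \<eta> * (norm (fst l))\<^sup>2"
    by (intro tendsto_intros limu limv lim1)
  have ge: "m \<le> u (fst l) - v (snd l) + \<eta> * (norm (fst l))\<^sup>2"
  proof (rule LIMSEQ_le_const[OF lim\<phi>], intro exI allI impI)
    fix i
    have "0 \<le> real (\<sigma> i) / 2 * (norm (fst (z (\<sigma> i)) - snd (z (\<sigma> i))))\<^sup>2" by simp
    then show "m \<le> u (fst (z (\<sigma> i))) - v (snd (z (\<sigma> i))) + \<eta> * (norm (fst (z (\<sigma> i))))\<^sup>2"
      using val[of "\<sigma> i"] unfolding \<phi>_def by linarith
  qed
  \<comment> \<open>Different limits would make the penalty unbounded while \<phi> stays above
    \<open>m\<close>.\<close>
  have eq: "fst l = snd l"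
  proof (rule ccontr)
    assume ne: "fst l \<noteq> snd l"
    define d where "d = (norm (fst l - snd l))\<^sup>2"
    have d: "d > 0" using ne by (simp add: d_def)
    have limd: "(\<lambda>i. (norm (fst (z (\<sigma> i)) - snd (z (\<sigma> i))))\<^sup>2) \<longlonglongrightarrow> d"
      unfolding d_def by (intro tendsto_intros lim1 lim2)
    define G where "G = u (fst l) - v (snd l) + \<eta> * (norm (fst l))\<^sup>2 + 1"
    have "\<forall>\<^sub>F i in sequentially. (norm (fst (z (\<sigma> i)) - snd (z (\<sigma> i))))\<^sup>2 > d / 2"
      using order_tendstoD(1)[OF limd, of "d/2"] d by simp
    moreover have "\<forall>\<^sub>F i in sequentially. u (fst (z (\<sigma> i))) - v (snd (z (\<sigma> i))) + \<eta> * (norm (fst (z (\<sigma> i))))\<^sup>2 < G"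
      using order_tendstoD(2)[OF lim\<phi>, of G] by (simp add: G_def)
    moreover have "\<forall>\<^sub>F i in sequentially. 4 * (\<bar>G\<bar> + 1) / d < real i"
      using eventually_gt_at_top filterlim_real_sequentially unfolding filterlim_at_top_dense by blast
    ultimately have "\<forall>\<^sub>F i in sequentially. False"
    proof eventually_elim
      case (elim i)
      have "4 * (\<bar>G\<bar> + 1) < d * real i" using elim(3) d by (simp add: field_simps)
      also have "\<dots> \<le> d * real (\<sigma> i)" using seq_suble[OF \<sigma>, of i] d by simp
      finally have "\<bar>G\<bar> + 1 < real (\<sigma> i) / 2 * (d / 2)" by (simp add: field_simps)
      also have "\<dots> \<le> real (\<sigma> i) / 2 * (norm (fst (z (\<sigma> i)) - snd (z (\<sigma> i))))\<^sup>2"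
        using elim(1) by (intro mult_left_mono) auto
      finally show ?case using val[of "\<sigma> i"] elim(2) m unfolding \<phi>_def by linarith
    qed
    then show False by simp
  qed
  have "fst l \<in> \<Omega>"
  proof (rule ccontr)
    assume "fst l \<notin> \<Omega>"
    then have "fst l \<in> frontier \<Omega>" using S1(3) \<Omega>(1) by (simp add: frontier_def interior_open)
    then have "u (fst l) \<le> v (snd l)" using le eq by simp
    then show False using ge \<eta>R[OF S1(3)] m by linarith
  qed
  then have "\<forall>\<^sub>F i in sequentially. fst (z (\<sigma> i)) \<in> \<Omega>" "\<forall>\<^sub>F i in sequentially. snd (z (\<sigma> i)) \<in> \<Omega>"
    using lim1 lim2 \<Omega>(1) eq by (auto simp: tendsto_def)
  then have "\<forall>\<^sub>F i in sequentially. fst (z (\<sigma> i)) \<in> \<Omega> \<and> snd (z (\<sigma> i)) \<in> \<Omega>"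
    by eventually_elim simp
  then obtain i where i: "fst (z (\<sigma> i)) \<in> \<Omega>" "snd (z (\<sigma> i)) \<in> \<Omega>"
    using eventually_happens[of _ sequentially] by auto
  define j where "j = \<sigma> i"
  define x0 where "x0 = fst (z j)"
  define y0 where "y0 = snd (z j)"
  obtain r1 where r1: "r1 > 0" "cball x0 r1 \<subseteq> \<Omega>"
    using \<Omega>(1) i(1) unfolding x0_def j_def open_contains_cball by blast
  obtain r2 where r2: "r2 > 0" "cball y0 r2 \<subseteq> \<Omega>"
    using \<Omega>(1) i(2) unfolding y0_def j_def open_contains_cball by blast
  define r where "r = min r1 r2"
  have r: "r > 0" "cball x0 r \<subseteq> \<Omega>" "cball y0 r \<subseteq> \<Omega>" using r1 r2 by (auto simp: r_def)
  \<comment> \<open>The Hessian of the penalty minus that of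
    \<open>\<eta> * (norm x)\<^sup>2\<close> in the first variable. On the diagonal
    \<open>h = k\<close> only \<open>- 2 * \<eta>\<close> survives, and the error
    \<open>\<eta> / 2\<close> of the theorem on sums, counted for \<open>h\<close> and for
    \<open>k\<close>, leaves \<open>- \<eta>\<close>.\<close>
  define B where "B z = (real j *\<^sub>R (fst z - snd z) - (2 * \<eta>) *\<^sub>R fst z, - (real j *\<^sub>R (fst z - snd z)))"
    for z :: "(real ^ 'n) \<times> (real ^ 'n)"
  have B: "linear B" "\<And>x y. x \<bullet> B y = B x \<bullet> y"
    by (auto intro!: linearI simp: B_def algebra_simps inner_prod_def inner_commute)
  have Bform: "(h, k) \<bullet> B (h, k) = real j * (norm (h - k))\<^sup>2 - 2 * \<eta> * (norm h)\<^sup>2" for h k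
    by (simp add: B_def power2_norm_eq_inner inner_simps inner_commute algebra_simps)
  obtain X Y where XY: "symmetric_matrix X" "symmetric_matrix Y" "F X \<le> 0" "0 \<le> F Y"
    "\<And>h k. h \<bullet> (X *v h) - k \<bullet> (Y *v k) \<le> (h, k) \<bullet> B (h, k) + \<eta> / 2 * ((norm h)\<^sup>2 + (norm k)\<^sup>2)"
  proof (rule theorem_on_sums[OF r(1), of F x0 u y0 v B "\<eta>/2" "real j *\<^sub>R (x0 - y0) - (2 * \<eta>) *\<^sub>R x0" "- (real j *\<^sub>R (x0 - y0))"])
    show "subsol F (ball x0 r) u" by (rule subsol_mono[OF u order_trans[OF ball_subset_cball r(2)]])
    show "supersol F (ball y0 r) v" by (rule supersol_mono[OF v order_trans[OF ball_subset_cball r(3)]])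
    show "continuous_on (cball x0 r) u" by (rule continuous_on_subset[OF cu order_trans[OF r(2) closure_subset]])
    show "continuous_on (cball y0 r) v" by (rule continuous_on_subset[OF cv order_trans[OF r(3) closure_subset]])
    show "u (x0 + h) - v (y0 + k) \<le> u x0 - v y0 + (real j *\<^sub>R (x0 - y0) - (2 * \<eta>) *\<^sub>R x0) \<bullet> h
        + - (real j *\<^sub>R (x0 - y0)) \<bullet> k + 1 / 2 * ((h, k) \<bullet> B (h, k))"
      if "norm h \<le> r" "norm k \<le> r" for h k
    proof -
      have "x0 + h \<in> ?S" "y0 + k \<in> ?S"
      proof -
        have "x0 + h \<in> cball x0 r" "y0 + k \<in> cball y0 r" using that by (auto simp: dist_norm)
        then show "x0 + h \<in> ?S" "y0 + k \<in> ?S" using r(2,3) closure_subset by blast+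
      qed
      then have "\<phi> j (x0 + h, y0 + k) \<le> \<phi> j (x0, y0)" using z[of _ j] by (simp add: x0_def y0_def)
      then have "u (x0 + h) - v (y0 + k) \<le> u x0 - v y0 + \<eta> * (norm x0)\<^sup>2 - \<eta> * (norm (x0 + h))\<^sup>2
         + real j / 2 * ((norm (x0 + h - (y0 + k)))\<^sup>2 - (norm (x0 - y0))\<^sup>2)"
        by (simp add: \<phi>_def algebra_simps)
      also have "(norm (x0 + h - (y0 + k)))\<^sup>2 - (norm (x0 - y0))\<^sup>2 = 2 * ((x0 - y0) \<bullet> (h - k)) + (norm (h - k))\<^sup>2"
        by (simp add: power2_norm_eq_inner inner_simps inner_commute algebra_simps)
      also have "(norm (x0 + h))\<^sup>2 = (norm x0)\<^sup>2 + 2 * (x0 \<bullet> h) + (norm h)\<^sup>2"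
        by (simp add: power2_norm_eq_inner inner_simps inner_commute algebra_simps)
      finally show ?thesis unfolding Bform by (simp add: inner_simps algebra_simps)
    qed
    show "linear B" "\<And>x y. x \<bullet> B y = B x \<bullet> y" by (fact B)+
    show "\<eta> / 2 > 0" using \<eta> by simp
  qed (rule that)
  have "F Y < F X"
  proof (rule F_strict_antimono[OF XY(1,2) \<eta>])
    show "h \<bullet> (X *v h) - h \<bullet> (Y *v h) \<le> - \<eta> * (norm h)\<^sup>2" for h
      using XY(5)[of h h] unfolding Bform by simp
  qed
  then show False using XY by simp
qed

text \<open>At an interior minimum of \<open>v - h\<close> the polynomial below \<open>h\<close>
  also touches \<open>v\<close> from below, so \<open>F X\<close> would be nonnegative. As
  \<open>h\<close> comes with such polynomials, no doubling of variables is involved.\<close>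

lemma supersol_ge_strict_subsolution:
  assumes \<Omega>: "open \<Omega>" "bounded \<Omega>" and v: "supersol F \<Omega> v" and cv: "continuous_on (closure \<Omega>) v"
    and ch: "continuous_on (closure \<Omega>) h"
    and h: "\<And>x. x \<in> \<Omega> \<Longrightarrow> \<exists>X p s. 0 < s \<and> symmetric_matrix X \<and> F X < 0 \<and>
       (\<forall>k. norm k < s \<longrightarrow> h (x + k) \<ge> h x + p \<bullet> k + (1/2) * (k \<bullet> (X *v k)))"
    and le: "\<And>x. x \<in> frontier \<Omega> \<Longrightarrow> h x \<le> v x" and x1: "x1 \<in> closure \<Omega>"
  shows "h x1 \<le> v x1"
proof -
  have S: "compact (closure \<Omega>)" using \<Omega> by (simp add: compact_closure)
  have "closure \<Omega> \<noteq> {}" using x1 by auto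
  from continuous_attains_inf[OF S this continuous_on_diff[OF cv ch]]
  obtain x where x: "x \<in> closure \<Omega>" "\<And>y. y \<in> closure \<Omega> \<Longrightarrow> v x - h x \<le> v y - h y"
    by blast
  have "x \<in> frontier \<Omega>"
  proof (rule ccontr)
    assume "x \<notin> frontier \<Omega>"
    then have "x \<in> \<Omega>" using x \<Omega> by (simp add: frontier_def interior_open)
    then obtain X p s where X: "0 < s" "symmetric_matrix X" "F X < 0"
      "\<And>k. norm k < s \<Longrightarrow> h (x + k) \<ge> h x + p \<bullet> k + (1/2) * (k \<bullet> (X *v k))" using h by blast
    obtain s' where s': "s' > 0" "ball x s' \<subseteq> \<Omega>" using \<open>x \<in> \<Omega>\<close> \<Omega>(1) open_contains_ball by blast
    have "0 \<le> F X"
    proof (rule supersolD[OF v _ _ X(2), where z = x and s = "min s s'" and p = p])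
      show "ball x (min s s') \<subseteq> \<Omega>" using s' by auto
      fix k :: "real ^ 'n" assume k: "norm k < min s s'"
      then have "x + k \<in> ball x s'" by (simp add: dist_norm)
      then have "x + k \<in> closure \<Omega>" using s' closure_subset by blast
      then show "v (x + k) \<ge> v x + p \<bullet> k + 1 / 2 * (k \<bullet> (X *v k))"
        using x(2)[of "x + k"] X(4)[of k] k by linarith
    qed (use X s' in auto)
    then show False using X by simp
  qed
  then show ?thesis using le[of x] x(2)[OF x1] by linarith
qed

lemma F_mat_neg: "c > 0 \<Longrightarrow> F (mat c) < 0"
proof -
  assume c: "c > 0"
  have "symmetric_matrix (0 :: real ^ 'n ^ 'n)" by (simp add: symmetric_matrix_def transpose_def vec_eq_iff)
  from F_strict_antimono[OF this symmetric_matrix_mat c] show ?thesis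
    by (simp add: mat_mult_vec dot_square_norm)
qed

text \<open>A constant is a subsolution but not a strict one; adding \<epsilon> times the squared
  norm, at most \<open>e\<close> on the bounded domain, makes it strict.\<close>

lemma supersol_ge_const:
  assumes \<Omega>: "open \<Omega>" "bounded \<Omega>" and v: "supersol F \<Omega> v" and cv: "continuous_on (closure \<Omega>) v"
    and le: "\<And>x. x \<in> frontier \<Omega> \<Longrightarrow> c \<le> v x" and x1: "x1 \<in> closure \<Omega>"
  shows "c \<le> v x1"
proof (rule field_le_epsilon)
  fix e :: real assume e: "e > 0"
  obtain R where R: "R > 0" "\<And>x. x \<in> closure \<Omega> \<Longrightarrow> norm x \<le> R"
    using bounded_closure[OF \<Omega>(2)] unfolding bounded_pos by blast
  define \<epsilon> where "\<epsilon> = e / R\<^sup>2"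
  have \<epsilon>: "\<epsilon> > 0" using e R by (simp add: \<epsilon>_def)
  have \<epsilon>R: "\<epsilon> * (norm x)\<^sup>2 \<le> e" if "x \<in> closure \<Omega>" for x
  proof -
    have "(norm x)\<^sup>2 \<le> R\<^sup>2" using R(2)[OF that] by (intro power_mono) auto
    then have "\<epsilon> * (norm x)\<^sup>2 \<le> \<epsilon> * R\<^sup>2" using \<epsilon> by (intro mult_left_mono) auto
    then show ?thesis using R by (simp add: \<epsilon>_def)
  qed
  have "c - e + \<epsilon> * (norm x1)\<^sup>2 \<le> v x1"
  proof (rule supersol_ge_strict_subsolution[OF \<Omega> v cv _ _ _ x1, where h = "\<lambda>x. c - e + \<epsilon> * (norm x)\<^sup>2"])
    show "\<exists>X p s. 0 < s \<and> symmetric_matrix X \<and> F X < 0 \<and> (\<forall>k. norm k < s \<longrightarrow>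
        c - e + \<epsilon> * (norm (x + k))\<^sup>2 \<ge> c - e + \<epsilon> * (norm x)\<^sup>2 + p \<bullet> k + (1/2) * (k \<bullet> (X *v k)))" for x
      using \<epsilon> by (intro exI[of _ "mat (2 * \<epsilon>)"] exI[of _ "(2 * \<epsilon>) *\<^sub>R x"] exI[of _ 1])
        (simp add: symmetric_matrix_mat F_mat_neg mat_mult_vec power2_norm_eq_inner inner_simps inner_commute algebra_simps)
    show "c - e + \<epsilon> * (norm x)\<^sup>2 \<le> v x" if "x \<in> frontier \<Omega>" for x
      using le[OF that] \<epsilon>R[of x] that by (auto simp: frontier_def)
  qed (intro continuous_intros)
  moreover have "0 \<le> \<epsilon> * (norm x1)\<^sup>2" using \<epsilon> by simp
  ultimately show "c \<le> v x1 + e" by linarith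
qed

lemma subsol_le_const:
  assumes \<Omega>: "open \<Omega>" "bounded \<Omega>" and u: "subsol F \<Omega> u" and cu: "continuous_on (closure \<Omega>) u"
    and le: "\<And>x. x \<in> frontier \<Omega> \<Longrightarrow> u x \<le> c" and x1: "x1 \<in> closure \<Omega>"
  shows "u x1 \<le> c"
proof -
  interpret d: elliptic_operator "dual_operator F" lam Lam by (rule dual)
  have "- c \<le> - u x1"
    by (rule d.supersol_ge_const[OF \<Omega> _ _ _ x1])
       (use u cu le in \<open>auto simp: supersol_def intro: continuous_on_minus\<close>)
  then show ?thesis by simp
qed

end

text \<open>The power \<open>norm (x - y)\<close> to the exponent \<open>- 4 * m\<close>. The
  natural power of the squared norm allows elementary inequalities instead of derivatives, and its
  even exponent \<open>2 * m\<close> is what \<open>inverse_power_ge_quadratic\<close>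
  exploits.\<close>

definition barrier :: "nat \<Rightarrow> real ^ 'n \<Rightarrow> real ^ 'n \<Rightarrow> real" where
  "barrier m y x = inverse (((norm (x - y))\<^sup>2) ^ (2 * m))"

text \<open>\<open>1 - \<tau>\<close> is at most the inverse of \<open>1 + \<tau>\<close>, Bernoulli
  bounds its \<open>m\<close>-th power below by \<open>1 - m * \<tau>\<close>, and squaring creates
  the positive quadratic term.\<close>

lemma inverse_power_ge_quadratic:
  fixes \<tau> :: real
  assumes "\<bar>\<tau>\<bar> < 1" "real m * \<tau> \<le> 1"
  shows "inverse ((1 + \<tau>) ^ (2 * m)) \<ge> 1 - 2 * real m * \<tau> + (real m)\<^sup>2 * \<tau>\<^sup>2"
proof -
  have p: "1 + \<tau> > 0" using assms by simp
  have "(1 - \<tau>) * (1 + \<tau>) \<le> 1" by (simp add: algebra_simps)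
  then have "1 - \<tau> \<le> inverse (1 + \<tau>)" using p by (simp add: field_simps)
  then have "(1 - \<tau>) ^ m \<le> inverse (1 + \<tau>) ^ m" using assms by (intro power_mono) auto
  moreover have "1 + real m * (- \<tau>) \<le> (1 + - \<tau>) ^ m" using assms by (intro Bernoulli_inequality) auto
  ultimately have "1 - real m * \<tau> \<le> inverse (1 + \<tau>) ^ m" by simp
  then have "(1 - real m * \<tau>)\<^sup>2 \<le> (inverse (1 + \<tau>) ^ m)\<^sup>2" using assms by (intro power_mono) auto
  also have "\<dots> = inverse ((1 + \<tau>) ^ (2 * m))" by (simp add: power_mult[symmetric] power_inverse mult.commute)
  finally show ?thesis by (simp add: power2_eq_square algebra_simps)
qed

text \<open>With \<tau> the relative change of the squared distance to \<open>y\<close>, the square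
  of \<tau> yields the large form along \<open>x - y\<close>, and the linear term in \<tau> contains
  the negative multiple of \<open>(norm k)\<^sup>2\<close>. Their ratio is \<open>m\<close>, which
  is why a large \<open>m\<close> makes a subsolution.\<close>

lemma barrier_expansion:
  fixes x y :: "real ^ 'n"
  assumes xy: "x \<noteq> y" and m: "m \<ge> 1"
  defines "s0 \<equiv> (norm (x - y))\<^sup>2"
  defines "c \<equiv> 8 * real m * inverse (s0 ^ (2 * m)) / s0"
  obtains p s where "s > 0" "\<And>k. norm k < s \<Longrightarrow> barrier m y (x + k) \<ge> barrier m y x + p \<bullet> k
    + (1/2) * (c * (real m * (sgn (x - y) \<bullet> k)\<^sup>2 - (norm k)\<^sup>2))"
proof -
  define \<xi> where "\<xi> = x - y"
  define q where "q = norm \<xi>"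
  have q: "q > 0" using xy by (simp add: q_def \<xi>_def)
  have s0: "s0 = q\<^sup>2" "s0 > 0" using q by (auto simp: s0_def q_def \<xi>_def)
  define J where "J = inverse (s0 ^ (2 * m))"
  have J: "J > 0" using s0 by (simp add: J_def)
  \<comment> \<open>Small enough for \<open>real m * \<bar>\<tau>\<bar> < 1\<close>, as Bernoulli
    needs, and for the cubic term in the square of \<open>t\<close> to cost at most
    \<open>q\<^sup>2 * (norm k)\<^sup>2 / m\<close>.\<close>
  define s where "s = q / (4 * real m)"
  have s: "s > 0" using q m by (simp add: s_def)
  have main: "barrier m y (x + k) \<ge> barrier m y x + (- (4 * real m * J / s0) *\<^sub>R \<xi>) \<bullet> k
    + (1/2) * (c * (real m * (sgn \<xi> \<bullet> k)\<^sup>2 - (norm k)\<^sup>2))" if k: "norm k < s" for k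
  proof -
    define t where "t = 2 * (\<xi> \<bullet> k) + (norm k)\<^sup>2"
    define \<tau> where "\<tau> = t / s0"
    have sq: "(norm (x + k - y))\<^sup>2 = s0 * (1 + \<tau>)"
    proof -
      have "x + k - y = \<xi> + k" by (simp add: \<xi>_def)
      then have "(norm (x + k - y))\<^sup>2 = s0 + t"
        unfolding \<open>x + k - y = \<xi> + k\<close> t_def s0 q_def
        by (simp add: power2_norm_eq_inner inner_simps inner_commute)
      then show ?thesis using s0 by (simp add: \<tau>_def field_simps)
    qed
    have kq: "4 * real m * norm k < q" using k m by (simp add: s_def field_simps)
    have k1: "norm k \<le> q / 4"
    proof -
      have "1 * (4 * norm k) \<le> real m * (4 * norm k)" using m by (intro mult_right_mono) auto
      then show ?thesis using kq by simp
    qed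
    have abs: "\<bar>\<xi> \<bullet> k\<bar> \<le> q * norm k" using Cauchy_Schwarz_ineq2[of \<xi> k] by (simp add: q_def)
    have k2: "(norm k)\<^sup>2 \<le> q * norm k / 4"
      using mult_right_mono[OF k1, of "norm k"] by (simp add: power2_eq_square)
    have tb: "\<bar>t\<bar> \<le> 9/4 * (q * norm k)" unfolding t_def
      by (intro abs_leI) (use abs[unfolded abs_le_iff] k2 zero_le_power2[of "norm k"] in linarith)+
    have "real m * \<bar>t\<bar> \<le> real m * (9/4 * (q * norm k))" using tb by (intro mult_left_mono) auto
    also have "\<dots> = 9/16 * q * (4 * real m * norm k)" by simp
    also have "\<dots> \<le> 9/16 * q * q" using kq q by (intro mult_left_mono) auto
    also have "\<dots> < s0" using q s0 by (simp add: power2_eq_square)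
    finally have mt: "real m * \<bar>t\<bar> < s0" .
    have m\<tau>: "real m * \<bar>\<tau>\<bar> < 1" using mt s0 by (simp add: \<tau>_def field_simps)
    moreover have "1 * \<bar>\<tau>\<bar> \<le> real m * \<bar>\<tau>\<bar>" using m by (intro mult_right_mono) auto
    ultimately have \<tau>1: "\<bar>\<tau>\<bar> < 1" by simp
    have "real m * \<tau> \<le> real m * \<bar>\<tau>\<bar>" by (intro mult_left_mono) auto
    then have \<tau>2: "real m * \<tau> \<le> 1" using m\<tau> by linarith
    have "barrier m y (x + k) = J * inverse ((1 + \<tau>) ^ (2 * m))"
      unfolding barrier_def sq J_def by (simp add: power_mult_distrib)
    also have "\<dots> \<ge> J * (1 - 2 * real m * \<tau> + (real m)\<^sup>2 * \<tau>\<^sup>2)"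
      using inverse_power_ge_quadratic[OF \<tau>1 \<tau>2] J by (intro mult_left_mono) auto
    finally have b1: "barrier m y (x + k) \<ge> J * (1 - 2 * real m * \<tau> + (real m)\<^sup>2 * \<tau>\<^sup>2)" .
    have tq: "t\<^sup>2 \<ge> 4 * (\<xi> \<bullet> k)\<^sup>2 - q\<^sup>2 * (norm k)\<^sup>2 / real m"
    proof -
      have "- (\<xi> \<bullet> k) * (norm k)\<^sup>2 \<le> (q * norm k) * (norm k)\<^sup>2" using abs by (intro mult_right_mono) auto
      also have "\<dots> = (q * (norm k)\<^sup>2) * norm k" by (simp add: power2_eq_square)
      also have "\<dots> \<le> (q * (norm k)\<^sup>2) * (q / (4 * real m))"
        using k q by (intro mult_left_mono) (auto simp: s_def)
      finally have "4 * (\<xi> \<bullet> k) * (norm k)\<^sup>2 \<ge> - (q\<^sup>2 * (norm k)\<^sup>2 / real m)"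
        using m by (simp add: power2_eq_square field_simps)
      moreover have "t\<^sup>2 = 4 * (\<xi> \<bullet> k)\<^sup>2 + 4 * (\<xi> \<bullet> k) * (norm k)\<^sup>2 + ((norm k)\<^sup>2)\<^sup>2"
        by (simp add: t_def power2_eq_square algebra_simps)
      moreover have "0 \<le> ((norm k)\<^sup>2)\<^sup>2" by simp
      ultimately show ?thesis by linarith
    qed
    have "(real m)\<^sup>2 * \<tau>\<^sup>2 = (real m)\<^sup>2 / s0\<^sup>2 * t\<^sup>2" by (simp add: \<tau>_def power_divide)
    also have "\<dots> \<ge> (real m)\<^sup>2 / s0\<^sup>2 * (4 * (\<xi> \<bullet> k)\<^sup>2 - q\<^sup>2 * (norm k)\<^sup>2 / real m)"
      by (intro mult_left_mono tq) auto
    also have "(real m)\<^sup>2 / s0\<^sup>2 * (4 * (\<xi> \<bullet> k)\<^sup>2 - q\<^sup>2 * (norm k)\<^sup>2 / real m)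
       = 4 * (real m)\<^sup>2 * (sgn \<xi> \<bullet> k)\<^sup>2 / s0 - real m * (norm k)\<^sup>2 / s0"
    proof -
      have "sgn \<xi> \<bullet> k = (\<xi> \<bullet> k) / q" by (simp add: sgn_div_norm q_def divide_inverse)
      then have "(sgn \<xi> \<bullet> k)\<^sup>2 = (\<xi> \<bullet> k)\<^sup>2 / s0" by (simp add: power_divide s0)
      moreover have "(real m)\<^sup>2 / s0\<^sup>2 * (q\<^sup>2 * (norm k)\<^sup>2 / real m) = real m * (norm k)\<^sup>2 / s0"
        unfolding s0(1)[symmetric] using s0(2) m by (simp add: power2_eq_square)
      ultimately show ?thesis unfolding right_diff_distrib by (simp add: power2_eq_square)
    qed
    finally have "J * (1 - 2 * real m * \<tau> + (real m)\<^sup>2 * \<tau>\<^sup>2)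
        \<ge> J * (1 - 2 * real m * \<tau> + (4 * (real m)\<^sup>2 * (sgn \<xi> \<bullet> k)\<^sup>2 / s0 - real m * (norm k)\<^sup>2 / s0))"
      using J by (intro mult_left_mono) auto
    also have "J * (1 - 2 * real m * \<tau> + (4 * (real m)\<^sup>2 * (sgn \<xi> \<bullet> k)\<^sup>2 / s0 - real m * (norm k)\<^sup>2 / s0))
      = J - 4 * real m * J / s0 * (\<xi> \<bullet> k) + (4 * real m * J / s0) * (real m * (sgn \<xi> \<bullet> k)\<^sup>2 - 3/4 * (norm k)\<^sup>2)"
    proof -
      have "J' * (1 - 2 * m' * ((2 * a + n) / s) + (4 * m'\<^sup>2 * g / s - m' * n / s))
          = J' - 4 * m' * J' / s * a + (4 * m' * J' / s) * (m' * g - 3/4 * n)"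
        if "s \<noteq> 0" for J' m' a n g s :: real
        using that by (simp add: power2_eq_square field_simps)
      from this[of s0 J "real m" "\<xi> \<bullet> k" "(norm k)\<^sup>2" "(sgn \<xi> \<bullet> k)\<^sup>2"] show ?thesis
        using s0(2) unfolding \<tau>_def t_def by linarith
    qed
    finally have b2: "barrier m y (x + k) \<ge> J - 4 * real m * J / s0 * (\<xi> \<bullet> k)
       + (4 * real m * J / s0) * (real m * (sgn \<xi> \<bullet> k)\<^sup>2 - 3/4 * (norm k)\<^sup>2)" using b1 by linarith
    have "(4 * real m * J / s0) * (real m * (sgn \<xi> \<bullet> k)\<^sup>2 - 3/4 * (norm k)\<^sup>2)
      \<ge> (4 * real m * J / s0) * (real m * (sgn \<xi> \<bullet> k)\<^sup>2 - (norm k)\<^sup>2)"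
      using J s0 by (intro mult_left_mono) auto
    moreover have "(1/2) * (c * (real m * (sgn \<xi> \<bullet> k)\<^sup>2 - (norm k)\<^sup>2)) = (4 * real m * J / s0) * (real m * (sgn \<xi> \<bullet> k)\<^sup>2 - (norm k)\<^sup>2)"
      by (simp add: c_def J_def)
    moreover have "barrier m y x = J" by (simp add: barrier_def J_def s0_def)
    moreover have "(- (4 * real m * J / s0) *\<^sub>R \<xi>) \<bullet> k = - (4 * real m * J / s0 * (\<xi> \<bullet> k))" by simp
    ultimately show ?thesis using b2 by linarith
  qed
  show thesis using that[OF s, of "- (4 * real m * J / s0) *\<^sub>R \<xi>"] main by (simp add: \<xi>_def)
qed

text \<open>Large enough for \<^term>\<open>barrier m\<close> to be a strict subsolution.\<close>

definition barrier_exponent :: "nat \<Rightarrow> real \<Rightarrow> real \<Rightarrow> nat" where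
  "barrier_exponent n lam Lam = (SOME m. m \<ge> 1 \<and> lam * real m > Lam * real n)"

definition outer :: "real ^ 'n \<Rightarrow> real ^ 'n ^ 'n" where
  "outer e = (\<chi> i j. e $ i * e $ j)"

lemma outer_simps:
  shows "symmetric_matrix (outer e)" "outer e *v k = (e \<bullet> k) *\<^sub>R e" "trace (outer e) = (norm e)\<^sup>2"
proof -
  show "symmetric_matrix (outer e)" by (simp add: symmetric_matrix_def outer_def transpose_def vec_eq_iff mult.commute)
  show "outer e *v k = (e \<bullet> k) *\<^sub>R e"
    by (simp add: outer_def matrix_vector_mult_def vec_eq_iff inner_vec_def sum_distrib_left mult_ac)
  show "trace (outer e) = (norm e)\<^sup>2"
    by (simp add: outer_def trace_def power2_norm_eq_inner inner_vec_def)
qed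

lemma nonneg_definite_outer: "c \<ge> 0 \<Longrightarrow> nonneg_definite (c *\<^sub>R outer e)"
  by (auto simp: nonneg_definite_def symmetric_matrix_intros outer_simps matrix_form_simps
      inner_commute mult.assoc intro!: mult_nonneg_nonneg)

lemma trace_scaleR: "trace (c *\<^sub>R A) = c * trace (A :: real ^ 'n ^ 'n)"
  by (simp add: trace_def sum_distrib_left)

context elliptic_operator
begin

abbreviation bar :: "real ^ 'n \<Rightarrow> real ^ 'n \<Rightarrow> real" where
  "bar \<equiv> barrier (barrier_exponent CARD('n) lam Lam)"

lemma barrier_exponent:
  "barrier_exponent CARD('n) lam Lam \<ge> 1" "lam * real (barrier_exponent CARD('n) lam Lam) > Lam * real CARD('n)"
proof -
  let ?P = "\<lambda>m. m \<ge> 1 \<and> lam * real m > Lam * real CARD('n)"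
  obtain m :: nat where "real m > Lam * real CARD('n) / lam" using reals_Archimedean2 by blast
  then have "lam * real m > Lam * real CARD('n)" using lam by (simp add: field_simps)
  moreover have "Lam * real CARD('n) > 0" using lam by simp
  ultimately have "?P m" by (cases m) auto
  from someI[of ?P, OF this]
  show "barrier_exponent CARD('n) lam Lam \<ge> 1" "lam * real (barrier_exponent CARD('n) lam Lam) > Lam * real CARD('n)"
    unfolding barrier_exponent_def by auto
qed

text \<open>\<open>X\<close> is a multiple of \<open>m\<close> times the projection onto
  \<open>x - y\<close>, minus the identity; the first part lowers \<open>F\<close> by at least
  \<open>lam * m\<close> and the second raises it by at most \<open>Lam * CARD('n)\<close>, up to a
  common factor. The last clause allows an arbitrary \<open>M\<close> because \<open>F\<close> is
  not additive: the barrier must still work when added to another function.\<close>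

lemma barrier_strict:
  assumes "x \<noteq> y"
  obtains X p s where "0 < s" "symmetric_matrix X"
    "\<And>k. norm k < s \<Longrightarrow> bar y (x + k) \<ge> bar y x + p \<bullet> k + (1/2) * (k \<bullet> (X *v k))"
    "\<And>\<epsilon> M. \<epsilon> > 0 \<Longrightarrow> symmetric_matrix M \<Longrightarrow> F (M + \<epsilon> *\<^sub>R X) < F M"
proof -
  let ?m = "barrier_exponent CARD('n) lam Lam"
  define s0 where "s0 = (norm (x - y))\<^sup>2"
  define c where "c = 8 * real ?m * inverse (s0 ^ (2 * ?m)) / s0"
  have s0: "s0 > 0" using assms by (simp add: s0_def)
  have c: "c > 0" using s0 barrier_exponent(1) by (simp add: c_def)
  define e where "e = sgn (x - y)"
  have e: "norm e = 1" using assms by (simp add: e_def norm_sgn)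
  define X where "X = (c * real ?m) *\<^sub>R outer e - mat c"
  have X: "symmetric_matrix X" unfolding X_def by (intro symmetric_matrix_intros outer_simps)
  have Xf: "k \<bullet> (X *v k) = c * (real ?m * (e \<bullet> k)\<^sup>2 - (norm k)\<^sup>2)" for k
    by (simp add: X_def matrix_form_simps outer_simps inner_simps dot_square_norm inner_commute power2_eq_square algebra_simps)
  obtain p s where ps: "s > 0" "\<And>k. norm k < s \<Longrightarrow> bar y (x + k) \<ge> bar y x + p \<bullet> k
    + (1/2) * (c * (real ?m * (e \<bullet> k)\<^sup>2 - (norm k)\<^sup>2))"
    unfolding c_def s0_def e_def by (rule barrier_expansion[OF assms barrier_exponent(1)]) blast
  show thesis
  proof (rule that[OF ps(1) X])
    show "bar y (x + k) \<ge> bar y x + p \<bullet> k + (1/2) * (k \<bullet> (X *v k))" if "norm k < s" for k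
      using ps(2)[OF that] by (simp add: Xf)
    fix \<epsilon> M assume \<epsilon>: "\<epsilon> > (0::real)" and M: "symmetric_matrix (M :: real ^ 'n ^ 'n)"
    define P where "P = (\<epsilon> * c * real ?m) *\<^sub>R outer e"
    have P: "nonneg_definite P" unfolding P_def using \<epsilon> c by (intro nonneg_definite_outer) auto
    have Q: "nonneg_definite (mat (\<epsilon> * c) :: real ^ 'n ^ 'n)"
      using \<epsilon> c by (auto simp: nonneg_definite_def symmetric_matrix_mat mat_mult_vec)
    have MP: "symmetric_matrix (M + P)" using M P by (auto simp: nonneg_definite_def intro: symmetric_matrix_intros)
    have "lam * trace P \<le> F (M + P - P) - F (M + P)" using elliptic[OF MP P] by simp
    then have 1: "F (M + P) \<le> F M - lam * (\<epsilon> * c * real ?m)"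
      by (simp add: P_def trace_scaleR outer_simps e)
    have 2: "F (M + P - mat (\<epsilon> * c)) \<le> F (M + P) + Lam * (\<epsilon> * c * real CARD('n))"
      using elliptic[OF MP Q] by (simp add: trace_simps)
    have "\<epsilon> *\<^sub>R (mat c :: real ^ 'n ^ 'n) = mat (\<epsilon> * c)" by (simp add: mat_def vec_eq_iff)
    then have eqn: "M + \<epsilon> *\<^sub>R X = M + P - mat (\<epsilon> * c)"
      by (simp add: X_def P_def scaleR_diff_right)
    have "(\<epsilon> * c) * (Lam * real CARD('n)) < (\<epsilon> * c) * (lam * real ?m)"
      using \<epsilon> c barrier_exponent(2) by (intro mult_strict_left_mono) auto
    then have "Lam * (\<epsilon> * c * real CARD('n)) < lam * (\<epsilon> * c * real ?m)" by (simp add: mult_ac)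
    then show "F (M + \<epsilon> *\<^sub>R X) < F M" unfolding eqn using 1 2 by linarith
  qed
qed

lemma continuous_on_barrier: "y \<notin> S \<Longrightarrow> continuous_on S (barrier m y)"
  unfolding barrier_def by (intro continuous_intros) auto

text \<open>Sums of subsolutions are not subsolutions in general. Here a polynomial \<open>M\<close>
  touching the sum, minus the polynomial below the barrier, touches \<open>V\<close>, and
  \<open>barrier_strict\<close> restores the missing Hessian with a favourable sign.\<close>

lemma subsol_add_barrier:
  assumes V: "subsol F \<Omega> V" and y: "y \<notin> \<Omega>" and \<epsilon>: "\<epsilon> > 0"
  shows "subsol F \<Omega> (\<lambda>x. V x + \<epsilon> * bar y x)"
  unfolding subsol_def
proof (intro allI impI, elim conjE)
  fix z M q s
  assume s: "0 < s" and b: "ball z s \<subseteq> \<Omega>" and M: "symmetric_matrix M"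
    and le: "\<forall>h. norm h < s \<longrightarrow> V (z + h) + \<epsilon> * bar y (z + h) \<le> V z + \<epsilon> * bar y z + q \<bullet> h + (1/2) * (h \<bullet> (M *v h))"
  have "z \<noteq> y" using b s y centre_in_ball[of z s] by blast
  then obtain X p s' where X: "0 < s'" "symmetric_matrix X"
    "\<And>k. norm k < s' \<Longrightarrow> bar y (z + k) \<ge> bar y z + p \<bullet> k + (1/2) * (k \<bullet> (X *v k))"
    "\<And>\<epsilon> M. \<epsilon> > 0 \<Longrightarrow> symmetric_matrix M \<Longrightarrow> F (M + \<epsilon> *\<^sub>R X) < F M"
    using barrier_strict by metis
  have sym: "symmetric_matrix (M - \<epsilon> *\<^sub>R X)" using M X by (intro symmetric_matrix_intros)
  have "F (M - \<epsilon> *\<^sub>R X) \<le> 0"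
  proof (rule subsolD[OF V _ _ sym, where z = z and s = "min s s'" and p = "q - \<epsilon> *\<^sub>R p"])
    fix h :: "real ^ 'n" assume h: "norm h < min s s'"
    have "\<epsilon> * bar y (z + h) \<ge> \<epsilon> * (bar y z + p \<bullet> h + (1/2) * (h \<bullet> (X *v h)))"
      using X(3)[of h] h \<epsilon> by (intro mult_left_mono) auto
    then show "V (z + h) \<le> V z + (q - \<epsilon> *\<^sub>R p) \<bullet> h + 1 / 2 * (h \<bullet> ((M - \<epsilon> *\<^sub>R X) *v h))"
      using le[rule_format, of h] h by (simp add: matrix_form_simps inner_simps algebra_simps)
  qed (use s X b in auto)
  then show "F M \<le> 0" using X(4)[OF \<epsilon> sym] by simp
qed

lemma supersol_ge_barrier:
  assumes \<Omega>: "open \<Omega>" "bounded \<Omega>" and v: "supersol F \<Omega> v" and cv: "continuous_on (closure \<Omega>) v"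
    and y: "y \<notin> closure \<Omega>" and \<epsilon>: "\<epsilon> > 0"
    and le: "\<And>x. x \<in> frontier \<Omega> \<Longrightarrow> \<epsilon> * bar y x + c \<le> v x" and x1: "x1 \<in> closure \<Omega>"
  shows "\<epsilon> * bar y x1 + c \<le> v x1"
proof (rule supersol_ge_strict_subsolution[OF \<Omega> v cv _ _ le x1])
  show "continuous_on (closure \<Omega>) (\<lambda>x. \<epsilon> * bar y x + c)"
    by (intro continuous_intros continuous_on_barrier y)
  fix x assume "x \<in> \<Omega>"
  then have "x \<noteq> y" using y closure_subset by blast
  then obtain X p s where X: "0 < s" "symmetric_matrix X"
    "\<And>k. norm k < s \<Longrightarrow> bar y (x + k) \<ge> bar y x + p \<bullet> k + (1/2) * (k \<bullet> (X *v k))"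
    "\<And>\<epsilon> M. \<epsilon> > 0 \<Longrightarrow> symmetric_matrix M \<Longrightarrow> F (M + \<epsilon> *\<^sub>R X) < F M"
    using barrier_strict by metis
  show "\<exists>X p s. 0 < s \<and> symmetric_matrix X \<and> F X < 0 \<and> (\<forall>k. norm k < s \<longrightarrow>
      \<epsilon> * bar y (x + k) + c \<ge> \<epsilon> * bar y x + c + p \<bullet> k + (1/2) * (k \<bullet> (X *v k)))"
  proof (intro exI conjI allI impI)
    show "F (\<epsilon> *\<^sub>R X) < 0" using X(4)[OF \<epsilon>, of 0] by (simp add: symmetric_matrix_def transpose_def vec_eq_iff)
    show "\<epsilon> * bar y (x + k) + c \<ge> \<epsilon> * bar y x + c + (\<epsilon> *\<^sub>R p) \<bullet> k + (1/2) * (k \<bullet> (\<epsilon> *\<^sub>R X *v k))"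
      if "norm k < s" for k
      using mult_left_mono[OF X(3)[OF that], of \<epsilon>] \<epsilon> by (simp add: matrix_form_simps algebra_simps)
  qed (use X in \<open>auto intro: symmetric_matrix_intros\<close>)
qed

end

section \<open>Lipschitz and Harnack estimates\<close>

text \<open>With \<open>A\<close> the radial and \<open>T\<close> the squared transversal part, the
  squared norm is \<open>A\<^sup>2 + T\<close>, and \<open>2 * A \<ge> \<rho>\<close> bounds it by
  the square of \<open>A + T / \<rho>\<close>. The transversal coefficient is twice that of Taylor's
  formula, the price for a bound without remainder.\<close>

lemma norm_add_le_quadratic:
  fixes \<xi> \<eta> :: "'a::real_inner"
  assumes "\<xi> \<noteq> 0" "norm \<eta> \<le> norm \<xi> / 2"
  shows "norm (\<xi> + \<eta>) \<le> norm \<xi> + sgn \<xi> \<bullet> \<eta> + ((norm \<eta>)\<^sup>2 - (sgn \<xi> \<bullet> \<eta>)\<^sup>2) / norm \<xi>"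
proof -
  define \<rho> where "\<rho> = norm \<xi>"
  define e where "e = sgn \<xi>"
  define A where "A = \<rho> + e \<bullet> \<eta>"
  define T where "T = (norm \<eta>)\<^sup>2 - (e \<bullet> \<eta>)\<^sup>2"
  have \<rho>: "\<rho> > 0" using assms by (simp add: \<rho>_def)
  have e: "norm e = 1" "\<xi> = \<rho> *\<^sub>R e" using assms by (auto simp: e_def \<rho>_def norm_sgn sgn_div_norm)
  have ce: "\<bar>e \<bullet> \<eta>\<bar> \<le> norm \<eta>" using Cauchy_Schwarz_ineq2[of e \<eta>] e by simp
  have A: "A \<ge> \<rho> / 2" using ce assms(2) by (simp add: A_def \<rho>_def abs_le_iff)
  have T: "T \<ge> 0" using power_mono[OF ce, of 2] by (simp add: T_def)
  have ee: "e \<bullet> e = 1" using e(1) by (simp add: dot_square_norm)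
  have "(norm (\<xi> + \<eta>))\<^sup>2 = A\<^sup>2 + T"
    unfolding e(2) A_def T_def power2_norm_eq_inner
    by (simp add: inner_simps inner_commute ee power2_eq_square algebra_simps)
  also have "\<dots> \<le> (A + T / \<rho>)\<^sup>2"
  proof -
    have "T * \<rho> \<le> T * (2 * A)" using A T by (intro mult_left_mono) auto
    then have "T \<le> 2 * A * (T / \<rho>)" using \<rho> by (simp add: field_simps)
    moreover have "0 \<le> (T / \<rho>)\<^sup>2" by simp
    moreover have "(A + T / \<rho>)\<^sup>2 = A\<^sup>2 + 2 * A * (T / \<rho>) + (T / \<rho>)\<^sup>2" by (rule power2_sum[THEN trans]) simp
    ultimately show ?thesis by linarith
  qed
  finally have sq: "(norm (\<xi> + \<eta>))\<^sup>2 \<le> (A + T / \<rho>)\<^sup>2" .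
  have "0 \<le> T / \<rho>" using \<rho> T by simp
  then have "norm (\<xi> + \<eta>) \<le> A + T / \<rho>"
    using A \<rho> by (intro power2_le_imp_le[OF sq]) linarith
  then show ?thesis by (simp add: A_def T_def \<rho>_def e_def)
qed

definition annulus :: "'a::real_normed_vector \<Rightarrow> real \<Rightarrow> real \<Rightarrow> 'a set" where
  "annulus c a b = {x. a < norm (x - c) \<and> norm (x - c) < b}"

lemma open_annulus: "open (annulus c a b)"
proof -
  have "annulus c a b = {x. a < norm (x - c)} \<inter> {x. norm (x - c) < b}" by (auto simp: annulus_def)
  then show ?thesis by (auto intro!: open_Int open_Collect_less continuous_intros)
qed

lemma bounded_annulus: "bounded (annulus c a b)"
  by (rule bounded_subset[OF bounded_ball, of _ c b]) (auto simp: annulus_def dist_norm norm_minus_commute)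

lemma closure_annulus_subset: "closure (annulus c a b) \<subseteq> {x. a \<le> norm (x - c) \<and> norm (x - c) \<le> b}"
proof (rule closure_minimal)
  have "{x. a \<le> norm (x - c) \<and> norm (x - c) \<le> b} = {x. a \<le> norm (x - c)} \<inter> {x. norm (x - c) \<le> b}" by auto
  then show "closed {x. a \<le> norm (x - c) \<and> norm (x - c) \<le> b}"
    by (auto intro!: closed_Int closed_Collect_le continuous_intros)
qed (auto simp: annulus_def)

lemma frontier_annulusD: "x \<in> frontier (annulus c a b) \<Longrightarrow> norm (x - c) = a \<or> norm (x - c) = b"
  using closure_annulus_subset[of c a b] interior_open[OF open_annulus, of c a b]
  by (force simp: frontier_def annulus_def)

text \<open>Half of this constant times \<open>M\<close> is the slope \<open>l\<close> in the
  doubling argument. The 16 gives \<open>l \<ge> 8 * M\<close>, which keeps the maximum away from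
  the boundary; the other entry gives \<open>8 * l * lam / n \<ge> 20 * Lam * n * M\<close>, which
  beats the \<open>18 * Lam * n * M\<close> produced by the remaining terms.\<close>

abbreviation lipschitz_const :: "nat \<Rightarrow> real \<Rightarrow> real \<Rightarrow> real" where
  "lipschitz_const n lam Lam \<equiv> max 16 (5 * Lam * (real n)\<^sup>2 / lam)"

context elliptic_operator
begin

text \<open>The Ishii--Lions method: \<open>2 |x - y| - |x - y|\<^sup>2\<close> is concave in the radial direction, while
  along the diagonal its Hessian vanishes.\<close>

lemma lipschitz_estimate_unit:
  assumes u: "soln F (ball 0 1) u" and cu: "continuous_on (cball 0 1) u"
    and bd: "\<And>x. norm x \<le> 1 \<Longrightarrow> 0 \<le> u x \<and> u x \<le> M" and M: "M > 0" and y1: "norm y1 \<le> 1"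
  shows "u 0 - u y1 \<le> lipschitz_const CARD('n) lam Lam * M * norm y1"
proof (rule ccontr)
  assume neg: "\<not> u 0 - u y1 \<le> lipschitz_const CARD('n) lam Lam * M * norm y1"
  define l where "l = lipschitz_const CARD('n) lam Lam * M / 2"
  have l: "l > 0" "l \<ge> 8 * M" using M by (auto simp: l_def)
  have l2: "l \<ge> 5 * Lam * (real CARD('n))\<^sup>2 / lam * M / 2"
    unfolding l_def using M by (intro divide_right_mono mult_right_mono) auto
  define \<psi> where "\<psi> \<xi> = l * (2 * norm \<xi> - (norm \<xi>)\<^sup>2)" for \<xi> :: "real ^ 'n"
  let ?D1 = "cball (0 :: real ^ 'n) (1/2)" and ?D2 = "cball (0 :: real ^ 'n) 1"
  \<comment> \<open>The localization term equals \<open>2 * M\<close> when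
    \<open>norm (fst z) = 1/2\<close>, more than the oscillation of \<open>u\<close>, so the first
    point stays inside.\<close>
  define \<phi> where "\<phi> z = u (fst z) - u (snd z) - \<psi> (fst z - snd z) - 8 * M * (norm (fst z))\<^sup>2" for z
  have "continuous_on (?D1 \<times> ?D2) \<phi>"
    unfolding \<phi>_def \<psi>_def
    by (intro continuous_intros continuous_on_compose2[OF cu, of _ fst] continuous_on_compose2[OF cu, of _ snd]) auto
  then obtain z where zD: "z \<in> ?D1 \<times> ?D2" and z: "\<And>z'. z' \<in> ?D1 \<times> ?D2 \<Longrightarrow> \<phi> z' \<le> \<phi> z"
    using continuous_attains_sup[of "?D1 \<times> ?D2" \<phi>] compact_Times[of ?D1 ?D2] by auto
  define x0 where "x0 = fst z"
  define y0 where "y0 = snd z"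
  have D: "norm x0 \<le> 1/2" "norm y0 \<le> 1" using zD by (auto simp: x0_def y0_def mem_Times_iff)
  have pos: "\<phi> z > 0"
  proof -
    have "\<psi> (0 - y1) \<le> l * (2 * norm y1)" unfolding \<psi>_def using l by (intro mult_left_mono) auto
    then have "0 < \<phi> (0, y1)" using neg by (simp add: \<phi>_def l_def)
    also have "\<dots> \<le> \<phi> z" using y1 by (intro z) auto
    finally show ?thesis .
  qed
  have \<phi>z: "\<phi> z = u x0 - u y0 - \<psi> (x0 - y0) - 8 * M * (norm x0)\<^sup>2" by (simp add: \<phi>_def x0_def y0_def)
  define \<xi> where "\<xi> = x0 - y0"
  define \<rho> where "\<rho> = norm \<xi>"
  have \<rho>32: "\<rho> \<le> 3/2" using D norm_triangle_ineq4[of x0 y0] by (simp add: \<rho>_def \<xi>_def)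
  have ne: "\<xi> \<noteq> 0"
  proof
    assume "\<xi> = 0"
    then have "x0 = y0" by (simp add: \<xi>_def)
    then have "\<phi> z = - (8 * M * (norm x0)\<^sup>2)" by (simp add: \<phi>z \<psi>_def)
    moreover have "8 * M * (norm x0)\<^sup>2 \<ge> 0" using M by simp
    ultimately show False using pos by linarith
  qed
  then have \<rho>: "\<rho> > 0" by (simp add: \<rho>_def)
  have \<psi>lo: "\<psi> \<xi> \<ge> l * (\<rho> / 2)"
  proof -
    have "\<rho> * \<rho> \<le> \<rho> * (3/2)" using \<rho> \<rho>32 by (intro mult_left_mono) auto
    then show ?thesis unfolding \<psi>_def \<rho>_def[symmetric] using l
      by (intro mult_left_mono) (auto simp: power2_eq_square)
  qed
  have ub: "u x0 - u y0 \<le> M" using bd[of x0] bd[of y0] D by auto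
  have x0: "norm x0 < 1/2"
  proof (rule ccontr)
    assume "\<not> norm x0 < 1/2"
    then have nx: "norm x0 = 1/2" using D by simp
    have "8 * M * (norm x0)\<^sup>2 = 2 * M" unfolding nx by (simp add: power2_eq_square)
    moreover have "\<psi> \<xi> \<ge> 0" using \<psi>lo l \<rho> by (smt (verit) divide_nonneg_pos mult_nonneg_nonneg)
    ultimately show False using pos ub M unfolding \<phi>z \<xi>_def by linarith
  qed
  have \<rho>small: "\<rho> < 1/2"
  proof (rule ccontr)
    assume "\<not> \<rho> < 1/2"
    then have "l * (\<rho> / 2) \<ge> l * (1/4)" using l by (intro mult_left_mono) auto
    moreover have "8 * M * (norm x0)\<^sup>2 \<ge> 0" using M by simp
    ultimately show False using pos ub l M \<psi>lo unfolding \<phi>z \<xi>_def by linarith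
  qed
  have y0: "norm y0 < 1"
  proof -
    have "y0 = x0 - \<xi>" by (simp add: \<xi>_def)
    then have "norm y0 \<le> norm x0 + \<rho>" unfolding \<rho>_def using norm_triangle_ineq4[of x0 \<xi>] by simp
    then show ?thesis using x0 \<rho>small by simp
  qed
  define r where "r = min (1/2 - norm x0) (min (1 - norm y0) (\<rho> / 4))"
  have r: "r > 0" "r \<le> 1/2 - norm x0" "r \<le> 1 - norm y0" "r \<le> \<rho> / 4"
    using x0 y0 \<rho> unfolding r_def by linarith+
  define e where "e = sgn \<xi>"
  have e: "norm e = 1" using ne by (simp add: e_def norm_sgn)
  have ee: "e \<bullet> e = 1" using e by (simp add: dot_square_norm)
  \<comment> \<open>A bound for the Hessian of \<psi> at \<xi>, from
    \<open>norm_add_le_quadratic\<close>: \<open>- 2 * l\<close> along \<open>e\<close>, and of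
    order \<open>l / \<rho>\<close> across. The large transversal part is harmless, because opposite
    increments are tested along \<open>e\<close> only.\<close>
  define Z where "Z \<eta> = l *\<^sub>R ((4 / \<rho>) *\<^sub>R (\<eta> - (e \<bullet> \<eta>) *\<^sub>R e) - 2 *\<^sub>R \<eta>)" for \<eta> :: "real ^ 'n"
  define B where "B z = (Z (fst z - snd z) + (16 * M) *\<^sub>R fst z, - Z (fst z - snd z))"
    for z :: "(real ^ 'n) \<times> (real ^ 'n)"
  have Zlin: "Z (x + y) = Z x + Z y" "Z (c *\<^sub>R x) = c *\<^sub>R Z x" "Z (x - y) = Z x - Z y" for x y c
    by (simp_all add: Z_def inner_simps algebra_simps)
  have Zsym: "x \<bullet> Z y = Z x \<bullet> y" for x y
    by (simp add: Z_def inner_simps inner_commute algebra_simps)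
  have Blin: "linear B"
    by (rule linearI) (simp_all add: B_def Zlin algebra_simps)
  have Bsym: "x \<bullet> B y = B x \<bullet> y" for x y
  proof -
    have "x \<bullet> B y = (fst x - snd x) \<bullet> Z (fst y - snd y) + 16 * M * (fst x \<bullet> fst y)" for x y
      by (simp add: B_def inner_prod_def inner_simps)
    then show ?thesis
      using Zsym[of "fst x - snd x" "fst y - snd y"] by (simp add: inner_commute[of "B x" y] inner_commute)
  qed
  have Bform: "(h, k) \<bullet> B (h, k) = (h - k) \<bullet> Z (h - k) + 16 * M * (norm h)\<^sup>2" for h k
    by (simp add: B_def inner_simps power2_norm_eq_inner algebra_simps)
  have Zform: "\<eta> \<bullet> Z \<eta> = l * (4 / \<rho> * ((norm \<eta>)\<^sup>2 - (e \<bullet> \<eta>)\<^sup>2) - 2 * (norm \<eta>)\<^sup>2)" for \<eta>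
    by (simp add: Z_def inner_simps dot_square_norm inner_commute power2_eq_square algebra_simps)
  have \<psi>up: "\<psi> (\<xi> + \<eta>) - \<psi> \<xi> \<le> (l * (2 - 2 * \<rho>)) * (e \<bullet> \<eta>) + (1/2) * (\<eta> \<bullet> Z \<eta>)" if "norm \<eta> \<le> \<rho> / 2" for \<eta>
  proof -
    have "norm (\<xi> + \<eta>) \<le> \<rho> + e \<bullet> \<eta> + ((norm \<eta>)\<^sup>2 - (e \<bullet> \<eta>)\<^sup>2) / \<rho>"
      using norm_add_le_quadratic[OF ne, of \<eta>] that by (simp add: \<rho>_def e_def)
    moreover have "(norm (\<xi> + \<eta>))\<^sup>2 = \<rho>\<^sup>2 + 2 * \<rho> * (e \<bullet> \<eta>) + (norm \<eta>)\<^sup>2"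
    proof -
      have "\<xi> = \<rho> *\<^sub>R e" using ne by (simp add: e_def \<rho>_def sgn_div_norm)
      have "(norm (\<rho> *\<^sub>R e + \<eta>))\<^sup>2 = \<rho>\<^sup>2 + 2 * \<rho> * (e \<bullet> \<eta>) + (norm \<eta>)\<^sup>2"
        unfolding power2_norm_eq_inner
        by (simp add: inner_simps inner_commute ee power2_eq_square algebra_simps)
      then show ?thesis unfolding \<open>\<xi> = \<rho> *\<^sub>R e\<close>[symmetric] .
    qed
    ultimately have "2 * norm (\<xi> + \<eta>) - (norm (\<xi> + \<eta>))\<^sup>2 - (2 * \<rho> - \<rho>\<^sup>2)
       \<le> (2 - 2 * \<rho>) * (e \<bullet> \<eta>) + (2 * (((norm \<eta>)\<^sup>2 - (e \<bullet> \<eta>)\<^sup>2) / \<rho>) - (norm \<eta>)\<^sup>2)"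
      unfolding left_diff_distrib mult.assoc by linarith
    then have "l * (2 * norm (\<xi> + \<eta>) - (norm (\<xi> + \<eta>))\<^sup>2 - (2 * \<rho> - \<rho>\<^sup>2))
       \<le> l * ((2 - 2 * \<rho>) * (e \<bullet> \<eta>) + (2 * (((norm \<eta>)\<^sup>2 - (e \<bullet> \<eta>)\<^sup>2) / \<rho>) - (norm \<eta>)\<^sup>2))"
      using l by (intro mult_left_mono) auto
    moreover have "l * (2 * norm (\<xi> + \<eta>) - (norm (\<xi> + \<eta>))\<^sup>2 - (2 * \<rho> - \<rho>\<^sup>2)) = \<psi> (\<xi> + \<eta>) - \<psi> \<xi>"
      by (simp add: \<psi>_def \<rho>_def algebra_simps)
    moreover have "l * ((2 - 2 * \<rho>) * (e \<bullet> \<eta>) + (2 * (((norm \<eta>)\<^sup>2 - (e \<bullet> \<eta>)\<^sup>2) / \<rho>) - (norm \<eta>)\<^sup>2))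
      = (l * (2 - 2 * \<rho>)) * (e \<bullet> \<eta>) + (1/2) * (\<eta> \<bullet> Z \<eta>)"
      unfolding Zform by (simp add: algebra_simps diff_divide_distrib add_divide_distrib)
    ultimately show ?thesis by simp
  qed
  have balls: "ball x0 r \<subseteq> ball 0 1" "ball y0 r \<subseteq> ball 0 1" "cball x0 r \<subseteq> cball 0 1" "cball y0 r \<subseteq> cball 0 1"
    using r D by (auto simp: ball_subset_ball_iff cball_subset_cball_iff dist_norm)
  obtain X Y where XY: "symmetric_matrix X" "symmetric_matrix Y" "F X \<le> 0" "0 \<le> F Y"
    "\<And>h k. h \<bullet> (X *v h) - k \<bullet> (Y *v k) \<le> (h, k) \<bullet> B (h, k) + M * ((norm h)\<^sup>2 + (norm k)\<^sup>2)"
  proof (rule theorem_on_sums[OF r(1), of F x0 u y0 u B M "(l * (2 - 2 * \<rho>)) *\<^sub>R e + (16 * M) *\<^sub>R x0" "- ((l * (2 - 2 * \<rho>)) *\<^sub>R e)"])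
    show "subsol F (ball x0 r) u" by (rule subsol_mono[OF _ balls(1)]) (use u in \<open>simp add: soln_def\<close>)
    show "supersol F (ball y0 r) u" by (rule supersol_mono[OF _ balls(2)]) (use u in \<open>simp add: soln_def\<close>)
    show "continuous_on (cball x0 r) u" by (rule continuous_on_subset[OF cu balls(3)])
    show "continuous_on (cball y0 r) u" by (rule continuous_on_subset[OF cu balls(4)])
    show "linear B" "\<And>x y. x \<bullet> B y = B x \<bullet> y" by (fact Blin Bsym)+
    show "M > 0" by (fact M)
    show "u (x0 + h) - u (y0 + k) \<le> u x0 - u y0 + ((l * (2 - 2 * \<rho>)) *\<^sub>R e + (16 * M) *\<^sub>R x0) \<bullet> h
        + - ((l * (2 - 2 * \<rho>)) *\<^sub>R e) \<bullet> k + 1 / 2 * ((h, k) \<bullet> B (h, k))"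
      if hk: "norm h \<le> r" "norm k \<le> r" for h k
    proof -
      have "norm (x0 + h) \<le> 1/2" "norm (y0 + k) \<le> 1"
        using hk r norm_triangle_ineq[of x0 h] norm_triangle_ineq[of y0 k] by auto
      then have "\<phi> (x0 + h, y0 + k) \<le> \<phi> z" by (intro z) auto
      moreover have "x0 + h - (y0 + k) = \<xi> + (h - k)" by (simp add: \<xi>_def)
      ultimately have "u (x0 + h) - u (y0 + k) \<le> u x0 - u y0 + (\<psi> (\<xi> + (h - k)) - \<psi> \<xi>)
          + 8 * M * (norm (x0 + h))\<^sup>2 - 8 * M * (norm x0)\<^sup>2"
        unfolding \<phi>z by (simp add: \<phi>_def \<xi>_def)
      moreover have "norm (h - k) \<le> \<rho> / 2" using hk r norm_triangle_ineq4[of h k] by simp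
      note \<psi>up[OF this]
      moreover have "8 * M * (norm (x0 + h))\<^sup>2 = 8 * M * (norm x0)\<^sup>2 + (16 * M) * (x0 \<bullet> h) + 8 * M * (norm h)\<^sup>2"
        by (simp add: power2_norm_eq_inner inner_simps inner_commute algebra_simps)
      ultimately show ?thesis unfolding Bform by (simp add: inner_simps algebra_simps)
    qed
  qed (rule that)
  define n where "n = real CARD('n)"
  have n: "n > 0" by (simp add: n_def)
  have "F Y \<le> F X + Lam * real CARD('n) * (18 * M) - lam / real CARD('n) * (18 * M - (e \<bullet> (X *v e) - e \<bullet> (Y *v e)))"
  proof (rule F_le_of_form_diff_le[OF XY(1,2) _ e])
    show "h \<bullet> (X *v h) - h \<bullet> (Y *v h) \<le> 18 * M * (norm h)\<^sup>2" for h
      using XY(5)[of h h] unfolding Bform Zform by simp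
  qed (use M in simp)
  \<comment> \<open>For the increments \<open>e\<close> and \<open>- e\<close> the form
    \<open>Z\<close> is evaluated at twice \<open>e\<close>, which gives \<open>- 8 * l\<close>;
    \<open>18 * M\<close> collects \<open>16 * M\<close> from the localization and
    \<open>2 * M\<close> from the theorem on sums, applied with \<delta> equal to
    \<open>M\<close>.\<close>
  moreover have "e \<bullet> (X *v e) - e \<bullet> (Y *v e) \<le> - 8 * l + 18 * M"
  proof -
    have "(e - - e) \<bullet> Z (e - - e) = - 8 * l"
    proof -
      have "e - - e = 2 *\<^sub>R e" by (simp add: scaleR_2)
      then show ?thesis unfolding Zform by (simp add: e ee power2_eq_square)
    qed
    moreover have "(- e) \<bullet> (Y *v (- e)) = e \<bullet> (Y *v e)"
      using matrix_vector_mult_scaleR[of Y "-1" e] by simp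
    ultimately show ?thesis using XY(5)[of e "- e"] unfolding Bform by (simp add: e)
  qed
  then have "lam / real CARD('n) * (18 * M - (e \<bullet> (X *v e) - e \<bullet> (Y *v e))) \<ge> lam / real CARD('n) * (8 * l)"
    using lam by (intro mult_left_mono) auto
  ultimately have "0 \<le> Lam * n * (18 * M) - lam / n * (8 * l)" using XY(3,4) by (simp add: n_def)
  moreover have "lam / n * (8 * l) \<ge> lam / n * (8 * (5 * Lam * n\<^sup>2 / lam * M / 2))"
    using l2 lam n by (intro mult_left_mono) (auto simp: n_def)
  moreover have "lam / n * (8 * (5 * Lam * n\<^sup>2 / lam * M / 2)) = 20 * (Lam * n * M)"
    using lam n by (simp add: power2_eq_square field_simps)
  moreover have "Lam * n * M > 0" using lam n M by simp
  ultimately show False by (simp add: algebra_simps)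
qed

lemma lipschitz_estimate:
  assumes R: "R > 0" and u: "soln F (ball c R) u" and cu: "continuous_on (cball c R) u"
    and bd: "\<And>x. x \<in> cball c R \<Longrightarrow> 0 \<le> u x \<and> u x \<le> M" and M: "M > 0" and y: "norm (y - c) \<le> R"
  shows "u c - u y \<le> lipschitz_const CARD('n) lam Lam * M * norm (y - c) / R"
proof -
  have mem: "c + R *\<^sub>R x \<in> cball c R \<longleftrightarrow> norm x \<le> 1" "c + R *\<^sub>R x \<in> ball c R \<longleftrightarrow> norm x < 1" for x
    using R by (auto simp: dist_norm)
  have "soln F {x. c + R *\<^sub>R x \<in> ball c R} (\<lambda>x. u (c + R *\<^sub>R x))" by (rule soln_rescale[OF u R])
  then have "soln F (ball 0 1) (\<lambda>x. u (c + R *\<^sub>R x))" by (rule soln_mono) (auto simp: mem simp del: mem_ball)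
  moreover have "continuous_on (cball 0 1) (\<lambda>x. u (c + R *\<^sub>R x))"
    by (rule continuous_on_compose2[OF cu]) (auto intro!: continuous_intros simp: mem simp del: mem_cball)
  ultimately have "u (c + R *\<^sub>R 0) - u (c + R *\<^sub>R ((1/R) *\<^sub>R (y - c))) \<le> lipschitz_const CARD('n) lam Lam * M * norm ((1/R) *\<^sub>R (y - c))"
    by (rule lipschitz_estimate_unit) (use bd mem M y R in auto)
  then show ?thesis using R by simp
qed

text \<open>At a maximum \<open>x1\<close> of \<open>u x * (1 - |x|) ^ \<beta>\<close>, where \<open>\<beta>\<close> is the decay rate of the barrier, the
  Lipschitz estimate makes \<open>u\<close> comparable to \<open>u x1\<close> on a ball of radius proportional to \<open>1 - |x1|\<close>;
  a barrier carries this lower bound to the origin.\<close>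

lemma harnack_unit:
  obtains C where "C \<ge> 1" "\<And>u x. soln F (ball 0 4) u \<Longrightarrow> continuous_on (cball 0 4) u \<Longrightarrow>
    (\<And>z. norm z \<le> 4 \<Longrightarrow> 0 \<le> u z) \<Longrightarrow> norm x \<le> 1/2 \<Longrightarrow> u x \<le> C * u 0"
proof -
  define m where "m = barrier_exponent CARD('n) lam Lam"
  define \<beta> where "\<beta> = 4 * m"
  have m: "m \<ge> 1" using barrier_exponent by (simp add: m_def)
  have bar: "bar y x = inverse (norm (x - y) ^ \<beta>)" for x y
    by (simp add: barrier_def \<beta>_def m_def power_mult[symmetric])
  \<comment> \<open>On the ball of radius \<open>d / 2\<close> around the maximum point
    \<open>u\<close> is at most \<open>2 ^ \<beta> * M\<close>, and with this \<theta> the Lipschitz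
    estimate permits a drop of at most \<open>M / 2\<close> within distance
    \<open>\<theta> * d\<close>.\<close>
  define \<theta> :: real where "\<theta> = 1 / (4 * lipschitz_const CARD('n) lam Lam * 2 ^ \<beta>)"
  have L2: "lipschitz_const CARD('n) lam Lam * 2 ^ \<beta> \<ge> 16"
    using mult_mono[of 16 "lipschitz_const CARD('n) lam Lam" 1 "2 ^ \<beta>"] by simp
  have \<theta>: "\<theta> > 0" "\<theta> \<le> 1/4"
  proof -
    have p: "4 * lipschitz_const CARD('n) lam Lam * 2 ^ \<beta> \<ge> 4" using L2 by simp
    then show "\<theta> > 0" unfolding \<theta>_def by (smt (verit) divide_pos_pos)
    show "\<theta> \<le> 1/4" unfolding \<theta>_def using p by (intro divide_left_mono) auto
  qed
  define C where "C = 4 * (2 / \<theta>) ^ \<beta>"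
  have C: "C \<ge> 1"
  proof -
    have "(2 / \<theta>) ^ \<beta> \<ge> 1" using \<theta> by (intro one_le_power) (simp add: field_simps)
    then show ?thesis by (simp add: C_def)
  qed
  have "u x \<le> C * u 0" if u: "soln F (ball 0 4) u" and cu: "continuous_on (cball 0 4) u"
    and nn: "\<And>z. norm z \<le> 4 \<Longrightarrow> 0 \<le> u z" and x: "norm x \<le> 1/2" for u x
  proof -
    define g where "g x = u x * (1 - norm x) ^ \<beta>" for x
    have "continuous_on (cball 0 1) g"
      unfolding g_def by (intro continuous_intros continuous_on_subset[OF cu]) auto
    then obtain x1 where x1: "norm x1 \<le> 1" "\<And>y. norm y \<le> 1 \<Longrightarrow> g y \<le> g x1"
      using continuous_attains_sup[of "cball 0 1" g] by auto
    have ux: "u x * (1/2) ^ \<beta> \<le> g x1"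
    proof -
      have "u x * (1/2) ^ \<beta> \<le> g x" unfolding g_def
        using x nn[of x] by (intro mult_left_mono power_mono) auto
      then show ?thesis using x1(2)[of x] x by linarith
    qed
    have C0: "0 \<le> C * u 0" using C nn[of 0] by simp
    show ?thesis
    proof (cases "g x1 > 0")
      case False
      then have "u x * (1/2) ^ \<beta> \<le> 0" using ux by linarith
      then have "u x \<le> 0" using mult_right_le_imp_le[of "u x" "(1/2) ^ \<beta>" 0] by simp
      then show ?thesis using C0 by linarith
    next
      case True
      define d where "d = 1 - norm x1"
      define M where "M = u x1"
      have d: "d > 0" "d \<le> 1"
      proof -
        have "d \<noteq> 0"
        proof
          assume "d = 0"
          then have "g x1 = 0" using m by (simp add: g_def d_def \<beta>_def)
          then show False using True by simp
        qed
        then show "d > 0" using x1 by (simp add: d_def)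
        show "d \<le> 1" by (simp add: d_def)
      qed
      have gM: "g x1 = M * d ^ \<beta>" by (simp add: g_def d_def M_def)
      have M: "M > 0" using True d unfolding gM by (simp add: zero_less_mult_iff)
      have nb: "norm y \<le> 1 - d / 2" if "y \<in> cball x1 (d/2)" for y
      proof -
        have "norm (y - x1) \<le> d / 2" using that by (simp add: dist_norm norm_minus_commute)
        moreover have "norm x1 = 1 - d" by (simp add: d_def)
        ultimately show ?thesis using norm_triangle_ineq[of "y - x1" x1] by simp
      qed
      have ub: "0 \<le> u y \<and> u y \<le> 2 ^ \<beta> * M" if y: "y \<in> cball x1 (d/2)" for y
      proof
        show u0: "0 \<le> u y" using nb[OF y] d by (intro nn) auto
        have "u y * (d/2) ^ \<beta> \<le> g y" unfolding g_def
          using nb[OF y] d u0 by (intro mult_left_mono power_mono) auto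
        also have "\<dots> \<le> M * d ^ \<beta>" using x1(2)[of y] nb[OF y] d gM by simp
        finally show "u y \<le> 2 ^ \<beta> * M" using d by (simp add: power_divide field_simps)
      qed
      have sub: "cball x1 (d/2) \<subseteq> ball 0 4" using nb d by fastforce
      have low: "u y \<ge> M / 2" if y: "norm (y - x1) \<le> \<theta> * d" for y
      proof -
        have "\<theta> * d \<le> 1/4 * d" using \<theta> d by (intro mult_right_mono) auto
        then have y2: "norm (y - x1) \<le> d / 2" using y d by linarith
        have "u x1 - u y \<le> lipschitz_const CARD('n) lam Lam * (2 ^ \<beta> * M) * norm (y - x1) / (d / 2)"
        proof (rule lipschitz_estimate[OF _ _ _ ub _ y2])
          show "soln F (ball x1 (d/2)) u" by (rule soln_mono[OF u order_trans[OF ball_subset_cball sub]])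
          show "continuous_on (cball x1 (d/2)) u"
            by (rule continuous_on_subset[OF cu order_trans[OF sub ball_subset_cball]])
        qed (use d M in auto)
        also have "\<dots> \<le> lipschitz_const CARD('n) lam Lam * (2 ^ \<beta> * M) * (\<theta> * d) / (d / 2)"
          using y d M by (intro divide_right_mono mult_left_mono) auto
        also have "\<dots> = (lipschitz_const CARD('n) lam Lam * 2 ^ \<beta>) * \<theta> * (2 * M)" using d by simp
        also have "(lipschitz_const CARD('n) lam Lam * 2 ^ \<beta>) * \<theta> = 1/4" unfolding \<theta>_def using L2 by simp
        finally show ?thesis by (simp add: M_def)
      qed
      \<comment> \<open>Makes \<open>\<epsilon> * bar x1\<close> equal to \<open>M / 2\<close> on
        the inner sphere. Since \<beta> is also the exponent of the weight in \<open>g\<close>,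
        \<epsilon> is a fixed multiple of \<open>g x1\<close>, wherever \<open>x1\<close>
        lies.\<close>
      define \<epsilon> where "\<epsilon> = M / 2 * (\<theta> * d) ^ \<beta>"
      have \<theta>d: "\<theta> * d > 0" "\<theta> * d \<le> 1"
        using \<theta> d mult_mono[of \<theta> 1 d 1] by auto
      have \<epsilon>: "\<epsilon> > 0" using M \<theta>d by (simp add: \<epsilon>_def)
      have \<epsilon>M: "\<epsilon> \<le> M / 2"
        unfolding \<epsilon>_def using M power_le_one[of "\<theta> * d" \<beta>] \<theta>d by (simp add: mult_left_le)
      have u0: "u 0 \<ge> \<epsilon> / 2"
      proof (cases "norm x1 \<le> \<theta> * d")
        case True
        then show ?thesis using low[of 0] \<epsilon>M \<epsilon> by simp
      next
        case False
        \<comment> \<open>The outer radius 3 keeps the annulus in the ball of radius 4, while the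
          origin is at distance at most 1 from \<open>x1\<close>; the barrier, lowered by its value
          at distance 3, vanishes on the outer sphere.\<close>
        let ?A = "annulus x1 (\<theta> * d) 3"
        have clA: "closure ?A \<subseteq> cball 0 4"
        proof
          fix y assume "y \<in> closure ?A"
          then have "norm (y - x1) \<le> 3" using closure_annulus_subset[of x1 "\<theta> * d" 3] by auto
          then show "y \<in> cball 0 4" using norm_triangle_ineq[of "y - x1" x1] x1(1) by simp
        qed
        have "?A \<subseteq> ball 0 4"
        proof
          fix y assume "y \<in> ?A"
          then show "y \<in> ball 0 4" using norm_triangle_ineq[of "y - x1" x1] x1(1) by (simp add: annulus_def)
        qed
        then have super: "supersol F ?A u" using u by (auto simp: soln_def intro: supersol_mono)
        have "\<epsilon> * bar x1 0 + - (\<epsilon> * inverse (3 ^ \<beta>)) \<le> u 0"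
        proof (rule supersol_ge_barrier[OF open_annulus bounded_annulus super])
          show "continuous_on (closure ?A) u" by (rule continuous_on_subset[OF cu clA])
          show "x1 \<notin> closure ?A" using closure_annulus_subset[of x1 "\<theta> * d" 3] \<theta>d by auto
          show "\<epsilon> > 0" by (rule \<epsilon>)
          have "0 \<in> ?A" using False x1(1) by (simp add: annulus_def)
          then show "0 \<in> closure ?A" using closure_subset by blast
          show "\<epsilon> * bar x1 y + - (\<epsilon> * inverse (3 ^ \<beta>)) \<le> u y" if y: "y \<in> frontier ?A" for y
            using frontier_annulusD[OF y]
          proof
            assume n: "norm (y - x1) = \<theta> * d"
            have "M / 2 * P * inverse P = M / 2" if "P > 0" for P :: real using that by simp
            from this[of "(\<theta> * d) ^ \<beta>"] have "\<epsilon> * bar x1 y = M / 2"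
              unfolding bar n \<epsilon>_def using zero_less_power[OF \<theta>d(1)] by blast
            moreover have "\<epsilon> * inverse (3 ^ \<beta>) \<ge> 0" using \<epsilon> by simp
            moreover have "u y \<ge> M / 2" using n by (intro low) simp
            ultimately show ?thesis by linarith
          next
            assume n: "norm (y - x1) = 3"
            have "y \<in> cball 0 4" using clA y by (auto simp: frontier_def)
            then show ?thesis unfolding bar n using nn[of y] by simp
          qed
        qed
        moreover have "bar x1 0 \<ge> 1"
        proof -
          have "norm x1 > 0" using False \<theta>d by linarith
          then have "norm x1 ^ \<beta> \<le> 1" "norm x1 ^ \<beta> > 0" using x1(1) by (auto intro: power_le_one)
          then show ?thesis unfolding bar by (simp add: one_le_inverse)
        qed
        then have "\<epsilon> * 1 \<le> \<epsilon> * bar x1 0" using \<epsilon> by (intro mult_left_mono) auto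
        moreover have "inverse (3 ^ \<beta>) \<le> (1/2 :: real)"
        proof -
          have "(2::real) \<le> 3 ^ 1" by simp
          also have "\<dots> \<le> 3 ^ \<beta>" using m by (intro power_increasing) (auto simp: \<beta>_def)
          finally have "inverse (3 ^ \<beta>) \<le> inverse (2::real)" by (intro le_imp_inverse_le) auto
          then show ?thesis by simp
        qed
        then have "\<epsilon> * inverse (3 ^ \<beta>) \<le> \<epsilon> * (1/2)" using \<epsilon> by (intro mult_left_mono) auto
        ultimately show ?thesis by linarith
      qed
      have "u x \<le> 2 ^ \<beta> * g x1" using ux by (simp add: power_divide field_simps)
      also have "\<dots> = C * (\<epsilon> / 2)"
        unfolding gM C_def \<epsilon>_def using \<theta> by (simp add: power_mult_distrib power_divide)
      also have "\<dots> \<le> C * u 0" using u0 C by (intro mult_left_mono) auto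
      finally show ?thesis .
    qed
  qed
  with C show thesis by (rule that)
qed

lemma harnack_ball:
  obtains C where "C \<ge> 1" "\<And>u y R x. R > 0 \<Longrightarrow> soln F (ball y R) u \<Longrightarrow> continuous_on (cball y R) u \<Longrightarrow>
    (\<And>z. z \<in> cball y R \<Longrightarrow> 0 \<le> u z) \<Longrightarrow> norm (x - y) \<le> R / 8 \<Longrightarrow> u x \<le> C * u y"
proof -
  obtain C where C: "C \<ge> 1" "\<And>u x. soln F (ball 0 4) u \<Longrightarrow> continuous_on (cball 0 4) u \<Longrightarrow>
    (\<And>z. norm z \<le> 4 \<Longrightarrow> 0 \<le> u z) \<Longrightarrow> norm x \<le> 1/2 \<Longrightarrow> u x \<le> C * u 0"
    using harnack_unit by blast
  have "u x \<le> C * u y" if R: "R > 0" and u: "soln F (ball y R) u" and cu: "continuous_on (cball y R) u"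
    and nn: "\<And>z. z \<in> cball y R \<Longrightarrow> 0 \<le> u z" and x: "norm (x - y) \<le> R / 8" for u y R x
  proof -
    define r where "r = R / 4"
    have r: "r > 0" using R by (simp add: r_def)
    have mem: "y + r *\<^sub>R z \<in> cball y R \<longleftrightarrow> norm z \<le> 4" "y + r *\<^sub>R z \<in> ball y R \<longleftrightarrow> norm z < 4" for z
      using R by (auto simp: dist_norm r_def)
    have "soln F {x. y + r *\<^sub>R x \<in> ball y R} (\<lambda>x. u (y + r *\<^sub>R x))" by (rule soln_rescale[OF u r])
    then have "soln F (ball 0 4) (\<lambda>x. u (y + r *\<^sub>R x))" by (rule soln_mono) (auto simp: mem simp del: mem_ball)
    moreover have "continuous_on (cball 0 4) (\<lambda>x. u (y + r *\<^sub>R x))"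
      by (rule continuous_on_compose2[OF cu]) (auto intro!: continuous_intros simp: mem simp del: mem_cball)
    ultimately have "u (y + r *\<^sub>R ((1/r) *\<^sub>R (x - y))) \<le> C * u (y + r *\<^sub>R 0)"
    proof (rule C(2))
      show "0 \<le> u (y + r *\<^sub>R z)" if "norm z \<le> 4" for z using nn mem that by blast
      have "norm ((1/r) *\<^sub>R (x - y)) = norm (x - y) / r" using r by simp
      also have "\<dots> \<le> 1/2" using x R by (simp add: r_def field_simps)
      finally show "norm ((1/r) *\<^sub>R (x - y)) \<le> 1/2" .
    qed
    then show ?thesis using r by simp
  qed
  with C(1) show thesis by (rule that)
qed

end

text \<open>Gram-Schmidt applied to \<open>b\<close>. If \<open>b\<close> is \<open>a\<close> or
  \<open>- a\<close>, the direction \<open>e\<close> is any unit vector orthogonal to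
  \<open>a\<close>, and this is where the dimension enters.\<close>

lemma great_circle:
  fixes a b :: "real ^ 'n"
  assumes n: "CARD('n) \<ge> 2" and ab: "norm a = 1" "norm b = 1"
  obtains e t where "norm e = 1" "a \<bullet> e = 0" "0 \<le> t" "t \<le> pi" "b = cos t *\<^sub>R a + sin t *\<^sub>R e"
proof -
  define c where "c = a \<bullet> b"
  have c: "-1 \<le> c" "c \<le> 1" using Cauchy_Schwarz_ineq2[of a b] ab by (auto simp: c_def abs_le_iff)
  define t where "t = arccos c"
  have t: "0 \<le> t" "t \<le> pi" "cos t = c" "sin t = sqrt (1 - c\<^sup>2)"
    using c by (auto simp: t_def arccos_lbound arccos_ubound sin_arccos)
  have aa: "a \<bullet> a = 1" "b \<bullet> b = 1" using ab by (auto simp: dot_square_norm)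
  define w where "w = b - c *\<^sub>R a"
  have wa: "a \<bullet> w = 0" by (simp add: w_def inner_simps aa c_def)
  have "(norm w)\<^sup>2 = 1 - c\<^sup>2"
    unfolding w_def power2_norm_eq_inner
    by (simp add: inner_simps aa inner_commute c_def power2_eq_square algebra_simps)
  then have nw: "norm w = sin t" unfolding t by (metis norm_ge_zero real_sqrt_unique)
  show thesis
  proof (cases "w = 0")
    case False
    show thesis
    proof (rule that[of "(1 / norm w) *\<^sub>R w" t])
      show "b = cos t *\<^sub>R a + sin t *\<^sub>R (1 / norm w) *\<^sub>R w"
        using False unfolding nw[symmetric] t(3) by (simp add: w_def)
    qed (use False wa t in auto)
  next
    case True
    obtain e0 :: "real ^ 'n" where e0: "e0 \<noteq> 0" "orthogonal a e0"
      using orthogonal_to_vector_exists[of a] n by auto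
    show thesis
    proof (rule that[of "(1 / norm e0) *\<^sub>R e0" t])
      have "sin t = 0" using True nw by simp
      then show "b = cos t *\<^sub>R a + sin t *\<^sub>R (1 / norm e0) *\<^sub>R e0"
        using True unfolding t(3) by (simp add: w_def)
    qed (use e0 t in \<open>auto simp: orthogonal_def\<close>)
  qed
qed

text \<open>A chain of 128 balls along a great circle. Around a point of norm \<open>r\<close> the
  ball of radius \<open>r / 4\<close> avoids the ball of radius \<rho> about 0, and the steps have
  length at most \<open>r * pi / 128\<close>, below the \<open>r / 32\<close> that
  \<open>harnack_ball\<close> allows.\<close>

lemma (in elliptic_operator) harnack_sphere:
  assumes n: "CARD('n) \<ge> 2"
  obtains C where "C \<ge> 1" "\<And>u \<rho> r x y. \<rho> > 0 \<Longrightarrow> soln F {x. \<rho> < norm x} u \<Longrightarrow>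
    (\<And>z. \<rho> < norm z \<Longrightarrow> 0 \<le> u z) \<Longrightarrow> r \<ge> 2 * \<rho> \<Longrightarrow> norm x = r \<Longrightarrow> norm y = r \<Longrightarrow> u x \<le> C * u y"
proof -
  obtain C where C: "C \<ge> 1" "\<And>u y R x. R > 0 \<Longrightarrow> soln F (ball y R) u \<Longrightarrow> continuous_on (cball y R) u \<Longrightarrow>
    (\<And>z. z \<in> cball y R \<Longrightarrow> 0 \<le> u z) \<Longrightarrow> norm (x - y) \<le> R / 8 \<Longrightarrow> u x \<le> C * u y"
    using harnack_ball by blast
  have "u x \<le> C ^ 128 * u y" if \<rho>: "\<rho> > 0" and u: "soln F {x. \<rho> < norm x} u"
    and nn: "\<And>z. \<rho> < norm z \<Longrightarrow> 0 \<le> u z" and r: "r \<ge> 2 * \<rho>" and xy: "norm x = r" "norm y = r" for u \<rho> r x y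
  proof -
    have r0: "r > 0" using \<rho> r by simp
    have step: "u p \<le> C * u q" if pq: "norm q = r" "norm (p - q) \<le> r / 32" for p q
    proof -
      have sub: "cball q (r/4) \<subseteq> {x. \<rho> < norm x}"
      proof
        fix z assume "z \<in> cball q (r/4)"
        then have "norm z \<ge> r - r/4"
          using norm_triangle_ineq2[of q "q - z"] pq(1) by (simp add: dist_norm)
        then show "z \<in> {x. \<rho> < norm x}" using r \<rho> by simp
      qed
      show ?thesis
      proof (rule C(2))
        show "r / 4 > 0" using r0 by simp
        show "soln F (ball q (r/4)) u" by (rule soln_mono[OF u order_trans[OF ball_subset_cball sub]])
        show "continuous_on (cball q (r/4)) u"
          using u sub unfolding soln_def by (blast intro: continuous_on_subset)
        show "0 \<le> u z" if "z \<in> cball q (r/4)" for z using nn sub that by blast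
        show "norm (p - q) \<le> r / 4 / 8" using pq by simp
      qed
    qed
    obtain e t where et: "norm e = 1" "((1/r) *\<^sub>R x) \<bullet> e = 0" "0 \<le> t" "t \<le> pi"
      "(1/r) *\<^sub>R y = cos t *\<^sub>R ((1/r) *\<^sub>R x) + sin t *\<^sub>R e"
      using great_circle[OF n, of "(1/r) *\<^sub>R x" "(1/r) *\<^sub>R y"] xy r0 by auto
    define a where "a = (1/r) *\<^sub>R x"
    define p where "p s = r *\<^sub>R (cos s *\<^sub>R a + sin s *\<^sub>R e)" for s
    have aa: "a \<bullet> a = 1" "e \<bullet> e = 1" "a \<bullet> e = 0"
      using xy r0 et by (auto simp: a_def dot_square_norm)
    have np: "norm (p s) = r" for s
    proof -
      have "(norm (cos s *\<^sub>R a + sin s *\<^sub>R e))\<^sup>2 = (cos s)\<^sup>2 + (sin s)\<^sup>2"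
        unfolding power2_norm_eq_inner using aa by (simp add: inner_simps inner_commute power2_eq_square)
      then have "norm (cos s *\<^sub>R a + sin s *\<^sub>R e) = 1" by (simp add: power2_eq_1_iff) (smt (verit) norm_ge_zero)
      then show ?thesis using r0 by (simp add: p_def)
    qed
    have dp: "norm (p s - p s') \<le> r * \<bar>s - s'\<bar>" for s s'
    proof -
      have "(norm (p s - p s'))\<^sup>2 = r\<^sup>2 * (2 - 2 * cos (s - s'))"
      proof -
        have eq: "p s - p s' = r *\<^sub>R ((cos s - cos s') *\<^sub>R a + (sin s - sin s') *\<^sub>R e)"
          by (simp add: p_def algebra_simps)
        have "(norm (A *\<^sub>R a + B *\<^sub>R e))\<^sup>2 = A\<^sup>2 + B\<^sup>2" for A B :: real
          unfolding power2_norm_eq_inner using aa by (simp add: inner_simps inner_commute power2_eq_square)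
        then have "(norm (p s - p s'))\<^sup>2 = r\<^sup>2 * ((cos s - cos s')\<^sup>2 + (sin s - sin s')\<^sup>2)"
          unfolding eq by (simp add: power_mult_distrib)
        also have "(cos s - cos s')\<^sup>2 + (sin s - sin s')\<^sup>2
            = ((cos s)\<^sup>2 + (sin s)\<^sup>2) + ((cos s')\<^sup>2 + (sin s')\<^sup>2) - 2 * (cos s * cos s' + sin s * sin s')"
          by (simp add: power2_eq_square algebra_simps)
        also have "\<dots> = 2 - 2 * cos (s - s')" by (simp add: cos_diff)
        finally show ?thesis .
      qed
      also have "2 - 2 * cos (s - s') \<le> (s - s')\<^sup>2"
      proof -
        have e: "2 * ((s - s') / 2) = s - s'" by simp
        have "cos (s - s') = 1 - 2 * (sin ((s - s') / 2))\<^sup>2"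
          using cos_double_sin[of "(s - s') / 2"] unfolding e .
        moreover have "(sin ((s - s') / 2))\<^sup>2 \<le> ((s - s') / 2)\<^sup>2"
          by (rule abs_le_square_iff[THEN iffD1, OF abs_sin_x_le_abs_x])
        ultimately show ?thesis by (simp add: power_divide)
      qed
      then have "r\<^sup>2 * (2 - 2 * cos (s - s')) \<le> r\<^sup>2 * (s - s')\<^sup>2" by (intro mult_left_mono) auto
      also have "\<dots> = (r * \<bar>s - s'\<bar>)\<^sup>2" by (simp add: power_mult_distrib)
      finally show ?thesis by (rule power2_le_imp_le) (use r0 in simp)
    qed
    have "u x \<le> C ^ k * u (p (t * real k / 128))" for k :: nat
    proof (induction k)
      case 0
      have "p 0 = x" using r0 by (simp add: p_def a_def)
      then show ?case by simp
    next
      case (Suc k)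
      have "norm (p (t * real k / 128) - p (t * real (Suc k) / 128)) \<le> r * \<bar>t * real k / 128 - t * real (Suc k) / 128\<bar>"
        by (rule dp)
      also have "\<bar>t * real k / 128 - t * real (Suc k) / 128\<bar> = t / 128" using et(3) by (simp add: field_simps)
      also have "r * (t / 128) \<le> r * (1 / 32)"
        using et(4) pi_less_4 r0 by (intro mult_left_mono) auto
      finally have "u (p (t * real k / 128)) \<le> C * u (p (t * real (Suc k) / 128))"
        by (intro step np) simp
      then have "C ^ k * u (p (t * real k / 128)) \<le> C ^ k * (C * u (p (t * real (Suc k) / 128)))"
        using C(1) by (intro mult_left_mono) auto
      then show ?case using Suc by (simp add: mult_ac)
    qed
    from this[of 128] have "u x \<le> C ^ 128 * u (p t)" by simp
    moreover have "p t = y"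
    proof -
      have "p t = r *\<^sub>R ((1/r) *\<^sub>R y)" unfolding p_def a_def et(5) ..
      then show ?thesis using r0 by simp
    qed
    ultimately show ?thesis by simp
  qed
  moreover have "C ^ 128 \<ge> 1" using C(1) by (rule one_le_power)
  ultimately show thesis using that by blast
qed

section \<open>Strong comparison and blow-down\<close>

context elliptic_operator
begin

lemma barrier_mono:
  assumes "0 < a" "a \<le> norm (x - y)"
  shows "barrier m y x \<le> inverse ((a\<^sup>2) ^ (2 * m))"
  unfolding barrier_def using assms by (intro le_imp_inverse_le power_mono zero_less_power) auto

text \<open>Hopf's argument: at a boundary point \<open>x1\<close> of the contact set touched by a ball from outside,
  \<open>V\<close> can be raised by a small multiple of a barrier.\<close>

lemma strong_comparison_local:
  assumes V: "subsol F \<Omega> V" and U: "supersol F \<Omega> U"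
    and cV: "continuous_on \<Omega> V" and cU: "continuous_on \<Omega> U" and le: "\<And>x. x \<in> \<Omega> \<Longrightarrow> V x \<le> U x"
    and x: "U x = V x" and s: "s > 0" and b: "ball x (4 * s) \<subseteq> \<Omega>" and y: "norm (y - x) < s"
  shows "U y = V y"
proof (rule ccontr)
  assume ne: "U y \<noteq> V y"
  have mem: "z \<in> \<Omega>" if "norm (z - x) < 4 * s" for z
    using that b by (auto simp: subset_eq dist_norm norm_minus_commute)
  define K where "K = {z \<in> cball x (2 * s). U z - V z = 0}"
  have sub: "cball x (2 * s) \<subseteq> \<Omega>" using mem s by (auto simp: dist_norm norm_minus_commute)
  have cUV: "continuous_on \<Omega> (\<lambda>z. U z - V z)" by (intro continuous_intros cU cV)
  have "closed K" unfolding K_def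
    by (rule continuous_closed_preimage_constant[OF continuous_on_subset[OF cUV sub] closed_cball])
  moreover have "bounded K" by (rule bounded_subset[OF bounded_cball[of x "2 * s"]]) (auto simp: K_def)
  ultimately have "compact K" by (simp add: compact_eq_bounded_closed)
  moreover have xK: "x \<in> K" using x s by (simp add: K_def)
  moreover have "continuous_on K (\<lambda>z. norm (z - y))" by (intro continuous_intros)
  ultimately obtain x1 where x1: "x1 \<in> K" "\<And>z. z \<in> K \<Longrightarrow> norm (x1 - y) \<le> norm (z - y)"
    using continuous_attains_inf[of K "\<lambda>z. norm (z - y)"] by blast
  define d where "d = norm (x1 - y)"
  have ds: "d < s" using x1(2)[OF xK] y by (simp add: d_def norm_minus_commute)
  have x1s: "norm (x1 - x) \<le> 2 * s" "U x1 = V x1" using x1(1) by (auto simp: K_def dist_norm norm_minus_commute)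
  have d: "d > 0" using x1s ne by (auto simp: d_def)
  have gap: "V z < U z" if z: "norm (z - y) < d" for z
  proof -
    have "norm (z - x) \<le> norm (z - y) + norm (y - x)" using norm_triangle_ineq[of "z - y" "y - x"] by simp
    then have zx: "norm (z - x) \<le> 2 * s" using z y ds by simp
    have "z \<notin> K" using x1(2)[of z] z by (auto simp: d_def)
    then have "U z \<noteq> V z" using zx by (auto simp: K_def dist_norm norm_minus_commute)
    moreover have "V z \<le> U z" using zx s by (intro le mem) simp
    ultimately show ?thesis by simp
  qed
  define y' where "y' = (1/2) *\<^sub>R (y + x1)"
  \<comment> \<open>Slightly more than \<open>d / 2\<close>, so the barrier at \<open>x1\<close>
    exceeds its value \<open>c0\<close> at distance \<kappa>. Yet the points at distance
    \<open>d / 4\<close> from \<open>x1\<close> and at most \<kappa> from \<open>y'\<close> stay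
    within \<open>d\<close> of \<open>y\<close>, where \<open>V < U\<close>: in \<open>par\<close>,
    2 * 0.51^2 + 1/2 - 1/16 is less than 1.\<close>
  define \<kappa> where "\<kappa> = 51/100 * d"
  have ny': "norm (x1 - y') = d / 2"
  proof -
    have "x1 - y' = (1/2) *\<^sub>R (x1 - y)" by (simp add: y'_def vec_eq_iff field_simps)
    then show ?thesis by (simp add: d_def)
  qed
  have par: "norm (z - y) < d" if z: "norm (z - x1) = d / 4" "norm (z - y') \<le> \<kappa>" for z
  proof -
    have "(norm (z - y))\<^sup>2 + (norm (z - x1))\<^sup>2 = 2 * (norm (z - y'))\<^sup>2 + (1/2) * (norm (x1 - y))\<^sup>2"
      by (simp add: y'_def power2_norm_eq_inner inner_simps inner_commute field_simps)
    moreover have "(norm (z - y'))\<^sup>2 \<le> \<kappa>\<^sup>2" using z by (intro power_mono) auto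
    ultimately have "(norm (z - y))\<^sup>2 \<le> 2 * \<kappa>\<^sup>2 + (1/2) * d\<^sup>2 - (d/4)\<^sup>2"
      using z(1) by (simp add: d_def)
    also have "\<dots> < d\<^sup>2" using d by (simp add: \<kappa>_def power2_eq_square)
    finally show ?thesis using d by (simp add: power2_less_imp_less)
  qed
  define m where "m = barrier_exponent CARD('n) lam Lam"
  have m: "m \<ge> 1" using barrier_exponent by (simp add: m_def)
  define c0 where "c0 = inverse ((\<kappa>\<^sup>2) ^ (2 * m))"
  define Bd where "Bd = inverse (((d/4)\<^sup>2) ^ (2 * m))"
  have Bd: "Bd > 0" using d by (simp add: Bd_def)
  have c0: "c0 > 0" using d by (simp add: c0_def \<kappa>_def)
  have bx1: "bar y' x1 > c0"
  proof -
    have "((d/2)\<^sup>2) ^ (2 * m) < (\<kappa>\<^sup>2) ^ (2 * m)"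
      using d m by (intro power_strict_mono) (auto simp: \<kappa>_def power2_eq_square)
    then show ?thesis unfolding barrier_def c0_def ny' m_def[symmetric] using d
      by (intro less_imp_inverse_less) auto
  qed
  define K2 where "K2 = sphere x1 (d/4) \<inter> cball y' \<kappa>"
  have in\<Omega>: "cball x1 (d/4) \<subseteq> \<Omega>"
  proof
    fix z assume "z \<in> cball x1 (d/4)"
    then have "norm (z - x) \<le> d/4 + 2 * s"
      using norm_triangle_ineq[of "z - x1" "x1 - x"] x1s by (simp add: dist_norm norm_minus_commute)
    then show "z \<in> \<Omega>" using ds s d by (intro mem) simp
  qed
  have K2\<Omega>: "K2 \<subseteq> \<Omega>" using in\<Omega> by (auto simp: K2_def)
  obtain c where c: "c > 0" "\<And>z. z \<in> K2 \<Longrightarrow> V z + c \<le> U z"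
  proof (cases "K2 = {}")
    case False
    have "compact K2" unfolding K2_def by (intro compact_Int_closed) auto
    then obtain z0 where z0: "z0 \<in> K2" "\<And>z. z \<in> K2 \<Longrightarrow> U z0 - V z0 \<le> U z - V z"
      using continuous_attains_inf[OF _ False continuous_on_subset[OF cUV K2\<Omega>]] by blast
    have "V z0 < U z0"
      using z0(1) by (intro gap par) (auto simp: K2_def dist_norm norm_minus_commute)
    then show ?thesis using z0(2) by (intro that[of "U z0 - V z0"]) force+
  qed (use that[of 1] in auto)
  define \<epsilon> where "\<epsilon> = c / Bd"
  have \<epsilon>: "\<epsilon> > 0" using c Bd by (simp add: \<epsilon>_def)
  have "V x1 + \<epsilon> * bar y' x1 + - (\<epsilon> * c0) \<le> U x1"
  proof (rule comparison[of "ball x1 (d/4)"])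
    have y'B: "y' \<notin> cball x1 (d/4)" using ny' d by (simp add: dist_norm)
    then have "y' \<notin> ball x1 (d/4)" by simp
    then show "subsol F (ball x1 (d/4)) (\<lambda>z. V z + \<epsilon> * bar y' z + - (\<epsilon> * c0))"
      by (intro subsol_add_const subsol_add_barrier subsol_mono[OF V] \<epsilon> order_trans[OF ball_subset_cball in\<Omega>])
    show "supersol F (ball x1 (d/4)) U" by (intro supersol_mono[OF U] order_trans[OF ball_subset_cball in\<Omega>])
    have cl: "closure (ball x1 (d/4)) = cball x1 (d/4)" using d by simp
    show "continuous_on (closure (ball x1 (d/4))) (\<lambda>z. V z + \<epsilon> * bar y' z + - (\<epsilon> * c0))"
      unfolding cl
      by (intro continuous_intros continuous_on_barrier y'B continuous_on_subset[OF cV in\<Omega>])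
    show "continuous_on (closure (ball x1 (d/4))) U"
      unfolding cl by (rule continuous_on_subset[OF cU in\<Omega>])
    show "x1 \<in> closure (ball x1 (d/4))" unfolding cl using d by simp
    fix z assume "z \<in> frontier (ball x1 (d/4))"
    then have z: "norm (z - x1) = d/4" using d by (simp add: dist_norm norm_minus_commute)
    then have zB: "z \<in> cball x1 (d/4)" by (simp add: dist_norm norm_minus_commute)
    show "V z + \<epsilon> * bar y' z + - (\<epsilon> * c0) \<le> U z"
    proof (cases "norm (z - y') \<le> \<kappa>")
      case True
      then have "z \<in> K2" using z by (simp add: K2_def dist_norm norm_minus_commute)
      have "norm (z - y') \<ge> d / 4"
        using norm_triangle_ineq2[of "x1 - y'" "x1 - z"] z ny' by (simp add: norm_minus_commute)
      then have "\<epsilon> * bar y' z \<le> \<epsilon> * Bd"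
        unfolding Bd_def m_def using \<epsilon> d by (intro mult_left_mono barrier_mono) auto
      also have "\<dots> = c" using Bd by (simp add: \<epsilon>_def)
      finally show ?thesis using c(2)[OF \<open>z \<in> K2\<close>] \<epsilon> c0 mult_pos_pos[OF \<epsilon> c0] by linarith
    next
      case False
      then have "\<epsilon> * bar y' z \<le> \<epsilon> * c0"
        unfolding c0_def m_def using \<epsilon> d by (intro mult_left_mono barrier_mono) (auto simp: \<kappa>_def)
      then show ?thesis using le[of z] in\<Omega> zB by force
    qed
  qed auto
  moreover have "\<epsilon> * c0 < \<epsilon> * bar y' x1" using bx1 \<epsilon> by simp
  ultimately show False using x1s by simp
qed

theorem strong_comparison:
  assumes \<Omega>: "open \<Omega>" "connected \<Omega>" and V: "subsol F \<Omega> V" and U: "supersol F \<Omega> U"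
    and cV: "continuous_on \<Omega> V" and cU: "continuous_on \<Omega> U" and le: "\<And>x. x \<in> \<Omega> \<Longrightarrow> V x \<le> U x"
    and x0: "x0 \<in> \<Omega>" "U x0 = V x0" and x: "x \<in> \<Omega>"
  shows "U x = V x"
proof -
  define E where "E = {x \<in> \<Omega>. U x - V x = 0}"
  have "closedin (top_of_set \<Omega>) E"
    unfolding E_def by (intro continuous_closedin_preimage_constant continuous_intros cU cV)
  moreover have "open E"
    unfolding open_contains_ball
  proof
    fix z assume "z \<in> E"
    then have z: "z \<in> \<Omega>" "U z = V z" by (auto simp: E_def)
    obtain r where r: "r > 0" "ball z r \<subseteq> \<Omega>" using z(1) \<Omega>(1) open_contains_ball by blast
    have "ball z (r/4) \<subseteq> E"
    proof
      fix y assume y: "y \<in> ball z (r/4)"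
      then have "norm (y - z) < r/4" by (simp add: dist_norm norm_minus_commute)
      then have "U y = V y"
        using r by (intro strong_comparison_local[OF V U cV cU le z(2), of "r/4"]) auto
      moreover have "y \<in> \<Omega>" using y r by auto
      ultimately show "y \<in> E" by (simp add: E_def)
    qed
    then show "\<exists>e>0. ball z e \<subseteq> E" using r by (intro exI[of _ "r/4"]) auto
  qed
  then have "openin (top_of_set \<Omega>) E" by (intro open_subset) (auto simp: E_def)
  ultimately have "E = {} \<or> E = \<Omega>" using \<Omega>(2) unfolding connected_clopen by blast
  then show ?thesis using x0 x by (auto simp: E_def)
qed

text \<open>A polynomial touching \<open>g\<close> touches a close \<open>f n\<close> up to an error
  that \<open>subsol_approximate_touching\<close> tolerates at the price of \<tau> in the Hessian;
  ellipticity lets \<tau> tend to 0.\<close>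

lemma subsol_uniform_limit:
  assumes sub: "\<And>n. subsol F \<Omega> (f n)" and cf: "\<And>n. continuous_on \<Omega> (f n)"
    and lim: "\<And>e. e > 0 \<Longrightarrow> \<exists>n. \<forall>x\<in>\<Omega>. \<bar>f n x - g x\<bar> < e"
  shows "subsol F \<Omega> g"
  unfolding subsol_def
proof (intro allI impI, elim conjE)
  fix z X p s
  assume s: "0 < s" and b: "ball z s \<subseteq> \<Omega>" and X: "symmetric_matrix X"
    and le: "\<forall>h. norm h < s \<longrightarrow> g (z + h) \<le> g z + p \<bullet> h + (1/2) * (h \<bullet> (X *v h))"
  have sub2: "cball z (s/2) \<subseteq> \<Omega>" using b s by (force simp: subset_eq)
  have F\<tau>: "F (X + mat (4 * \<tau>)) \<le> 0" if \<tau>: "\<tau> > 0" for \<tau>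
  proof -
    define e where "e = \<tau> * (s/2)\<^sup>2 / 2"
    have "e > 0" using \<tau> s by (simp add: e_def)
    then obtain n where n: "\<And>x. x \<in> \<Omega> \<Longrightarrow> \<bar>f n x - g x\<bar> < e" using lim by blast
    show ?thesis
    proof (rule subsol_approximate_touching[OF sub[of n] _ sub2 _ X \<tau>, where p = p])
      show "continuous_on (cball z (s/2)) (f n)" by (rule continuous_on_subset[OF cf sub2])
      fix h :: "real ^ 'n" assume h: "norm h \<le> s/2"
      then have "z + h \<in> \<Omega>" "z \<in> \<Omega>" using sub2 s by (auto simp: subset_eq dist_norm)
      then have "\<bar>f n (z + h) - g (z + h)\<bar> < e" "\<bar>f n z - g z\<bar> < e" using n by auto
      moreover have "g (z + h) \<le> g z + p \<bullet> h + (1/2) * (h \<bullet> (X *v h))" using le h s by auto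
      ultimately show "f n (z + h) \<le> f n z + p \<bullet> h + 1 / 2 * (h \<bullet> (X *v h)) + \<tau> * (s/2)\<^sup>2"
        unfolding e_def by linarith
    qed (use s in simp)
  qed
  show "F X \<le> 0"
  proof (rule field_le_epsilon)
    fix e :: real assume e: "e > 0"
    define \<tau> where "\<tau> = e / (4 * Lam * real CARD('n))"
    have L: "Lam * real CARD('n) > 0" using lam by simp
    have \<tau>: "\<tau> > 0" using e L by (simp add: \<tau>_def mult.assoc)
    have "nonneg_definite (mat (4 * \<tau>) :: real ^ 'n ^ 'n)"
      using \<tau> by (auto simp: nonneg_definite_def symmetric_matrix_mat mat_mult_vec)
    from elliptic[OF symmetric_matrix_add[OF X symmetric_matrix_mat[of "4 * \<tau>"]] this]
    have "F X - F (X + mat (4 * \<tau>)) \<le> Lam * (4 * \<tau> * real CARD('n))" by (simp add: trace_simps)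
    also have "\<dots> = 4 * (Lam * real CARD('n)) * \<tau>" by simp
    also have "\<dots> = e" using lam by (simp add: \<tau>_def)
    finally show "F X \<le> 0 + e" using F\<tau>[OF \<tau>] by simp
  qed
qed

lemma supersol_uniform_limit:
  assumes "\<And>n. supersol F \<Omega> (f n)" and "\<And>n. continuous_on \<Omega> (f n)"
    and lim: "\<And>e. e > 0 \<Longrightarrow> \<exists>n. \<forall>x\<in>\<Omega>. \<bar>f n x - g x\<bar> < e"
  shows "supersol F \<Omega> g"
proof -
  interpret d: elliptic_operator "dual_operator F" lam Lam by (rule dual)
  have s: "subsol (dual_operator F) \<Omega> (\<lambda>x. - f n x)" for n
    using assms(1)[of n] by (simp add: supersol_def)
  have c: "continuous_on \<Omega> (\<lambda>x. - f n x)" for n by (intro continuous_on_minus assms(2))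
  have l: "\<exists>n. \<forall>x\<in>\<Omega>. \<bar>- f n x - - g x\<bar> < e" if "e > 0" for e
    using lim[OF that] by (simp add: abs_minus_commute)
  show ?thesis unfolding supersol_def by (rule d.subsol_uniform_limit[OF s c l])
qed

text \<open>Blow-down: the functions \<open>r\<^sub>j powr \<alpha> * w (r\<^sub>j x)\<close> converge along a subsequence to a solution
  that lies above \<open>a \<Psi>\<close> and touches it.\<close>

lemma blow_down_touching:
  assumes n: "CARD('n) \<ge> 2" and \<Psi>: "soln F (- {0}) \<Psi>"
    and hom: "\<And>\<sigma> x. \<sigma> > 0 \<Longrightarrow> x \<noteq> 0 \<Longrightarrow> \<sigma> powr \<alpha> * \<Psi> (\<sigma> *\<^sub>R x) = \<Psi> x"
    and \<Psi>pos: "\<And>x. x \<noteq> 0 \<Longrightarrow> \<Psi> x > 0"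
    and \<rho>: "\<rho> > 0" and w: "soln F {x. \<rho> < norm x} w"
    and wb: "\<And>x. \<rho> < norm x \<Longrightarrow> 0 \<le> w x \<and> w x \<le> C * \<Psi> x"
    and a: "a > 0" and low: "\<And>\<epsilon>. \<epsilon> > 0 \<Longrightarrow> \<exists>R. \<forall>x. R \<le> norm x \<longrightarrow> (a - \<epsilon>) * \<Psi> x \<le> w x"
    and touch: "\<And>\<epsilon> R. \<epsilon> > 0 \<Longrightarrow> \<exists>x. R \<le> norm x \<and> w x \<le> (a + \<epsilon>) * \<Psi> x"
    and \<epsilon>: "\<epsilon> > 0"
  shows "\<exists>r\<ge>R. \<forall>x. norm x = r \<longrightarrow> w x \<le> (a + \<epsilon>) * \<Psi> x"
proof -
  obtain Rl where Rl: "\<And>j x. Rl j \<le> norm x \<Longrightarrow> (a - 1 / real (Suc j)) * \<Psi> x \<le> w x"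
    using low[of "1 / real (Suc _)"] by (metis zero_less_divide_1_iff of_nat_0_less_iff zero_less_Suc)
  \<comment> \<open>The bound \<open>8 * \<rho> + 1\<close> makes the rescaled functions solutions
    for \<open>1/8 < norm x\<close>, and \<open>2 * Rl j\<close> makes the lower bound valid from
    \<open>norm x = 1/2\<close> on.\<close>
  have "\<exists>x. Max {R, 8 * \<rho> + 1, 2 * Rl j} \<le> norm x \<and> w x \<le> (a + 1 / real (Suc j)) * \<Psi> x" for j
    by (rule touch) simp
  then obtain xs where xs: "\<And>j. Max {R, 8 * \<rho> + 1, 2 * Rl j} \<le> norm (xs j)"
    "\<And>j. w (xs j) \<le> (a + 1 / real (Suc j)) * \<Psi> (xs j)" by metis
  define r where "r j = norm (xs j)" for j
  have r: "R \<le> r j" "8 * \<rho> + 1 \<le> r j" "2 * Rl j \<le> r j" for j using xs(1)[of j] by (auto simp: r_def)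
  have r0: "r j > 0" for j using r(2)[of j] \<rho> by simp
  define U where "U j x = r j powr \<alpha> * w (r j *\<^sub>R x)" for j x
  have big: "\<rho> < norm (r j *\<^sub>R x)" if "norm x > 1/8" for j x
  proof -
    have "\<rho> < r j * (1/8)" using r(2)[of j] by simp
    also have "\<dots> \<le> r j * norm x" using that r0[of j] by (intro mult_left_mono) auto
    finally show ?thesis using r0[of j] by simp
  qed
  have Usol: "soln F {x. 1/8 < norm x} (U j)" for j
  proof -
    have "soln F {x. 0 + r j *\<^sub>R x \<in> {x. \<rho> < norm x}} (\<lambda>x. w (0 + r j *\<^sub>R x))"
      by (rule soln_rescale[OF w r0])
    then have "soln F {x. 1/8 < norm x} (\<lambda>x. w (r j *\<^sub>R x))"
      using big by (auto intro: soln_mono)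
    then show ?thesis unfolding U_def using r0[of j] by (intro soln_scaleR) auto
  qed
  \<comment> \<open>The Lipschitz estimate consumes a margin of 1/8, so bounds are taken on
    \<open>A4\<close> and compactness is obtained on the smaller \<open>S\<close>, which contains
    the unit sphere in its interior.\<close>
  define A4 where "A4 = cball (0 :: real ^ 'n) 4 - ball 0 (1/4)"
  define S where "S = cball (0 :: real ^ 'n) 2 - ball 0 (1/2)"
  have comp: "compact A4" "compact S" "compact (sphere (0 :: real ^ 'n) 1)"
    unfolding A4_def S_def by (auto intro!: compact_diff)
  have c\<Psi>: "continuous_on T \<Psi>" if "0 \<notin> T" for T
    using \<Psi> that unfolding soln_def by (auto intro: continuous_on_subset)
  obtain Mx where Mx: "\<And>x. x \<in> A4 \<Longrightarrow> \<Psi> x \<le> Mx" "Mx > 0"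
  proof -
    have "bounded (\<Psi> ` A4)"
      by (intro compact_imp_bounded compact_continuous_image comp c\<Psi>) (simp add: A4_def)
    then obtain Mx where "Mx > 0" "\<forall>y\<in>\<Psi> ` A4. norm y \<le> Mx" unfolding bounded_pos by blast
    then show ?thesis using that[of Mx] by (force simp: abs_le_iff)
  qed
  have hom': "r j powr \<alpha> * \<Psi> (r j *\<^sub>R x) = \<Psi> x" if "x \<noteq> 0" for j x using hom[OF r0 that] .
  define M where "M = \<bar>C\<bar> * Mx + 1"
  have M: "M > 0" using Mx by (simp add: M_def add_nonneg_pos)
  have Ub: "0 \<le> U j x \<and> U j x \<le> M" if x: "x \<in> A4" for j x
  proof -
    have nx: "norm x > 1/8" "x \<noteq> 0" using x by (auto simp: A4_def)
    have p: "r j powr \<alpha> \<ge> 0" by simp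
    have "U j x \<le> r j powr \<alpha> * (C * \<Psi> (r j *\<^sub>R x))"
      unfolding U_def using wb[OF big[OF nx(1)], of j] p by (intro mult_left_mono) auto
    also have "\<dots> = C * \<Psi> x" using hom'[OF nx(2), of j] by (simp add: mult.left_commute)
    also have "\<dots> \<le> \<bar>C\<bar> * Mx"
      using Mx(1)[OF x] \<Psi>pos[OF nx(2)] by (intro mult_mono) auto
    finally have "U j x \<le> M" by (simp add: M_def)
    moreover have "0 \<le> U j x" unfolding U_def using wb[OF big[OF nx(1)], of j] p by simp
    ultimately show ?thesis by simp
  qed
  have ballA4: "cball x (1/8) \<subseteq> A4" if "x \<in> S" for x
  proof
    fix z assume "z \<in> cball x (1/8)"
    then have "norm (z - x) \<le> 1/8" by (simp add: dist_norm norm_minus_commute)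
    moreover have "1/2 \<le> norm x" "norm x \<le> 2" using that by (auto simp: S_def)
    ultimately show "z \<in> A4"
      using norm_triangle_ineq[of "z - x" x] norm_triangle_ineq2[of x "x - z"] by (simp add: A4_def norm_minus_commute)
  qed
  have A4sub: "A4 \<subseteq> {x. 1/8 < norm x}" by (auto simp: A4_def)
  have lip1: "U j x - U j y \<le> lipschitz_const CARD('n) lam Lam * M * norm (y - x) / (1/8)" if x: "x \<in> S" and y: "norm (y - x) \<le> 1/8" for j x y
  proof (rule lipschitz_estimate[OF _ _ _ _ M y])
    have s: "cball x (1/8) \<subseteq> {x. 1/8 < norm x}" using ballA4[OF x] A4sub by blast
    show "soln F (ball x (1/8)) (U j)" by (rule soln_mono[OF Usol order_trans[OF ball_subset_cball s]])
    show "continuous_on (cball x (1/8)) (U j)"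
      using Usol[of j] s unfolding soln_def by (blast intro: continuous_on_subset)
    show "0 \<le> U j z \<and> U j z \<le> M" if "z \<in> cball x (1/8)" for z using Ub ballA4[OF x] that by blast
  qed simp
  obtain g k where g: "continuous_on S g" and k: "strict_mono (k :: nat \<Rightarrow> nat)"
    and conv: "\<And>e. 0 < e \<Longrightarrow> \<exists>N. \<forall>n x. n \<ge> N \<and> x \<in> S \<longrightarrow> norm (U (k n) x - g x) < e"
  proof (rule Arzela_Ascoli[of S U M])
    show "compact S" by (rule comp)
    show "norm (U n x) \<le> M" if "x \<in> S" for n x
    proof -
      have "x \<in> A4" using ballA4[OF that] by auto
      then show ?thesis using Ub[of x n] by simp
    qed
    show "\<exists>d>0. \<forall>n y. y \<in> S \<and> norm (x - y) < d \<longrightarrow> norm (U n x - U n y) < e" if x: "x \<in> S" and e: "0 < e" for x e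
    proof -
      define L where "L = 8 * lipschitz_const CARD('n) lam Lam * M"
      have L: "L > 0" using M by (simp add: L_def)
      have "norm (U n x - U n y) < e" if y: "y \<in> S" "norm (x - y) < min (1/8) (e / L)" for n y
      proof -
        have "norm (x - y) < e / L" using y(2) by simp
        then have "L * norm (x - y) < e" using L by (simp add: pos_less_divide_eq mult.commute)
        moreover have "U n x - U n y \<le> L * norm (x - y)"
          using lip1[OF x, of y n] y(2) by (simp add: L_def norm_minus_commute mult_ac)
        moreover have "U n y - U n x \<le> L * norm (x - y)"
          using lip1[OF y(1), of x n] y(2) by (simp add: L_def norm_minus_commute mult_ac)
        ultimately show ?thesis by (simp add: abs_less_iff)
      qed
      then show ?thesis using L e by (intro exI[of _ "min (1/8) (e / L)"]) auto
    qed
  qed (rule that)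
  let ?\<Omega> = "annulus (0 :: real ^ 'n) (1/2) 2"
  have \<Omega>S: "?\<Omega> \<subseteq> S" by (auto simp: annulus_def S_def)
  have \<Omega>8: "?\<Omega> \<subseteq> {x. 1/8 < norm x}" by (auto simp: annulus_def)
  have gsup: "supersol F ?\<Omega> g"
  proof (rule supersol_uniform_limit[of _ "\<lambda>n. U (k n)"])
    show "supersol F ?\<Omega> (U (k n))" "continuous_on ?\<Omega> (U (k n))" for n
      using soln_mono[OF Usol \<Omega>8, of "k n"] by (auto simp: soln_def)
    show "\<exists>n. \<forall>x\<in>?\<Omega>. \<bar>U (k n) x - g x\<bar> < e" if "e > 0" for e
      using conv[OF that] \<Omega>S by (metis real_norm_def subsetD order_refl)
  qed
  have \<Psi>S: "\<Psi> x > 0" if "x \<in> S" for x using that by (intro \<Psi>pos) (auto simp: S_def)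
  have lowU: "(a - 1 / real (Suc j)) * \<Psi> x \<le> U j x" if "x \<in> S" for j x
  proof -
    have nx: "x \<noteq> 0" "norm x \<ge> 1/2" using that by (auto simp: S_def)
    have "r j * (1/2) \<le> r j * norm x" using nx r0[of j] by (intro mult_left_mono) auto
    moreover have "norm (r j *\<^sub>R x) = r j * norm x" using r0[of j] by simp
    ultimately have "Rl j \<le> norm (r j *\<^sub>R x)" using r(3)[of j] by linarith
    from mult_left_mono[OF Rl[OF this], of "r j powr \<alpha>"]
    have "r j powr \<alpha> * ((a - 1 / real (Suc j)) * \<Psi> (r j *\<^sub>R x)) \<le> U j x"
      unfolding U_def by simp
    then show ?thesis unfolding mult.left_commute[of "r j powr \<alpha>"] hom'[OF nx(1)] .
  qed
  have gge: "a * \<Psi> x \<le> g x" if x: "x \<in> S" for x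
  proof (rule field_le_epsilon)
    fix e :: real assume e: "e > 0"
    obtain N1 where N1: "\<And>n. n \<ge> N1 \<Longrightarrow> norm (U (k n) x - g x) < e / 2" using conv[of "e/2"] e x by auto
    obtain N2 :: nat where N2: "2 * \<Psi> x / e < real N2" using reals_Archimedean2 by blast
    define N where "N = max N1 N2"
    have "real N2 \<le> real (Suc (k N))" using seq_suble[OF k, of N] by (simp add: N_def)
    then have "2 * \<Psi> x / e < real (Suc (k N))" using N2 by linarith
    then have "1 / real (Suc (k N)) * \<Psi> x \<le> e / 2" using e by (simp add: field_simps)
    moreover have "\<bar>U (k N) x - g x\<bar> < e / 2" using N1[of N] by (simp add: N_def)
    moreover have "a * \<Psi> x - 1 / real (Suc (k N)) * \<Psi> x \<le> U (k N) x"
      using lowU[OF x, of "k N"] unfolding left_diff_distrib .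
    ultimately show "a * \<Psi> x \<le> g x + e" by linarith
  qed
  let ?S1 = "sphere (0 :: real ^ 'n) 1"
  have S1S: "?S1 \<subseteq> S" "?S1 \<subseteq> ?\<Omega>" by (auto simp: S_def annulus_def)
  have S1ne: "?S1 \<noteq> {}" by simp
  have "continuous_on ?S1 (\<lambda>x. g x - a * \<Psi> x)"
    by (intro continuous_intros c\<Psi> continuous_on_subset[OF g S1S(1)]) simp
  then obtain e0 where e0: "e0 \<in> ?S1" "\<And>x. x \<in> ?S1 \<Longrightarrow> g e0 - a * \<Psi> e0 \<le> g x - a * \<Psi> x"
    using continuous_attains_inf[OF comp(3) S1ne] by blast
  \<comment> \<open>The almost-touching points divided by their norms lie on the unit sphere; a
    positive minimum of \<open>g - a * \<Psi>\<close> there would exclude them for large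
    \<open>j\<close>.\<close>
  have contact: "g e0 = a * \<Psi> e0"
  proof (rule ccontr)
    assume "g e0 \<noteq> a * \<Psi> e0"
    then have \<mu>: "g e0 - a * \<Psi> e0 > 0" using gge[of e0] e0(1) S1S by force
    define \<mu> where "\<mu> = g e0 - a * \<Psi> e0"
    obtain N1 where N1: "\<And>n x. n \<ge> N1 \<Longrightarrow> x \<in> S \<Longrightarrow> norm (U (k n) x - g x) < \<mu> / 2"
      using conv[of "\<mu>/2"] \<mu> by (auto simp: \<mu>_def)
    obtain N2 :: nat where N2: "2 * Mx / \<mu> < real N2" using reals_Archimedean2 by blast
    define N where "N = max N1 N2"
    define j where "j = k N"
    have "real N2 \<le> real (Suc j)" using seq_suble[OF k, of N] by (simp add: N_def j_def)
    then have "2 * Mx / \<mu> < real (Suc j)" using N2 by linarith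
    then have small: "1 / real (Suc j) * Mx < \<mu> / 2" using \<mu> by (simp add: \<mu>_def field_simps)
    define x where "x = (1 / r j) *\<^sub>R xs j"
    have x: "x \<in> ?S1" using r0[of j] by (simp add: x_def r_def)
    have xS: "x \<in> S" "x \<in> A4" "x \<noteq> 0" using x S1S ballA4 by (auto simp: A4_def)
    have rx: "r j *\<^sub>R x = xs j" using r0[of j] by (simp add: x_def)
    have "U j x \<le> r j powr \<alpha> * ((a + 1 / real (Suc j)) * \<Psi> (r j *\<^sub>R x))"
      unfolding U_def rx using xs(2)[of j] by (intro mult_left_mono) auto
    also have "\<dots> = a * \<Psi> x + 1 / real (Suc j) * \<Psi> x"
      unfolding mult.left_commute[of "r j powr \<alpha>"] hom'[OF xS(3)] by (rule distrib_right)
    also have "1 / real (Suc j) * \<Psi> x \<le> 1 / real (Suc j) * Mx" using Mx(1)[OF xS(2)] by (intro mult_left_mono) auto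
    finally have 1: "U j x < a * \<Psi> x + \<mu> / 2" using small by linarith
    have "N1 \<le> N" by (simp add: N_def)
    from N1[OF this xS(1)] have 2: "\<bar>U j x - g x\<bar> < \<mu> / 2" by (simp add: j_def)
    show False using e0(2)[OF x] 1 2 unfolding \<mu>_def[symmetric] by linarith
  qed
  have eq: "g x = a * \<Psi> x" if "x \<in> ?\<Omega>" for x
  proof (rule strong_comparison[of ?\<Omega> "\<lambda>x. a * \<Psi> x" g e0 x])
    show "open ?\<Omega>" by (rule open_annulus)
    show "connected ?\<Omega>"
      using connected_annulus(1)[where 'N = "real ^ 'n", of "1/2" 0 2] n unfolding annulus_def by simp
    have "soln F (- {0}) (\<lambda>x. a * \<Psi> x)" by (rule soln_scaleR[OF \<Psi> a])
    then have "soln F ?\<Omega> (\<lambda>x. a * \<Psi> x)" by (rule soln_mono) (auto simp: annulus_def)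
    then show "subsol F ?\<Omega> (\<lambda>x. a * \<Psi> x)" "continuous_on ?\<Omega> (\<lambda>x. a * \<Psi> x)" by (auto simp: soln_def)
    show "supersol F ?\<Omega> g" by (rule gsup)
    show "continuous_on ?\<Omega> g" by (rule continuous_on_subset[OF g \<Omega>S])
    show "a * \<Psi> x \<le> g x" if "x \<in> ?\<Omega>" for x using gge \<Omega>S that by blast
    show "e0 \<in> ?\<Omega>" using e0 S1S by blast
  qed (use contact that in auto)
  obtain e1 where e1: "e1 \<in> ?S1" "\<And>x. x \<in> ?S1 \<Longrightarrow> \<Psi> e1 \<le> \<Psi> x"
    using continuous_attains_inf[OF comp(3) S1ne, of \<Psi>] c\<Psi>[of ?S1] by auto
  have "\<epsilon> * \<Psi> e1 > 0" using \<epsilon> \<Psi>S[of e1] e1 S1S by auto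
  from conv[OF this] obtain N where N: "\<And>x. x \<in> S \<Longrightarrow> norm (U (k N) x - g x) < \<epsilon> * \<Psi> e1" by blast
  show ?thesis
  proof (intro exI[of _ "r (k N)"] conjI allI impI r(1))
    fix y :: "real ^ 'n" assume y: "norm y = r (k N)"
    define x where "x = (1 / r (k N)) *\<^sub>R y"
    have x: "x \<in> ?S1" using r0[of "k N"] y by (simp add: x_def)
    have ry: "r (k N) *\<^sub>R x = y" using r0[of "k N"] by (simp add: x_def)
    have x0: "x \<noteq> 0" using x by auto
    have xS: "x \<in> S" "x \<in> ?\<Omega>" using x S1S by blast+
    have "\<bar>U (k N) x - g x\<bar> < \<epsilon> * \<Psi> e1" using N[OF xS(1)] by simp
    then have "U (k N) x \<le> a * \<Psi> x + \<epsilon> * \<Psi> e1" using eq[OF xS(2)] by linarith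
    also have "\<epsilon> * \<Psi> e1 \<le> \<epsilon> * \<Psi> x" using e1(2)[OF x] \<epsilon> by (intro mult_left_mono) auto
    finally have "U (k N) x \<le> (a + \<epsilon>) * \<Psi> x" by (simp add: distrib_right)
    also have "\<dots> = r (k N) powr \<alpha> * ((a + \<epsilon>) * \<Psi> y)" using hom'[OF x0, of "k N"] by (simp add: ry mult.left_commute)
    finally show "w y \<le> (a + \<epsilon>) * \<Psi> y"
      unfolding U_def ry using r0[of "k N"] by (simp add: mult_le_cancel_left_pos)
  qed
qed

end

section \<open>Behaviour at infinity\<close>

lemma supersol_add_const: "supersol F \<Omega> u \<Longrightarrow> supersol F \<Omega> (\<lambda>x. u x + c)"
  unfolding supersol_def using subsol_add_const[of "dual_operator F" \<Omega> "\<lambda>x. - u x" "- c"] by simp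

lemma sphere_bound:
  fixes f :: "real ^ 'n \<Rightarrow> real"
  assumes "continuous_on (sphere 0 r) f"
  obtains B where "B > 0" "\<And>x. norm x = r \<Longrightarrow> \<bar>f x\<bar> \<le> B"
proof -
  have "bounded (f ` sphere 0 r)"
    by (intro compact_imp_bounded compact_continuous_image assms compact_sphere)
  then obtain B where "B > 0" "\<forall>y\<in>f ` sphere 0 r. norm y \<le> B" unfolding bounded_pos by blast
  then show thesis using that[of B] by simp
qed

lemma sphere_attains_inf:
  fixes f :: "real ^ 'n \<Rightarrow> real"
  assumes "continuous_on (sphere 0 r) f" "r \<ge> 0"
  obtains z where "norm z = r" "\<And>x. norm x = r \<Longrightarrow> f z \<le> f x"
proof -
  have "sphere (0 :: real ^ 'n) r \<noteq> {}" using assms(2) by (simp add: sphere_eq_empty)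
  from continuous_attains_inf[OF compact_sphere this assms(1)] show thesis using that by auto
qed

lemma ex_norm_eq: "r \<ge> 0 \<Longrightarrow> \<exists>x :: real ^ 'n. norm x = r"
  by (rule exI[of _ "r *\<^sub>R axis undefined 1"]) (simp add: norm_axis_1)

section \<open>Elements of \<open>H_plus\<close> at infinity\<close>

lemma H_plus_0D: "v \<in> H_plus 0 \<Longrightarrow> \<sigma> > 0 \<Longrightarrow> x \<noteq> 0 \<Longrightarrow> v (\<sigma> *\<^sub>R x) + ln \<sigma> = v x"
  and H_plusD: "v \<in> H_plus \<alpha> \<Longrightarrow> \<alpha> \<noteq> 0 \<Longrightarrow> \<sigma> > 0 \<Longrightarrow> x \<noteq> 0 \<Longrightarrow> \<sigma> powr \<alpha> * v (\<sigma> *\<^sub>R x) = v x"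
  and H_plus_sign: "v \<in> H_plus \<alpha> \<Longrightarrow> \<alpha> \<noteq> 0 \<Longrightarrow> x \<noteq> 0 \<Longrightarrow> \<alpha> * v x > 0"
  by (auto simp: H_plus_def)

lemma H_plus_polar:
  assumes "v \<in> H_plus \<alpha>" "x \<noteq> 0"
  shows "\<alpha> = 0 \<Longrightarrow> v x = v (sgn x) - ln (norm x)"
    and "\<alpha> \<noteq> 0 \<Longrightarrow> v x = norm x powr (- \<alpha>) * v (sgn x)"
proof -
  have n: "norm x > 0" "sgn x \<noteq> 0" "norm x *\<^sub>R sgn x = x" using assms(2) by (auto simp: sgn_div_norm)
  show "v x = v (sgn x) - ln (norm x)" if "\<alpha> = 0"
  proof -
    have "v (norm x *\<^sub>R sgn x) + ln (norm x) = v (sgn x)"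
      using H_plus_0D[of v "norm x" "sgn x"] assms(1) that n by simp
    then show ?thesis using n by simp
  qed
  show "v x = norm x powr (- \<alpha>) * v (sgn x)" if "\<alpha> \<noteq> 0"
  proof -
    have "norm x powr \<alpha> * v (norm x *\<^sub>R sgn x) = v (sgn x)"
      using H_plusD[OF assms(1) that n(1,2)] .
    then have "norm x powr (- \<alpha>) * (norm x powr \<alpha> * v x) = norm x powr (- \<alpha>) * v (sgn x)" using n by simp
    then show ?thesis using n by (simp add: mult.assoc[symmetric] powr_add[symmetric])
  qed
qed

lemma H_plus_continuous: "v \<in> H_plus \<alpha> \<Longrightarrow> 0 \<notin> T \<Longrightarrow> continuous_on T v"
  unfolding H_plus_def by (auto intro: continuous_on_subset)

lemma H_plus_tendsto_minus_infinity:
  fixes v :: "real ^ 'n \<Rightarrow> real"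
  assumes v: "v \<in> H_plus \<alpha>" and \<alpha>: "\<alpha> \<le> 0"
  shows "\<exists>R. \<forall>x. R \<le> norm x \<longrightarrow> v x \<le> K"
proof -
  obtain z where z: "norm z = 1" "\<And>x. norm x = 1 \<Longrightarrow> - v z \<le> - v x"
    using sphere_attains_inf[of 1 "\<lambda>x. - v x"] H_plus_continuous[OF v, of "sphere 0 1"]
    by (auto intro: continuous_on_minus)
  show ?thesis
  proof (cases "\<alpha> = 0")
    case True
    have "v x \<le> K" if "exp (v z - K) \<le> norm x" for x
    proof -
      have x: "norm x > 0" using that exp_gt_zero[of "v z - K"] by linarith
      then have "v z - K \<le> ln (norm x)" using that by (simp add: ln_ge_iff)
      moreover have "v x = v (sgn x) - ln (norm x)" using H_plus_polar(1)[OF v _ True] x by auto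
      moreover have "v (sgn x) \<le> v z" using z(2)[of "sgn x"] x by (simp add: norm_sgn)
      ultimately show ?thesis by linarith
    qed
    then show ?thesis by blast
  next
    case False
    then have a: "- \<alpha> > 0" using \<alpha> by simp
    have "\<alpha> * v z > 0" using z(1) by (intro H_plus_sign[OF v False]) auto
    then have vz: "v z < 0" using a by (simp add: zero_less_mult_iff)
    define R where "R = (\<bar>K\<bar> / (- v z) + 1) powr (1 / (- \<alpha>))"
    have R: "R > 0" using vz by (simp add: R_def add_nonneg_pos)
    have "v x \<le> K" if "R \<le> norm x" for x
    proof -
      have x: "norm x > 0" using that R by linarith
      have "\<bar>K\<bar> / (- v z) + 1 = R powr (- \<alpha>)"
        using a vz by (simp add: R_def powr_powr add_nonneg_pos divide_nonneg_neg add_pos_nonneg)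
      also have "\<dots> \<le> norm x powr (- \<alpha>)" using that R a by (intro powr_mono2) auto
      finally have "(\<bar>K\<bar> / (- v z)) * (- v z) \<le> norm x powr (- \<alpha>) * (- v z)"
        using vz by (intro mult_right_mono) auto
      then have "\<bar>K\<bar> \<le> norm x powr (- \<alpha>) * (- v z)" using vz by simp
      moreover have "v x = norm x powr (- \<alpha>) * v (sgn x)" using H_plus_polar(2)[OF v _ False] x by auto
      moreover have "norm x powr (- \<alpha>) * v (sgn x) \<le> norm x powr (- \<alpha>) * v z"
        using z(2)[of "sgn x"] x by (intro mult_left_mono) (auto simp: norm_sgn)
      ultimately show ?thesis by simp
    qed
    then show ?thesis by blast
  qed
qed

lemma H_plus_tendsto_zero:
  fixes v :: "real ^ 'n \<Rightarrow> real"
  assumes v: "v \<in> H_plus \<alpha>" and \<alpha>: "\<alpha> > 0" and e: "e > 0"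
  shows "\<exists>R. \<forall>x. R \<le> norm x \<longrightarrow> v x \<le> e"
proof -
  obtain B where B: "B > 0" "\<And>x. norm x = 1 \<Longrightarrow> \<bar>v x\<bar> \<le> B"
    using sphere_bound[of 1 v] H_plus_continuous[OF v, of "sphere 0 1"] by auto
  define R where "R = (e / B) powr (- 1 / \<alpha>)"
  have R: "R > 0" using e B by (simp add: R_def)
  have "v x \<le> e" if "R \<le> norm x" for x
  proof -
    have x: "norm x > 0" using that R by linarith
    have "norm x powr (- \<alpha>) \<le> R powr (- \<alpha>)" using that R \<alpha> by (intro powr_mono2') auto
    also have "\<dots> = e / B" using e B \<alpha> by (simp add: R_def powr_powr)
    finally have 1: "norm x powr (- \<alpha>) * B \<le> e" using B by (simp add: field_simps)
    have "v x = norm x powr (- \<alpha>) * v (sgn x)" using H_plus_polar(2)[OF v, of x] x \<alpha> by auto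
    also have "\<dots> \<le> norm x powr (- \<alpha>) * B"
      using B(2)[of "sgn x"] x by (intro mult_left_mono) (auto simp: norm_sgn abs_le_iff)
    finally show ?thesis using 1 by linarith
  qed
  then show ?thesis by blast
qed

text \<open>\<open>a\<close> is the lower limit of \<open>w / \<Psi>\<close>, taken as the supremum
  of the slopes that are eventually admissible below; the products avoid division. It serves for the
  constant function 1, for \<Phi> and for minus the dual fundamental solution alike.\<close>

lemma liminf_ratio:
  fixes w \<Psi> :: "real ^ 'n \<Rightarrow> real"
  assumes k0: "\<exists>R. \<forall>x. R \<le> norm x \<longrightarrow> k0 * \<Psi> x \<le> w x"
    and pos: "\<exists>R. \<forall>x. R \<le> norm x \<longrightarrow> 0 < \<Psi> x"
    and bd: "\<And>k. \<exists>R. \<forall>x. R \<le> norm x \<longrightarrow> k * \<Psi> x \<le> w x \<Longrightarrow> k \<le> K"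
  obtains a where "a \<ge> k0" "\<And>\<epsilon>. \<epsilon> > 0 \<Longrightarrow> \<exists>R. \<forall>x. R \<le> norm x \<longrightarrow> (a - \<epsilon>) * \<Psi> x \<le> w x"
    "\<And>\<epsilon> R. \<epsilon> > 0 \<Longrightarrow> \<exists>x. R \<le> norm x \<and> w x \<le> (a + \<epsilon>) * \<Psi> x"
proof -
  define S where "S = {k. \<exists>R. \<forall>x. R \<le> norm x \<longrightarrow> k * \<Psi> x \<le> w x}"
  have S: "k0 \<in> S" "bdd_above S"
    using k0 bd by (auto simp: S_def intro!: bdd_aboveI[of _ K])
  obtain Rp where Rp: "\<And>x. Rp \<le> norm x \<Longrightarrow> 0 < \<Psi> x" using pos by blast
  show thesis
  proof (rule that[of "Sup S"])
    show "k0 \<le> Sup S" using S by (rule cSup_upper)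
    fix \<epsilon> :: real assume \<epsilon>: "\<epsilon> > 0"
    then obtain k where k: "k \<in> S" "Sup S - \<epsilon> < k"
      using less_cSup_iff[of S "Sup S - \<epsilon>"] S by auto
    then obtain R where R: "\<And>x. R \<le> norm x \<Longrightarrow> k * \<Psi> x \<le> w x" by (auto simp: S_def)
    have "(Sup S - \<epsilon>) * \<Psi> x \<le> w x" if "max R Rp \<le> norm x" for x
    proof -
      have "(Sup S - \<epsilon>) * \<Psi> x \<le> k * \<Psi> x" using k Rp[of x] that by (intro mult_right_mono) auto
      then show ?thesis using R[of x] that by simp
    qed
    then show "\<exists>R. \<forall>x. R \<le> norm x \<longrightarrow> (Sup S - \<epsilon>) * \<Psi> x \<le> w x" by blast
  next
    fix \<epsilon> R :: real assume \<epsilon>: "\<epsilon> > 0"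
    show "\<exists>x. R \<le> norm x \<and> w x \<le> (Sup S + \<epsilon>) * \<Psi> x"
    proof (rule ccontr)
      assume "\<not> ?thesis"
      then have "\<forall>x. R \<le> norm x \<longrightarrow> (Sup S + \<epsilon>) * \<Psi> x \<le> w x" by force
      then have "Sup S + \<epsilon> \<in> S" by (auto simp: S_def)
      from cSup_upper[OF this S(2)] show False using \<epsilon> by simp
    qed
  qed
qed

context elliptic_operator
begin

lemma annulus_comparison:
  assumes u: "subsol F {x. \<rho> < norm x} u" and v: "supersol F {x. \<rho> < norm x} v"
    and cu: "continuous_on {x. \<rho> \<le> norm x} u" and cv: "continuous_on {x. \<rho> \<le> norm x} v"
    and inner: "\<And>x. norm x = \<rho> \<Longrightarrow> u x \<le> v x" and outer: "\<And>x. norm x = b \<Longrightarrow> u x \<le> v x"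
    and x: "\<rho> \<le> norm x" "norm x \<le> b"
  shows "u x \<le> v x"
proof (cases "norm x = \<rho> \<or> norm x = b")
  case False
  have cl: "closure (annulus 0 \<rho> b) \<subseteq> {x. \<rho> \<le> norm x}" by (rule order_trans[OF closure_annulus_subset]) auto
  have sub: "annulus 0 \<rho> b \<subseteq> {x :: real ^ 'n. \<rho> < norm x}" by (auto simp: annulus_def)
  show ?thesis
  proof (rule comparison[OF open_annulus bounded_annulus])
    show "subsol F (annulus 0 \<rho> b) u" by (rule subsol_mono[OF u sub])
    show "supersol F (annulus 0 \<rho> b) v" by (rule supersol_mono[OF v sub])
    show "continuous_on (closure (annulus 0 \<rho> b)) u" by (rule continuous_on_subset[OF cu cl])
    show "continuous_on (closure (annulus 0 \<rho> b)) v" by (rule continuous_on_subset[OF cv cl])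
    show "u y \<le> v y" if "y \<in> frontier (annulus 0 \<rho> b)" for y
      using frontier_annulusD[OF that] inner outer by auto
    have "x \<in> annulus 0 \<rho> b" using x False by (simp add: annulus_def)
    then show "x \<in> closure (annulus 0 \<rho> b)" using closure_subset by blast
  qed
qed (use inner outer in auto)

lemma exterior_comparison:
  assumes u: "subsol F {x. \<rho> < norm x} u" and v: "supersol F {x. \<rho> < norm x} v"
    and cu: "continuous_on {x. \<rho> \<le> norm x} u" and cv: "continuous_on {x. \<rho> \<le> norm x} v"
    and inner: "\<And>x. norm x = \<rho> \<Longrightarrow> u x \<le> v x"
    and far: "\<And>e. e > 0 \<Longrightarrow> \<exists>R. \<forall>x. R \<le> norm x \<longrightarrow> u x \<le> v x + e"
    and x: "\<rho> \<le> norm x"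
  shows "u x \<le> v x"
proof (rule field_le_epsilon)
  fix e :: real assume e: "e > 0"
  obtain R where R: "\<And>x. R \<le> norm x \<Longrightarrow> u x \<le> v x + e" using far[OF e] by blast
  show "u x \<le> v x + e"
  proof (rule annulus_comparison[OF u supersol_add_const[OF v] cu _ _ _ x])
    show "continuous_on {x. \<rho> \<le> norm x} (\<lambda>x. v x + e)" by (intro continuous_intros cv)
    show "u y \<le> v y + e" if "norm y = \<rho>" for y using inner[OF that] e by simp
    show "u y \<le> v y + e" if "norm y = max R (norm x)" for y by (rule R) (simp add: that)
    show "norm x \<le> max R (norm x)" by simp
  qed
qed

lemma soln_affine: "soln F \<Omega> v \<Longrightarrow> k > 0 \<Longrightarrow> soln F \<Omega> (\<lambda>x. k * v x + c)"
  by (intro soln_add_const soln_scaleR)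

text \<open>If \<open>u\<close> does not tend to infinity, its lower limit \<open>l\<close> is
  finite. Where \<open>u\<close> is nearly \<open>l\<close>, Harnack for the nonnegative
  \<open>u - (l - \<epsilon>)\<close> bounds \<open>u\<close> by
  \<open>l + 2 * C * \<epsilon>\<close> on the whole sphere; there are such spheres beyond every
  radius, and the maximum principle fills the space between two of them.\<close>

lemma limit_or_infinity:
  assumes n: "CARD('n) \<ge> 2" and u: "soln F {x. 1 < norm x} u"
    and c0: "\<And>x. 1 < norm x \<Longrightarrow> c0 \<le> u x"
  shows "(\<exists>l. (u \<longlongrightarrow> l) at_infinity) \<or> (\<forall>K. \<exists>R. \<forall>x. R \<le> norm x \<longrightarrow> K \<le> u x)"
proof (rule disjCI)
  assume "\<not> (\<forall>K. \<exists>R. \<forall>x. R \<le> norm x \<longrightarrow> K \<le> u x)"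
  then obtain K where "\<forall>R. \<not> (\<forall>x. R \<le> norm x \<longrightarrow> K \<le> u x)" by blast
  then have K: "\<exists>x. R \<le> norm x \<and> u x < K" for R by (meson not_le)
  have A: "\<exists>R. \<forall>x. R \<le> norm x \<longrightarrow> c0 * 1 \<le> u x" using c0 by (intro exI[of _ 2]) auto
  have P: "\<exists>R. \<forall>x :: real ^ 'n. R \<le> norm x \<longrightarrow> 0 < (1 :: real)" by simp
  have bd: "k \<le> K" if ex: "\<exists>R. \<forall>x. R \<le> norm x \<longrightarrow> k * 1 \<le> u x" for k
  proof -
    obtain R where le: "\<And>x. R \<le> norm x \<Longrightarrow> k * 1 \<le> u x" using ex by blast
    obtain x where "R \<le> norm x" "u x < K" using K by blast
    then show ?thesis using le[of x] by simp
  qed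
  obtain l where "l \<ge> c0" and low: "\<And>\<epsilon>. \<epsilon> > 0 \<Longrightarrow> \<exists>R. \<forall>x. R \<le> norm x \<longrightarrow> (l - \<epsilon>) * 1 \<le> u x"
    and touch: "\<And>\<epsilon> R. \<epsilon> > 0 \<Longrightarrow> \<exists>x. R \<le> norm x \<and> u x \<le> (l + \<epsilon>) * 1"
    by (rule liminf_ratio[OF A P], erule bd, rule that)
  obtain C where C: "C \<ge> 1" "\<And>u \<rho> r x y. \<rho> > 0 \<Longrightarrow> soln F {x. \<rho> < norm x} u \<Longrightarrow>
    (\<And>z. \<rho> < norm z \<Longrightarrow> 0 \<le> u z) \<Longrightarrow> r \<ge> 2 * \<rho> \<Longrightarrow> norm x = r \<Longrightarrow> norm y = r \<Longrightarrow> u x \<le> C * u y"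
    using harnack_sphere[OF n] by blast
  have "(u \<longlongrightarrow> l) at_infinity"
    unfolding tendsto_iff eventually_at_infinity
  proof (intro allI impI)
    fix e :: real assume e: "e > 0"
    define \<epsilon> where "\<epsilon> = e / (4 * C)"
    have \<epsilon>: "\<epsilon> > 0" "\<epsilon> < e" "2 * C * \<epsilon> < e"
      using e C(1) by (auto simp: \<epsilon>_def field_simps)
    obtain R1 where R1: "\<And>x. R1 \<le> norm x \<Longrightarrow> l - \<epsilon> \<le> u x" using low[OF \<epsilon>(1)] by auto
    define \<rho> where "\<rho> = max 1 R1"
    have \<rho>: "\<rho> > 0" by (simp add: \<rho>_def)
    have sph: "\<exists>r\<ge>R. r \<ge> 2 * \<rho> \<and> (\<forall>x. norm x = r \<longrightarrow> u x \<le> l + 2 * C * \<epsilon>)" for R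
    proof -
      obtain y where y: "max R (2 * \<rho>) \<le> norm y" "u y \<le> l + \<epsilon>" using touch[OF \<epsilon>(1), of "max R (2 * \<rho>)"] by auto
      have "u x \<le> l + 2 * C * \<epsilon>" if "norm x = norm y" for x
      proof -
        have "u x + - (l - \<epsilon>) \<le> C * (u y + - (l - \<epsilon>))"
        proof (rule C(2)[OF \<rho>, where r = "norm y"])
          show "soln F {x. \<rho> < norm x} (\<lambda>x. u x + - (l - \<epsilon>))"
            by (rule soln_add_const[OF soln_mono[OF u]]) (auto simp: \<rho>_def)
          show "0 \<le> u z + - (l - \<epsilon>)" if "\<rho> < norm z" for z
            using R1[of z] that by (simp add: \<rho>_def)
        qed (use y that in auto)
        also have "\<dots> \<le> C * (2 * \<epsilon>)" using y(2) C(1) by (intro mult_left_mono) auto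
        finally show ?thesis using \<epsilon> by simp
      qed
      then show ?thesis using y by (intro exI[of _ "norm y"]) auto
    qed
    obtain r1 where r1: "r1 \<ge> 2 * \<rho>" "\<And>x. norm x = r1 \<Longrightarrow> u x \<le> l + 2 * C * \<epsilon>" using sph[of 0] by blast
    have r11: "r1 > 1" using r1(1) by (auto simp: \<rho>_def)
    show "\<exists>b. \<forall>x. b \<le> norm x \<longrightarrow> dist (u x) l < e"
    proof (intro exI[of _ r1] allI impI)
      fix x :: "real ^ 'n" assume x: "r1 \<le> norm x"
      obtain r2 where r2: "r2 \<ge> norm x" "\<And>x. norm x = r2 \<Longrightarrow> u x \<le> l + 2 * C * \<epsilon>" using sph[of "norm x"] by blast
      have "u x \<le> l + 2 * C * \<epsilon>"
      proof (cases "norm x = r1 \<or> norm x = r2")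
        case False
        have cl: "closure (annulus 0 r1 r2) \<subseteq> {x :: real ^ 'n. 1 < norm x}"
          by (rule order_trans[OF closure_annulus_subset]) (use r11 in auto)
        show ?thesis
        proof (rule subsol_le_const[OF open_annulus bounded_annulus])
          show "subsol F (annulus 0 r1 r2) u"
            using u cl closure_subset unfolding soln_def by (blast intro: subsol_mono)
          show "continuous_on (closure (annulus 0 r1 r2)) u"
            using u cl unfolding soln_def by (blast intro: continuous_on_subset)
          show "u y \<le> l + 2 * C * \<epsilon>" if "y \<in> frontier (annulus 0 r1 r2)" for y
            using frontier_annulusD[OF that] r1 r2 by auto
          have "x \<in> annulus 0 r1 r2" using x r2 False by (simp add: annulus_def)
          then show "x \<in> closure (annulus 0 r1 r2)" using closure_subset by blast
        qed
      qed (use r1 r2 in auto)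
      moreover have "l - \<epsilon> \<le> u x" using x r1(1) \<rho> by (intro R1) (auto simp: \<rho>_def)
      ultimately show "dist (u x) l < e" using \<epsilon> by (simp add: dist_real_def abs_less_iff)
    qed
  qed
  then show "\<exists>l. (u \<longlongrightarrow> l) at_infinity" by blast
qed

lemma asymptotics_above_limit:
  assumes n: "CARD('n) \<ge> 2" and \<Phi>: "\<Phi> \<in> H_plus \<alpha>" "soln F (- {0}) \<Phi>"
    and u: "soln F {x. 1 < norm x} u" and lim: "(u \<longlongrightarrow> l) at_infinity"
    and r: "r > 1" "\<And>x. norm x = r \<Longrightarrow> l < u x"
  shows "\<alpha> > 0 \<and> (\<exists>a>0. ((\<lambda>x. (u x - l) / \<Phi> x) \<longlongrightarrow> a) at_infinity)"
proof -
  define w where "w x = u x + - l" for x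
  have w: "soln F {x. 1 < norm x} w" unfolding w_def by (rule soln_add_const[OF u])
  have wr: "soln F {x. r < norm x} w" by (rule soln_mono[OF w]) (use r(1) in auto)
  have cw: "continuous_on {x. r \<le> norm x} w"
    using w r(1) unfolding soln_def by (auto intro: continuous_on_subset)
  have c\<Phi>: "continuous_on {x. s \<le> norm x} \<Phi>" if "s > 0" for s
    by (rule H_plus_continuous[OF \<Phi>(1)]) (use that in auto)
  have c\<Phi>r: "continuous_on (sphere 0 r) \<Phi>" by (rule H_plus_continuous[OF \<Phi>(1)]) (use r(1) in auto)
  have cwr: "continuous_on (sphere 0 r) w" by (rule continuous_on_subset[OF cw]) auto
  have \<Phi>sol: "soln F {x. s < norm x} \<Phi>" if "s > 0" for s by (rule soln_mono[OF \<Phi>(2)]) (use that in auto)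
  have limw: "\<exists>R. \<forall>x. R \<le> norm x \<longrightarrow> \<bar>w x\<bar> < e" if "e > 0" for e
    using lim that unfolding tendsto_iff eventually_at_infinity w_def by (simp add: dist_real_def)
  obtain z where z: "norm z = r" "\<And>x. norm x = r \<Longrightarrow> w z \<le> w x"
    using sphere_attains_inf[OF cwr] r(1) by auto
  define c where "c = w z"
  have c: "c > 0" "\<And>x. norm x = r \<Longrightarrow> c \<le> w x" using z r by (auto simp: c_def w_def)
  obtain T where T: "T > 0" "\<And>x. norm x = r \<Longrightarrow> \<bar>\<Phi> x\<bar> \<le> T" using sphere_bound[OF c\<Phi>r] by blast
  obtain W where W: "W > 0" "\<And>x. norm x = r \<Longrightarrow> \<bar>w x\<bar> \<le> W" using sphere_bound[OF cwr] by blast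
  \<comment> \<open>Otherwise \<Phi> tends to minus infinity, so
    \<open>k * \<Phi> + (c - k * T)\<close> lies below \<open>w\<close> on the sphere of radius
    \<open>r\<close> and far out, hence in between. As \<open>k\<close> tends to 0 this gives
    \<open>w \<ge> c > 0\<close>, although \<open>w\<close> tends to 0.\<close>
  have \<alpha>: "\<alpha> > 0"
  proof (rule ccontr)
    assume "\<not> \<alpha> > 0"
    then have \<alpha>: "\<alpha> \<le> 0" by simp
    have key: "k * \<Phi> x + (c - k * T) \<le> w x" if k: "k > 0" and x: "r \<le> norm x" for k x
    proof (rule exterior_comparison[OF _ _ _ cw _ _ x])
      have s: "soln F {x. r < norm x} (\<lambda>x. k * \<Phi> x + (c - k * T))"
        using r(1) by (intro soln_affine \<Phi>sol k) simp
      then show "subsol F {x. r < norm x} (\<lambda>x. k * \<Phi> x + (c - k * T))" by (simp add: soln_def)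
      show "supersol F {x. r < norm x} w" using wr by (simp add: soln_def)
      show "continuous_on {x. r \<le> norm x} (\<lambda>x. k * \<Phi> x + (c - k * T))"
        using r(1) by (intro continuous_intros c\<Phi>) simp
      show "k * \<Phi> y + (c - k * T) \<le> w y" if "norm y = r" for y
      proof -
        have "k * \<Phi> y \<le> k * T" using T(2)[OF that] k by (intro mult_left_mono) auto
        then show ?thesis using c(2)[OF that] by simp
      qed
      show "\<exists>R. \<forall>y. R \<le> norm y \<longrightarrow> k * \<Phi> y + (c - k * T) \<le> w y + e" if e: "e > 0" for e
      proof -
        obtain R1 where R1: "\<And>y. R1 \<le> norm y \<Longrightarrow> \<Phi> y \<le> T - c / k"
          using H_plus_tendsto_minus_infinity[OF \<Phi>(1) \<alpha>] by blast
        obtain R2 where R2: "\<And>y. R2 \<le> norm y \<Longrightarrow> \<bar>w y\<bar> < e" using limw[OF e] by blast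
        have "k * \<Phi> y + (c - k * T) \<le> w y + e" if "max R1 R2 \<le> norm y" for y
        proof -
          have "k * \<Phi> y \<le> k * (T - c / k)" using R1[of y] k that by (intro mult_left_mono) auto
          also have "\<dots> = k * T - c" using k by (simp add: right_diff_distrib)
          finally show ?thesis using R2[of y] that by (simp add: abs_less_iff)
        qed
        then show ?thesis by blast
      qed
    qed
    have ge: "c \<le> w x" if x: "r \<le> norm x" for x
    proof (rule field_le_epsilon)
      fix e :: real assume e: "e > 0"
      define k where "k = e / (T + \<bar>\<Phi> x\<bar> + 1)"
      have p: "T + \<bar>\<Phi> x\<bar> + 1 > 0" using T by simp
      have k: "k > 0" using e p by (simp add: k_def)
      have "k * (T - \<Phi> x) \<le> k * (T + \<bar>\<Phi> x\<bar> + 1)" using k by (intro mult_left_mono) auto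
      also have "\<dots> = e" using p by (simp add: k_def)
      finally show "c \<le> w x + e" using key[OF k x] by (simp add: algebra_simps)
    qed
    obtain R where R: "\<And>x. R \<le> norm x \<Longrightarrow> \<bar>w x\<bar> < c" using limw[OF c(1)] by blast
    obtain x :: "real ^ 'n" where "norm x = max (max R r) 0" using ex_norm_eq[of "max (max R r) 0"] by auto
    then show False using R[of x] ge[of x] r(1) by (auto simp: abs_less_iff)
  qed
  have \<Phi>pos: "\<Phi> x > 0" if "x \<noteq> 0" for x
    using H_plus_sign[OF \<Phi>(1) _ that] \<alpha> by (simp add: zero_less_mult_iff)
  have hom: "\<sigma> powr \<alpha> * \<Phi> (\<sigma> *\<^sub>R x) = \<Phi> x" if "\<sigma> > 0" "x \<noteq> 0" for \<sigma> x
    using H_plusD[OF \<Phi>(1) _ that] \<alpha> by simp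
  have upper: "w x \<le> k * \<Phi> x" if k: "k > 0" and s: "s \<ge> r" and le: "\<And>y. norm y = s \<Longrightarrow> w y \<le> k * \<Phi> y" and x: "s \<le> norm x" for k s x
  proof -
    have "w x \<le> k * \<Phi> x + 0"
    proof (rule exterior_comparison[OF _ _ _ _ _ _ x])
      have s0: "s > 0" using s r(1) by simp
      show "subsol F {x. s < norm x} w" using wr s by (auto simp: soln_def intro: subsol_mono)
      have "soln F {x. s < norm x} (\<lambda>x. k * \<Phi> x + 0)" by (intro soln_affine \<Phi>sol k s0)
      then show "supersol F {x. s < norm x} (\<lambda>x. k * \<Phi> x + 0)" by (simp add: soln_def)
      show "continuous_on {x. s \<le> norm x} w" by (rule continuous_on_subset[OF cw]) (use s in auto)
      show "continuous_on {x. s \<le> norm x} (\<lambda>x. k * \<Phi> x + 0)" by (intro continuous_intros c\<Phi> s0)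
      show "\<exists>R. \<forall>y. R \<le> norm y \<longrightarrow> w y \<le> k * \<Phi> y + 0 + e" if e: "e > 0" for e
      proof -
        obtain R where R: "\<And>y. R \<le> norm y \<Longrightarrow> \<bar>w y\<bar> < e" using limw[OF e] by blast
        have "w y \<le> k * \<Phi> y + 0 + e" if "max R 1 \<le> norm y" for y
        proof -
          have "y \<noteq> 0" using that by auto
          then have "k * \<Phi> y > 0" using \<Phi>pos[of y] k by simp
          then show ?thesis using R[of y] that by (simp add: abs_less_iff)
        qed
        then show ?thesis by blast
      qed
    qed (use le in auto)
    then show ?thesis by simp
  qed
  obtain zm where zm: "norm zm = r" "\<And>x. norm x = r \<Longrightarrow> \<Phi> zm \<le> \<Phi> x"
    using sphere_attains_inf[OF c\<Phi>r] r(1) by auto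
  have zm0: "\<Phi> zm > 0" using zm(1) r(1) by (intro \<Phi>pos) auto
  define C where "C = W / \<Phi> zm"
  have C: "C > 0" using W zm0 by (simp add: C_def)
  have wC: "w x \<le> C * \<Phi> x" if "r \<le> norm x" for x
  proof (rule upper[OF C order_refl _ that])
    fix y :: "real ^ 'n" assume y: "norm y = r"
    have "W = C * \<Phi> zm" using zm0 by (simp add: C_def)
    also have "\<dots> \<le> C * \<Phi> y" using zm(2)[OF y] C by (intro mult_left_mono) auto
    finally show "w y \<le> C * \<Phi> y" using W(2)[OF y] by simp
  qed
  define c1 where "c1 = c / T"
  have c1: "c1 > 0" using c T by (simp add: c1_def)
  have wc: "c1 * \<Phi> x \<le> w x" if x: "r \<le> norm x" for x
  proof -
    have "c1 * \<Phi> x + 0 \<le> w x"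
    proof (rule exterior_comparison[OF _ _ _ cw _ _ x])
      have "soln F {x. r < norm x} (\<lambda>x. c1 * \<Phi> x + 0)" using r(1) by (intro soln_affine \<Phi>sol c1) simp
      then show "subsol F {x. r < norm x} (\<lambda>x. c1 * \<Phi> x + 0)" by (simp add: soln_def)
      show "supersol F {x. r < norm x} w" using wr by (simp add: soln_def)
      show "continuous_on {x. r \<le> norm x} (\<lambda>x. c1 * \<Phi> x + 0)" using r(1) by (intro continuous_intros c\<Phi>) simp
      show "c1 * \<Phi> y + 0 \<le> w y" if "norm y = r" for y
      proof -
        have "c1 * \<Phi> y \<le> c1 * T" using T(2)[OF that] c1 by (intro mult_left_mono) auto
        also have "\<dots> = c" using T by (simp add: c1_def)
        finally show ?thesis using c(2)[OF that] by simp
      qed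
      show "\<exists>R. \<forall>y. R \<le> norm y \<longrightarrow> c1 * \<Phi> y + 0 \<le> w y + e" if e: "e > 0" for e
      proof -
        obtain R where R: "\<And>y. R \<le> norm y \<Longrightarrow> \<bar>w y\<bar> < e / 2" using limw[of "e/2"] e by auto
        obtain R2 where R2: "\<And>y. R2 \<le> norm y \<Longrightarrow> \<Phi> y \<le> e / 2 / c1"
          using H_plus_tendsto_zero[OF \<Phi>(1) \<alpha>, of "e / 2 / c1"] e c1 by auto
        have "c1 * \<Phi> y + 0 \<le> w y + e" if "max R R2 \<le> norm y" for y
        proof -
          have "c1 * \<Phi> y \<le> c1 * (e / 2 / c1)" using R2[of y] c1 that by (intro mult_left_mono) auto
          also have "\<dots> = e / 2" using c1 by simp
          finally show ?thesis using R[of y] that by (simp add: abs_less_iff)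
        qed
        then show ?thesis by blast
      qed
    qed
    then show ?thesis by simp
  qed
  have A: "\<exists>R. \<forall>x. R \<le> norm x \<longrightarrow> c1 * \<Phi> x \<le> w x" using wc by blast
  have P: "\<exists>R. \<forall>x. R \<le> norm x \<longrightarrow> 0 < \<Phi> x"
  proof (intro exI allI impI)
    fix x :: "real ^ 'n" assume "1 \<le> norm x"
    then show "0 < \<Phi> x" by (intro \<Phi>pos) auto
  qed
  have bd: "k \<le> C" if ex: "\<exists>R. \<forall>x. R \<le> norm x \<longrightarrow> k * \<Phi> x \<le> w x" for k
  proof -
    obtain R where le: "\<And>x. R \<le> norm x \<Longrightarrow> k * \<Phi> x \<le> w x" using ex by blast
    have "0 \<le> max R r" using r(1) by linarith
    then obtain x :: "real ^ 'n" where x: "norm x = max R r" using ex_norm_eq by blast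
    have "k * \<Phi> x \<le> C * \<Phi> x" using le[of x] wC[of x] x by auto
    moreover have "\<Phi> x > 0" using x r(1) by (intro \<Phi>pos) auto
    ultimately show ?thesis by simp
  qed
  obtain a where a: "a \<ge> c1" and low: "\<And>\<epsilon>. \<epsilon> > 0 \<Longrightarrow> \<exists>R. \<forall>x. R \<le> norm x \<longrightarrow> (a - \<epsilon>) * \<Phi> x \<le> w x"
    and touch: "\<And>\<epsilon> R. \<epsilon> > 0 \<Longrightarrow> \<exists>x. R \<le> norm x \<and> w x \<le> (a + \<epsilon>) * \<Phi> x"
    by (rule liminf_ratio[OF A P], erule bd, rule that)
  have a0: "a > 0" using a c1 by simp
  have "((\<lambda>x. (u x - l) / \<Phi> x) \<longlongrightarrow> a) at_infinity"
    unfolding tendsto_iff eventually_at_infinity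
  proof (intro allI impI)
    fix e :: real assume e: "e > 0"
    obtain R1 where R1: "\<And>x. R1 \<le> norm x \<Longrightarrow> (a - e/2) * \<Phi> x \<le> w x" using low[of "e/2"] e by auto
    \<comment> \<open>One sphere suffices: beyond it \<open>upper\<close> propagates the bound,
      because \<open>w\<close> tends to 0 and \<Phi> is positive.\<close>
    have "\<exists>s\<ge>max R1 r. \<forall>x. norm x = s \<longrightarrow> w x \<le> (a + e/2) * \<Phi> x"
    proof (rule blow_down_touching[OF n \<Phi>(2) hom \<Phi>pos _ wr])
      show "0 \<le> w x \<and> w x \<le> C * \<Phi> x" if "r < norm x" for x
      proof -
        have "x \<noteq> 0" using that r(1) by auto
        then have "c1 * \<Phi> x > 0" using \<Phi>pos[of x] c1 by simp
        then show ?thesis using wc[of x] wC[of x] that by simp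
      qed
    qed (use r(1) e a0 low touch in auto)
    then obtain s where s: "s \<ge> max R1 r" "\<And>x. norm x = s \<Longrightarrow> w x \<le> (a + e/2) * \<Phi> x" by blast
    show "\<exists>b. \<forall>x. b \<le> norm x \<longrightarrow> dist ((u x - l) / \<Phi> x) a < e"
    proof (intro exI[of _ s] allI impI)
      fix x :: "real ^ 'n" assume x: "s \<le> norm x"
      have p: "\<Phi> x > 0" using x s r(1) by (intro \<Phi>pos) auto
      have "w x \<le> (a + e/2) * \<Phi> x" by (rule upper[OF _ _ s(2) x]) (use s(1) a0 e in auto)
      then have 1: "(u x - l) / \<Phi> x \<le> a + e/2" using p by (simp add: w_def pos_divide_le_eq)
      have "(a - e/2) * \<Phi> x \<le> w x" using x s by (intro R1) auto
      then have "a - e/2 \<le> (u x - l) / \<Phi> x" using p by (simp add: w_def pos_le_divide_eq)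
      then show "dist ((u x - l) / \<Phi> x) a < e" using 1 e by (simp add: dist_real_def abs_less_iff)
    qed
  qed
  then show ?thesis using \<alpha> a0 by blast
qed


text \<open>Growth at the logarithmic rate: the Harnack inequality for \<open>u\<close> minus its approximate
  minimum gains an error of order \<open>\<epsilon> ln r\<close> only.\<close>

lemma logarithmic_touching:
  assumes n: "CARD('n) \<ge> 2" and u: "soln F {x. 1 < norm x} u" and B: "B > 0"
    and \<Psi>: "\<And>x. 1 \<le> norm x \<Longrightarrow> \<bar>\<Psi> x - ln (norm x)\<bar> \<le> B"
    and a: "a > 0" and low: "\<And>\<epsilon>. \<epsilon> > 0 \<Longrightarrow> \<exists>R. \<forall>x. R \<le> norm x \<longrightarrow> (a - \<epsilon>) * \<Psi> x \<le> u x"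
    and touch: "\<And>\<epsilon> R. \<epsilon> > 0 \<Longrightarrow> \<exists>x. R \<le> norm x \<and> u x \<le> (a + \<epsilon>) * \<Psi> x"
    and \<epsilon>: "\<epsilon> > 0"
  shows "\<exists>r\<ge>R. \<forall>x. norm x = r \<longrightarrow> u x \<le> (a + \<epsilon>) * \<Psi> x"
proof -
  obtain C where C: "C \<ge> 1" "\<And>u \<rho> r x y. \<rho> > 0 \<Longrightarrow> soln F {x. \<rho> < norm x} u \<Longrightarrow>
    (\<And>z. \<rho> < norm z \<Longrightarrow> 0 \<le> u z) \<Longrightarrow> r \<ge> 2 * \<rho> \<Longrightarrow> norm x = r \<Longrightarrow> norm y = r \<Longrightarrow> u x \<le> C * u y"
    using harnack_sphere[OF n] by blast
  define \<eta> where "\<eta> = min (a / 2) (\<epsilon> / (4 * C))"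
  have \<eta>: "\<eta> > 0" "\<eta> < a" using a \<epsilon> C(1) by (auto simp: \<eta>_def)
  have \<eta>C: "2 * C * \<eta> \<le> \<epsilon> / 2"
  proof -
    have "2 * C * \<eta> \<le> 2 * C * (\<epsilon> / (4 * C))" using C(1) by (intro mult_left_mono) (auto simp: \<eta>_def)
    then show ?thesis using C(1) by simp
  qed
  \<comment> \<open>Collects the errors that stay bounded as \<open>r\<close> grows;
    \<open>exp (2 * G / \<epsilon>) \<le> r\<close> makes them at most
    \<open>\<epsilon> / 2 * L\<close>.\<close>
  define G where "G = C * (2 * a * (2 * B + 1)) + (a + \<epsilon>) * B"
  obtain R1 where R1: "\<And>x. R1 \<le> norm x \<Longrightarrow> (a - \<eta>) * \<Psi> x \<le> u x" using low[OF \<eta>(1)] by blast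
  obtain y where y: "max (max R 4) (max (2 * R1) (exp (2 * G / \<epsilon>))) \<le> norm y" "u y \<le> (a + \<eta>) * \<Psi> y"
    using touch[OF \<eta>(1)] by blast
  define r where "r = norm y"
  have r: "R \<le> r" "4 \<le> r" "2 * R1 \<le> r" "exp (2 * G / \<epsilon>) \<le> r" using y(1) by (auto simp: r_def)
  define L where "L = ln r"
  have "2 * G / \<epsilon> \<le> L" unfolding L_def using r by (simp add: ln_ge_iff)
  then have LG: "G \<le> \<epsilon> / 2 * L" using \<epsilon> by (simp add: field_simps)
  have L0: "L \<ge> 0" using r by (simp add: L_def)
  have ln2: "0 < ln (2::real)" "ln (2::real) \<le> 1" using ln_le_minus_one[of 2] by simp_all
  have lnr2: "ln (r / 2) = L - ln 2" using r by (simp add: L_def ln_div)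
  \<comment> \<open>A lower bound for \<open>u\<close> on \<open>r / 2 < norm z\<close>. At
    \<open>y\<close> the difference \<open>u - l\<close> is at most \<open>2 * \<eta> * L\<close>
    plus a bounded amount, so Harnack multiplies only a small part of the logarithm by
    \<open>C\<close>.\<close>
  define l where "l = (a - \<eta>) * (L - ln 2 - B)"
  have "u x \<le> (a + \<epsilon>) * \<Psi> x" if x: "norm x = r" for x
  proof -
    have "u x + - l \<le> C * (u y + - l)"
    proof (rule C(2)[where \<rho> = "r / 2" and r = r])
      show "soln F {x. r / 2 < norm x} (\<lambda>x. u x + - l)"
        by (rule soln_add_const[OF soln_mono[OF u]]) (use r in auto)
      show "0 \<le> u z + - l" if z: "r / 2 < norm z" for z
      proof -
        have "ln (r / 2) \<le> ln (norm z)" by (rule ln_mono) (use z r in auto)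
        then have "L - ln 2 - B \<le> \<Psi> z" using \<Psi>[of z] z r unfolding lnr2 by (simp add: abs_le_iff)
        then have "l \<le> (a - \<eta>) * \<Psi> z" unfolding l_def using \<eta> by (intro mult_left_mono) auto
        then show ?thesis using R1[of z] z r by simp
      qed
    qed (use r x in \<open>auto simp: r_def\<close>)
    also have "\<dots> \<le> C * (2 * \<eta> * L + 2 * a * (2 * B + 1))"
    proof (rule mult_left_mono)
      have "u y \<le> (a + \<eta>) * (L + B)"
      proof -
        have "\<Psi> y \<le> L + B" using \<Psi>[of y] r by (simp add: r_def L_def abs_le_iff)
        then have "(a + \<eta>) * \<Psi> y \<le> (a + \<eta>) * (L + B)" using a \<eta> by (intro mult_left_mono) auto
        then show ?thesis using y(2) by simp
      qed
      moreover have "(a + \<eta>) * B \<le> 2 * a * B" using \<eta> B by (intro mult_right_mono) auto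
      moreover have "(a - \<eta>) * (ln 2 + B) \<le> a * (1 + B)"
      proof (rule mult_mono)
        show "0 \<le> ln 2 + B" using ln2(1) B by linarith
      qed (use \<eta> B a ln2(2) in auto)
      moreover have "0 \<le> a * B" using a B by simp
      ultimately show "u y + - l \<le> 2 * \<eta> * L + 2 * a * (2 * B + 1)"
        using a by (simp add: l_def algebra_simps)
    qed (use C in simp)
    finally have "u x \<le> l + (2 * C * \<eta>) * L + C * (2 * a * (2 * B + 1))" by (simp add: algebra_simps)
    also have "(2 * C * \<eta>) * L \<le> (\<epsilon> / 2) * L" using \<eta>C L0 by (rule mult_right_mono)
    also have "l \<le> a * L"
    proof -
      have "l \<le> (a - \<eta>) * L" unfolding l_def by (rule mult_left_mono) (use \<eta> B ln2(1) in linarith)+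
      also have "\<dots> \<le> a * L" using \<eta> L0 by (intro mult_right_mono) auto
      finally show ?thesis .
    qed
    finally have "u x \<le> a * L + (\<epsilon> / 2) * L + C * (2 * a * (2 * B + 1))" by simp
    also have "\<dots> \<le> (a + \<epsilon>) * (L - B)" using LG unfolding G_def by (simp add: algebra_simps)
    also have "\<dots> \<le> (a + \<epsilon>) * \<Psi> x"
    proof -
      have "L - B \<le> \<Psi> x" using \<Psi>[of x] x r by (simp add: L_def abs_le_iff)
      then show ?thesis using a \<epsilon> by (intro mult_left_mono) auto
    qed
    finally show ?thesis .
  qed
  then show ?thesis using r by blast
qed

text \<open>The dual operator appears because minus its fundamental solution solves the equation for
  \<open>F\<close> and can grow. The bounds \<open>T\<close> and \<open>Cu\<close> on the sphere of
  radius 2 do not depend on the slope, so the slopes \<open>a + \<epsilon>\<close> and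
  \<open>a - \<epsilon>\<close> may tend to \<open>a\<close> with the same \<open>C\<close>.\<close>

lemma asymptotics_at_infinity:
  assumes n: "CARD('n) \<ge> 2" and \<Phi>: "\<Phi> \<in> H_plus \<alpha>" "soln (dual_operator F) (- {0}) \<Phi>"
    and u: "soln F {x. 1 < norm x} u" and inf: "\<And>K. \<exists>R. \<forall>x. R \<le> norm x \<longrightarrow> K \<le> u x"
  shows "\<alpha> \<le> 0 \<and> (\<exists>a>0. \<exists>C>0. \<forall>x. 2 \<le> norm x \<longrightarrow> - a * \<Phi> x - C \<le> u x \<and> u x \<le> - a * \<Phi> x + C)"
proof -
  define \<Psi> where "\<Psi> x = - \<Phi> x" for x
  have \<Psi>: "soln F (- {0}) \<Psi>" using soln_dual[OF \<Phi>(2)] by (simp add: \<Psi>_def[abs_def])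
  have \<Psi>2: "soln F {x. s < norm x} \<Psi>" if "s > 0" for s by (rule soln_mono[OF \<Psi>]) (use that in auto)
  have c\<Psi>: "continuous_on T \<Psi>" if "0 \<notin> T" for T
    using \<Psi> that unfolding soln_def by (auto intro: continuous_on_subset)
  have u2: "soln F {x. 2 < norm x} u" by (rule soln_mono[OF u]) auto
  have cu: "continuous_on {x. 2 \<le> norm x} u"
    using u unfolding soln_def by (auto intro: continuous_on_subset)
  obtain T where T: "T > 0" "\<And>x. norm x = 2 \<Longrightarrow> \<bar>\<Psi> x\<bar> \<le> T"
    using sphere_bound[of 2 \<Psi>] c\<Psi>[of "sphere 0 2"] by auto
  have cu2: "continuous_on (sphere 0 2) u" by (rule continuous_on_subset[OF cu]) auto
  obtain Cu where Cu: "Cu > 0" "\<And>x. norm x = 2 \<Longrightarrow> \<bar>u x\<bar> \<le> Cu"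
    using sphere_bound[OF cu2] by blast
  have below: "k * \<Psi> x + c \<le> u x"
    if k: "k > 0" and inner: "\<And>y. norm y = 2 \<Longrightarrow> k * \<Psi> y + c \<le> u y"
      and outer: "\<And>y. norm y = b \<Longrightarrow> k * \<Psi> y + c \<le> u y" and x: "2 \<le> norm x" "norm x \<le> b" for k c b x
  proof (rule annulus_comparison[OF _ _ _ cu inner outer x])
    have s: "soln F {x. 2 < norm x} (\<lambda>x. k * \<Psi> x + c)" by (intro soln_affine \<Psi>2 k) simp
    show "subsol F {x. 2 < norm x} (\<lambda>x. k * \<Psi> x + c)" "supersol F {x. 2 < norm x} u"
      using s u2 by (auto simp: soln_def)
    show "continuous_on {x. 2 \<le> norm x} (\<lambda>x. k * \<Psi> x + c)" by (intro continuous_intros c\<Psi>) simp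
  qed auto
  have above: "u x \<le> k * \<Psi> x + c"
    if k: "k > 0" and inner: "\<And>y. norm y = 2 \<Longrightarrow> u y \<le> k * \<Psi> y + c"
      and outer: "\<And>y. norm y = b \<Longrightarrow> u y \<le> k * \<Psi> y + c" and x: "2 \<le> norm x" "norm x \<le> b" for k c b x
  proof (rule annulus_comparison[OF _ _ cu _ inner outer x])
    have s: "soln F {x. 2 < norm x} (\<lambda>x. k * \<Psi> x + c)" by (intro soln_affine \<Psi>2 k) simp
    show "supersol F {x. 2 < norm x} (\<lambda>x. k * \<Psi> x + c)" "subsol F {x. 2 < norm x} u"
      using s u2 by (auto simp: soln_def)
    show "continuous_on {x. 2 \<le> norm x} (\<lambda>x. k * \<Psi> x + c)" by (intro continuous_intros c\<Psi>) simp
  qed auto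
  \<comment> \<open>Otherwise \<Psi> is negative and tends to 0. Then
    \<open>k * (\<Psi> + t) - Cu\<close> lies below \<open>u\<close> on the sphere of radius 2 and
    far out, for every \<open>k\<close>; at \<open>x1\<close>, where \<open>\<Psi> + t\<close> is at
    least \<open>t / 2\<close>, this bound is unbounded in \<open>k\<close>.\<close>
  have \<alpha>: "\<alpha> \<le> 0"
  proof (rule ccontr)
    assume "\<not> \<alpha> \<le> 0"
    then have \<alpha>: "\<alpha> > 0" by simp
    have neg: "\<Phi> x > 0" if "x \<noteq> 0" for x
      using H_plus_sign[OF \<Phi>(1) _ that] \<alpha> by (simp add: zero_less_mult_iff)
    obtain z where z: "norm z = 2" "\<And>x. norm x = 2 \<Longrightarrow> \<Phi> z \<le> \<Phi> x"
      using sphere_attains_inf[of 2 \<Phi>] H_plus_continuous[OF \<Phi>(1), of "sphere 0 2"] by auto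
    define t where "t = \<Phi> z"
    have t: "t > 0" unfolding t_def using z(1) by (intro neg) auto
    obtain R where R: "\<And>x. R \<le> norm x \<Longrightarrow> \<Phi> x \<le> t / 2"
      using H_plus_tendsto_zero[OF \<Phi>(1) \<alpha>, of "t/2"] t by auto
    obtain x1 :: "real ^ 'n" where x1: "norm x1 = max R 2" using ex_norm_eq[OF max.coboundedI2[OF zero_le_numeral]] by blast
    have "k * (t / 2) - Cu \<le> u x1" if k: "k > 0" for k
    proof -
      obtain R2 where R2: "\<And>x. R2 \<le> norm x \<Longrightarrow> k * t - Cu \<le> u x" using inf[of "k * t - Cu"] by blast
      have "k * \<Psi> x1 + (k * t - Cu) \<le> u x1"
      proof (rule below[OF k, of _ "max R2 (norm x1)"])
        show "k * \<Psi> y + (k * t - Cu) \<le> u y" if "norm y = 2" for y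
        proof -
          have "k * t \<le> k * \<Phi> y" using z(2)[OF that] k by (intro mult_left_mono) (auto simp: t_def)
          then show ?thesis using Cu(2)[OF that] by (simp add: \<Psi>_def abs_le_iff)
        qed
        show "k * \<Psi> y + (k * t - Cu) \<le> u y" if "norm y = max R2 (norm x1)" for y
        proof -
          have "y \<noteq> 0" using that x1 by auto
          then have "k * \<Psi> y \<le> 0" using neg[of y] k by (simp add: \<Psi>_def)
          then show ?thesis using R2[of y] that by simp
        qed
      qed (use x1 in auto)
      moreover have "k * \<Phi> x1 \<le> k * (t / 2)" using R[of x1] x1 k by (intro mult_left_mono) auto
      ultimately show ?thesis by (simp add: \<Psi>_def)
    qed
    note k = this
    define k0 where "k0 = 2 * (\<bar>u x1\<bar> + Cu + 1) / t"
    have "k0 > 0" using t Cu by (simp add: k0_def add_nonneg_pos)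
    moreover have "k0 * (t / 2) = \<bar>u x1\<bar> + Cu + 1" using t by (simp add: k0_def)
    ultimately show False using k[of k0] abs_ge_self[of "u x1"] by linarith
  qed
  have far: "\<exists>R. \<forall>x. R \<le> norm x \<longrightarrow> K \<le> \<Psi> x" for K
    using H_plus_tendsto_minus_infinity[OF \<Phi>(1) \<alpha>, of "- K"] unfolding \<Psi>_def le_minus_iff[of K] .
  obtain R0 where R0: "\<And>x. R0 \<le> norm x \<Longrightarrow> 1 \<le> \<Psi> x" using far by blast
  obtain R0' where R0': "\<And>x. R0' \<le> norm x \<Longrightarrow> 0 \<le> u x" using inf by blast
  define Rp where "Rp = max 2 (max R0 R0')"
  have Rp: "Rp \<ge> 2" "\<And>x. Rp \<le> norm x \<Longrightarrow> 1 \<le> \<Psi> x" "\<And>x. Rp \<le> norm x \<Longrightarrow> 0 \<le> u x"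
    using R0 R0' by (auto simp: Rp_def)
  obtain H where H: "H \<ge> 1" "\<And>u \<rho> r x y. \<rho> > 0 \<Longrightarrow> soln F {x. \<rho> < norm x} u \<Longrightarrow>
    (\<And>z. \<rho> < norm z \<Longrightarrow> 0 \<le> u z) \<Longrightarrow> r \<ge> 2 * \<rho> \<Longrightarrow> norm x = r \<Longrightarrow> norm y = r \<Longrightarrow> u x \<le> H * u y"
    using harnack_sphere[OF n] by blast
  have up: "u x \<le> k * (\<Psi> x + T) + Cu"
    if k: "k > 0" and sph: "\<And>R. \<exists>r\<ge>R. \<forall>y. norm y = r \<longrightarrow> u y \<le> k * \<Psi> y" and x: "2 \<le> norm x" for k x
  proof -
    obtain r where r: "r \<ge> norm x" "\<And>y. norm y = r \<Longrightarrow> u y \<le> k * \<Psi> y" using sph by blast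
    have kT: "k * T > 0" using k T by simp
    have "u x \<le> k * \<Psi> x + (k * T + Cu)"
    proof (rule above[OF k, of _ r])
      show "u y \<le> k * \<Psi> y + (k * T + Cu)" if "norm y = 2" for y
      proof -
        have "k * (- T) \<le> k * \<Psi> y" using T(2)[OF that] k by (intro mult_left_mono) (auto simp: abs_le_iff)
        then show ?thesis using Cu(2)[OF that] by (simp add: abs_le_iff)
      qed
      show "u y \<le> k * \<Psi> y + (k * T + Cu)" if "norm y = r" for y using r(2)[OF that] kT Cu(1) by simp
    qed (use r x in auto)
    then show ?thesis by (simp add: algebra_simps)
  qed
  have lo: "k * (\<Psi> x - T) - Cu \<le> u x"
    if k: "k > 0" and ev: "\<And>y. R \<le> norm y \<Longrightarrow> k * \<Psi> y \<le> u y" and x: "2 \<le> norm x" for k x R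
  proof -
    have kT: "k * T > 0" using k T by simp
    have "k * \<Psi> x + (- (k * T) - Cu) \<le> u x"
    proof (rule below[OF k, of _ "max R (norm x)"])
      show "k * \<Psi> y + (- (k * T) - Cu) \<le> u y" if "norm y = 2" for y
      proof -
        have "k * \<Psi> y \<le> k * T" using T(2)[OF that] k by (intro mult_left_mono) (auto simp: abs_le_iff)
        then show ?thesis using Cu(2)[OF that] by (simp add: abs_le_iff)
      qed
      show "k * \<Psi> y + (- (k * T) - Cu) \<le> u y" if "norm y = max R (norm x)" for y
        using ev[of y] that kT Cu(1) by simp
    qed (use x in auto)
    then show ?thesis by (simp add: algebra_simps)
  qed
  obtain Rx where Rx: "\<And>x. Rx \<le> norm x \<Longrightarrow> T + 1 \<le> \<Psi> x" using far by blast
  obtain x1 :: "real ^ 'n" where x1: "norm x1 = max Rx 2" using ex_norm_eq[OF max.coboundedI2[OF zero_le_numeral]] by blast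
  have A: "\<exists>R. \<forall>x. R \<le> norm x \<longrightarrow> 0 * \<Psi> x \<le> u x" using Rp(3) by auto
  have P: "\<exists>R. \<forall>x. R \<le> norm x \<longrightarrow> 0 < \<Psi> x" using Rp(2) by (meson less_le_trans zero_less_one)
  have bd: "k \<le> \<bar>u x1\<bar> + Cu" if ex: "\<exists>R. \<forall>x. R \<le> norm x \<longrightarrow> k * \<Psi> x \<le> u x" for k
  proof (cases "k > 0")
    case True
    obtain R where le: "\<And>x. R \<le> norm x \<Longrightarrow> k * \<Psi> x \<le> u x" using ex by blast
    have "k * 1 \<le> k * (\<Psi> x1 - T)" using Rx[of x1] x1 True by (intro mult_left_mono) auto
    also have "k * (\<Psi> x1 - T) - Cu \<le> u x1" by (rule lo[OF True, of R]) (use le x1 in auto)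
    then have "k * (\<Psi> x1 - T) \<le> u x1 + Cu" by simp
    finally show ?thesis by simp
  qed (use Cu(1) in linarith)
  obtain a where a: "a \<ge> 0" and low: "\<And>\<epsilon>. \<epsilon> > 0 \<Longrightarrow> \<exists>R. \<forall>x. R \<le> norm x \<longrightarrow> (a - \<epsilon>) * \<Psi> x \<le> u x"
    and touch: "\<And>\<epsilon> R. \<epsilon> > 0 \<Longrightarrow> \<exists>x. R \<le> norm x \<and> u x \<le> (a + \<epsilon>) * \<Psi> x"
    by (rule liminf_ratio[OF A P], erule bd, rule that)
  \<comment> \<open>Harnack for \<open>u\<close> and once more for \<Psi> turns a bound at single
    points into one on whole spheres; hence the factor \<open>H * H\<close>.\<close>
  have harn: "\<exists>r\<ge>R. \<forall>y. norm y = r \<longrightarrow> u y \<le> (H * H * k) * \<Psi> y"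
    if k: "k > 0" and t: "\<And>R. \<exists>x. R \<le> norm x \<and> u x \<le> k * \<Psi> x" for k R
  proof -
    obtain x where x: "max R (2 * Rp) \<le> norm x" "u x \<le> k * \<Psi> x" using t by blast
    have "u y \<le> (H * H * k) * \<Psi> y" if y: "norm y = norm x" for y
    proof -
      have Rp0: "Rp > 0" using Rp(1) by simp
      have "u y \<le> H * u x"
        by (rule H(2)[OF Rp0 soln_mono[OF u]]) (use Rp x y in auto)
      also have "\<dots> \<le> H * (k * \<Psi> x)" using x(2) H(1) by (intro mult_left_mono) auto
      also have "\<Psi> x \<le> H * \<Psi> y"
      proof (rule H(2)[OF Rp0 \<Psi>2[OF Rp0]])
        show "0 \<le> \<Psi> z" if "Rp < norm z" for z using Rp(2)[of z] that by simp
      qed (use x y in auto)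
      then have "H * (k * \<Psi> x) \<le> H * (k * (H * \<Psi> y))" using H(1) k by (intro mult_left_mono) auto
      finally show ?thesis by (simp add: mult_ac)
    qed
    then show ?thesis using x by (intro exI[of _ "norm x"]) auto
  qed
  \<comment> \<open>With \<open>a = 0\<close> there is touching at arbitrarily small slopes
    \<open>k\<close>, and \<open>up\<close> then bounds \<open>u\<close> by \<open>Cu\<close>,
    against its divergence.\<close>
  have a0: "a > 0"
  proof (rule ccontr)
    assume "\<not> a > 0"
    then have a0: "a = 0" using a by simp
    have le: "u x \<le> Cu" if x: "2 \<le> norm x" for x
    proof (rule field_le_epsilon)
      fix e :: real assume e: "e > 0"
      define q where "q = H * H * (\<bar>\<Psi> x\<bar> + T)"
      have q: "q > 0" using H(1) T by (simp add: q_def add_nonneg_pos)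
      define k where "k = e / q"
      have k: "k > 0" using e q by (simp add: k_def)
      have "u x \<le> (H * H * k) * (\<Psi> x + T) + Cu"
      proof (rule up[OF _ _ x])
        show "0 < H * H * k" using H(1) k by simp
        show "\<exists>r\<ge>R. \<forall>y. norm y = r \<longrightarrow> u y \<le> H * H * k * \<Psi> y" for R
          by (rule harn[OF k]) (use touch[OF k] a0 in simp)
      qed
      also have "(H * H * k) * (\<Psi> x + T) \<le> (H * H * k) * (\<bar>\<Psi> x\<bar> + T)"
        using H(1) k by (intro mult_left_mono) auto
      also have "\<dots> = e"
      proof -
        have "(H * H * k) * (\<bar>\<Psi> x\<bar> + T) = q * k" by (simp add: q_def)
        then show ?thesis using q by (simp add: k_def)
      qed
      finally show "u x \<le> Cu + e" by simp
    qed
    obtain R where R: "\<And>x. R \<le> norm x \<Longrightarrow> Cu + 1 \<le> u x" using inf by blast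
    obtain x :: "real ^ 'n" where "norm x = max R 2" using ex_norm_eq[OF max.coboundedI2[OF zero_le_numeral]] by blast
    then show False using le[of x] R[of x] by auto
  qed
  \<comment> \<open>The a priori upper bound that compactness in \<open>blow_down_touching\<close>
    requires; additive constants are absorbed by \<open>\<Psi> \<ge> 1\<close>.\<close>
  define C1 where "C1 = H * H * (a + 1) * (1 + T) + Cu"
  have uC: "u x \<le> C1 * \<Psi> x" if x: "Rp \<le> norm x" for x
  proof -
    define k where "k = H * H * (a + 1)"
    have k: "k > 0" using H(1) a0 by (simp add: k_def)
    have "u x \<le> k * (\<Psi> x + T) + Cu"
    proof (rule up[OF k])
      show "\<exists>r\<ge>R. \<forall>y. norm y = r \<longrightarrow> u y \<le> k * \<Psi> y" for R
        unfolding k_def by (rule harn) (use touch[of 1] a0 in auto)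
    qed (use x Rp in simp)
    also have "\<dots> \<le> k * (\<Psi> x + T * \<Psi> x) + Cu * \<Psi> x"
      using Rp(2)[OF x] k T Cu by (intro add_mono mult_left_mono) auto
    also have "\<dots> = C1 * \<Psi> x" by (simp add: C1_def k_def algebra_simps)
    finally show ?thesis .
  qed
  have sph: "\<exists>r\<ge>R. \<forall>x. norm x = r \<longrightarrow> u x \<le> (a + \<epsilon>) * \<Psi> x" if \<epsilon>: "\<epsilon> > 0" for \<epsilon> R
  proof (cases "\<alpha> = 0")
    case True
    obtain B where B: "B > 0" "\<And>x. norm x = 1 \<Longrightarrow> \<bar>\<Psi> x\<bar> \<le> B"
      using sphere_bound[of 1 \<Psi>] c\<Psi>[of "sphere 0 1"] by auto
    have "\<bar>\<Psi> x - ln (norm x)\<bar> \<le> B" if "1 \<le> norm x" for x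
    proof -
      have x: "x \<noteq> 0" using that by auto
      have "\<Psi> x = \<Psi> (sgn x) + ln (norm x)" using H_plus_polar(1)[OF \<Phi>(1) x True] by (simp add: \<Psi>_def)
      then show ?thesis using B(2)[of "sgn x"] x by (simp add: norm_sgn)
    qed
    then show ?thesis by (rule logarithmic_touching[OF n u B(1) _ a0 low touch \<epsilon>])
  next
    case False
    then have \<alpha>n: "\<alpha> < 0" using \<alpha> by simp
    have hom: "\<sigma> powr \<alpha> * \<Psi> (\<sigma> *\<^sub>R x) = \<Psi> x" if "\<sigma> > 0" "x \<noteq> 0" for \<sigma> x
      using H_plusD[OF \<Phi>(1) False that] unfolding \<Psi>_def by simp
    have pos: "\<Psi> x > 0" if "x \<noteq> 0" for x
      using H_plus_sign[OF \<Phi>(1) False that] \<alpha>n unfolding \<Psi>_def by (simp add: zero_less_mult_iff)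
    show ?thesis
    proof (rule blow_down_touching[OF n \<Psi> hom pos _ _ _ a0 low touch \<epsilon>])
      show "Rp > 0" using Rp(1) by simp
      show "soln F {x. Rp < norm x} u" by (rule soln_mono[OF u]) (use Rp(1) in auto)
      show "0 \<le> u x \<and> u x \<le> C1 * \<Psi> x" if "Rp < norm x" for x using Rp(3) uC that by auto
    qed
  qed
  define C where "C = a * T + Cu"
  have C: "C > 0" using a0 T Cu by (simp add: C_def add_pos_pos)
  have U: "u x \<le> a * \<Psi> x + C" if x: "2 \<le> norm x" for x
  proof (rule field_le_epsilon)
    fix e :: real assume e: "e > 0"
    define q where "q = \<bar>\<Psi> x\<bar> + T"
    have q: "q > 0" using T by (simp add: q_def add_nonneg_pos)
    define \<epsilon> where "\<epsilon> = e / q"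
    have \<epsilon>: "\<epsilon> > 0" using e q by (simp add: \<epsilon>_def)
    have "u x \<le> (a + \<epsilon>) * (\<Psi> x + T) + Cu" by (rule up[OF _ sph[OF \<epsilon>] x]) (use a0 \<epsilon> in simp)
    moreover have "\<epsilon> * (\<Psi> x + T) \<le> \<epsilon> * q" using \<epsilon> by (intro mult_left_mono) (auto simp: q_def)
    moreover have "\<epsilon> * q = e" using q by (simp add: \<epsilon>_def)
    ultimately show "u x \<le> a * \<Psi> x + C + e" by (simp add: C_def algebra_simps)
  qed
  have L: "a * \<Psi> x - C \<le> u x" if x: "2 \<le> norm x" for x
  proof (rule field_le_epsilon)
    fix e :: real assume e: "e > 0"
    define q where "q = \<bar>\<Psi> x\<bar> + T"
    have q: "q > 0" using T by (simp add: q_def add_nonneg_pos)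
    define \<epsilon> where "\<epsilon> = min (a / 2) (e / q)"
    have \<epsilon>: "\<epsilon> > 0" "\<epsilon> < a" using e q a0 by (auto simp: \<epsilon>_def)
    obtain R where R: "\<And>y. R \<le> norm y \<Longrightarrow> (a - \<epsilon>) * \<Psi> y \<le> u y" using low[OF \<epsilon>(1)] by blast
    have "(a - \<epsilon>) * (\<Psi> x - T) - Cu \<le> u x" by (rule lo[OF _ R x]) (use \<epsilon> in simp)
    moreover have "\<epsilon> * (\<Psi> x - T) \<le> \<epsilon> * q" using \<epsilon> T by (intro mult_left_mono) (auto simp: q_def)
    moreover have "\<epsilon> * q \<le> e / q * q" using q by (intro mult_right_mono) (auto simp: \<epsilon>_def)
    moreover have "e / q * q = e" using q by simp
    ultimately show "a * \<Psi> x - C \<le> u x + e" by (simp add: C_def algebra_simps)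
  qed
  have "\<forall>x. 2 \<le> norm x \<longrightarrow> - a * \<Phi> x - C \<le> u x \<and> u x \<le> - a * \<Phi> x + C"
    using U L by (simp add: \<Psi>_def)
  then show ?thesis using \<alpha> a0 C by blast
qed

end

section \<open>Separation and assembly of the five alternatives\<close>

lemma eventually_pos_of_ratio_limit:
  fixes \<Phi> u :: "real ^ 'n \<Rightarrow> real"
  assumes \<Phi>: "\<Phi> \<in> H_plus \<alpha>" "\<alpha> > 0" and a: "a > 0"
    and lim: "((\<lambda>x. w x / \<Phi> x) \<longlongrightarrow> a) at_infinity"
  shows "\<forall>\<^sub>F x in at_infinity. w x > 0"
proof -
  have "\<forall>\<^sub>F x in at_infinity. w x / \<Phi> x > 0" using order_tendstoD(1)[OF lim a] .
  moreover have "\<forall>\<^sub>F x :: real ^ 'n in at_infinity. norm x \<ge> 1"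
    unfolding eventually_at_infinity by blast
  ultimately show ?thesis
  proof eventually_elim
    case (elim x)
    then have "x \<noteq> 0" by auto
    then have "\<Phi> x > 0" using H_plus_sign[OF \<Phi>(1), of x] \<Phi>(2) by (simp add: zero_less_mult_iff)
    then show ?case using elim by (simp add: zero_less_divide_iff)
  qed
qed

text \<open>The minimum over a large sphere is attained, at a point where \<open>u > l\<close> would
  fail. For \<open>u\<close> and for \<open>- u\<close> this separates the first alternative from
  the second and the third.\<close>

lemma not_eventually_gt_of_INF_le:
  fixes u :: "real ^ 'n \<Rightarrow> real"
  assumes cu: "continuous_on (- ball 0 1) u" and le: "\<And>r. r > 1 \<Longrightarrow> (INF x\<in>sphere 0 r. u x) \<le> l"
  shows "\<not> (\<forall>\<^sub>F x in at_infinity. u x > l)"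
proof
  assume "\<forall>\<^sub>F x in at_infinity. u x > l"
  then obtain R where R: "\<And>x. R \<le> norm x \<Longrightarrow> l < u x" unfolding eventually_at_infinity by blast
  define r where "r = max R 2"
  have r: "R \<le> r" "2 \<le> r" by (auto simp: r_def)
  have r0: "0 \<le> r" using r(2) by linarith
  have c: "continuous_on (sphere 0 r) u" by (rule continuous_on_subset[OF cu]) (use r(2) in auto)
  obtain z where z: "norm z = r" "\<And>x. norm x = r \<Longrightarrow> u z \<le> u x"
    using sphere_attains_inf[OF c r0] by blast
  have "(INF x\<in>sphere 0 r. u x) = u z" by (rule cInf_eq_minimum) (use z in auto)
  then show False using le[of r] R[of z] z(1) r by auto
qed

lemma INF_gt_imp: "continuous_on (sphere 0 r) u \<Longrightarrow> l < (INF x\<in>sphere 0 r. u x) \<Longrightarrow> norm x = r \<Longrightarrow> l < u x"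
  for u :: "real ^ 'n \<Rightarrow> real"
proof -
  assume c: "continuous_on (sphere 0 r) u" and l: "l < (INF x\<in>sphere 0 r. u x)" and x: "norm x = r"
  obtain B where B: "\<And>x. norm x = r \<Longrightarrow> \<bar>u x\<bar> \<le> B" using sphere_bound[OF c] by blast
  have "(INF x\<in>sphere 0 r. u x) \<le> u x"
    by (rule cINF_lower) (use B x in \<open>auto intro!: bdd_belowI2[of _ "- B"] simp: abs_le_iff minus_le_iff\<close>)
  then show ?thesis using l by simp
qed

lemma INF_uminus:
  fixes u :: "real ^ 'n \<Rightarrow> real"
  shows "(INF x\<in>S. - u x) = - (SUP x\<in>S. u x)"
  by (simp add: Inf_real_def image_image)

lemma filterlim_at_bot_of_le_H_plus:
  fixes \<Phi> u :: "real ^ 'n \<Rightarrow> real"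
  assumes \<Phi>: "\<Phi> \<in> H_plus \<alpha>" "\<alpha> \<le> 0" and a: "a > 0"
    and le: "\<And>x. x \<in> - ball 0 2 \<Longrightarrow> u x \<le> a * \<Phi> x + C"
  shows "filterlim u at_bot at_infinity"
  unfolding filterlim_at_bot
proof
  fix Z :: real
  obtain R where R: "\<And>x. R \<le> norm x \<Longrightarrow> \<Phi> x \<le> (Z - C) / a"
    using H_plus_tendsto_minus_infinity[OF \<Phi>] by blast
  have "u x \<le> Z" if "max R 2 \<le> norm x" for x
  proof -
    have "a * \<Phi> x \<le> a * ((Z - C) / a)" using R[of x] that a by (intro mult_left_mono) auto
    also have "\<dots> = Z - C" using a by simp
    finally show ?thesis using le[of x] that by simp
  qed
  then show "\<forall>\<^sub>F x in at_infinity. u x \<le> Z" unfolding eventually_at_infinity by blast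
qed

lemma ex1_nth_5:
  assumes "P0 \<or> P1 \<or> P2 \<or> P3 \<or> P4"
    and "\<not> (P0 \<and> P1)" "\<not> (P0 \<and> P2)" "\<not> (P1 \<and> P2)"
    and "\<not> ((P0 \<or> P1 \<or> P2) \<and> (P3 \<or> P4))" "\<not> (P3 \<and> P4)"
  shows "\<exists>!i::nat. i < 5 \<and> [P0, P1, P2, P3, P4] ! i"
proof -
  have i5: "(i < 5) = (i = 0 \<or> i = 1 \<or> i = 2 \<or> i = 3 \<or> i = 4)" for i :: nat by auto
  have nth: "(i < 5 \<and> [P0, P1, P2, P3, P4] ! i) = (i = 0 \<and> P0 \<or> i = 1 \<and> P1 \<or> i = 2 \<and> P2 \<or> i = 3 \<and> P3 \<or> i = 4 \<and> P4)" for i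
    unfolding i5 by auto
  show ?thesis unfolding nth using assms by (cases P0; cases P1; cases P2; cases P3; cases P4; simp)
qed

theorem theorem6:
  fixes F :: "real ^ 'n ^ 'n \<Rightarrow> real"
    and \<Phi> \<Phi>d u :: "real ^ 'n \<Rightarrow> real"
  assumes "CARD('n) \<ge> 2"
    and "uniformly_elliptic F"
    and "positively_homogeneous F"
    and "upward_fundamental_solution F \<Phi>"
    and "upward_fundamental_solution (dual_operator F) \<Phi>d"
    and "continuous_on (- ball 0 1) u"
    and "viscosity_solution F (- cball 0 1) u"
    and "bdd_above (u ` (- ball 0 1)) \<or> bdd_below (u ` (- ball 0 1))"
  shows "\<exists>!i::nat. i < 5 \<and>
    [ \<exists>u_inf. (u \<longlongrightarrow> u_inf) at_infinity \<and>
        (\<forall>r>1. (INF x\<in>sphere 0 r. u x) \<le> u_inf \<and> u_inf \<le> (SUP x\<in>sphere 0 r. u x)),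
      scaling_exponent F > 0 \<and>
        (\<exists>u_inf. (u \<longlongrightarrow> u_inf) at_infinity \<and>
          (\<exists>a>0. ((\<lambda>x. (u x - u_inf) / \<Phi> x) \<longlongrightarrow> a) at_infinity)),
      scaling_exponent (dual_operator F) > 0 \<and>
        (\<exists>u_inf. (u \<longlongrightarrow> u_inf) at_infinity \<and>
          (\<exists>a>0. ((\<lambda>x. (u x - u_inf) / (- \<Phi>d x)) \<longlongrightarrow> a) at_infinity)),
      scaling_exponent F \<le> 0 \<and>
        (\<exists>a>0. \<exists>C>0. \<forall>x\<in>- ball 0 2. a * \<Phi> x - C \<le> u x \<and> u x \<le> a * \<Phi> x + C),
      scaling_exponent (dual_operator F) \<le> 0 \<and>
        (\<exists>a>0. \<exists>C>0. \<forall>x\<in>- ball 0 2. - a * \<Phi>d x - C \<le> u x \<and> u x \<le> - a * \<Phi>d x + C)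
    ] ! i"
proof -
  note n = assms(1) and cu = assms(6)
  obtain lam Lam where "elliptic_operator F lam Lam" using elliptic_operatorI assms(2,3) by blast
  then interpret elliptic_operator F lam Lam .
  interpret d: elliptic_operator "dual_operator F" lam Lam by (rule dual)
  define \<alpha> where "\<alpha> = scaling_exponent F"
  define \<alpha>d where "\<alpha>d = scaling_exponent (dual_operator F)"
  have \<Phi>: "\<Phi> \<in> H_plus \<alpha>" "soln F (- {0}) \<Phi>"
    using assms(4) viscosity_solution_imp_soln unfolding upward_fundamental_solution_def \<alpha>_def by auto
  have \<Phi>d: "\<Phi>d \<in> H_plus \<alpha>d" "soln (dual_operator F) (- {0}) \<Phi>d"
    using assms(5) viscosity_solution_imp_soln unfolding upward_fundamental_solution_def \<alpha>d_def by auto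
  have "- cball 0 1 = {x :: real ^ 'n. 1 < norm x}" by auto
  then have u: "soln F {x. 1 < norm x} u" using viscosity_solution_imp_soln[OF assms(7)] by simp
  have ud: "soln (dual_operator F) {x. 1 < norm x} (\<lambda>x. - u x)" by (rule soln_dual[OF u])
  have cud: "continuous_on (- ball 0 1) (\<lambda>x. - u x)" by (intro continuous_on_minus cu)
  have csph: "continuous_on (sphere 0 r) u" "continuous_on (sphere 0 r) (\<lambda>x. - u x)" if "r > 1" for r
    using that by (auto intro!: continuous_on_subset[OF cu] continuous_on_subset[OF cud])
  define P0 where "P0 \<longleftrightarrow> (\<exists>u_inf. (u \<longlongrightarrow> u_inf) at_infinity \<and>
        (\<forall>r>1. (INF x\<in>sphere 0 r. u x) \<le> u_inf \<and> u_inf \<le> (SUP x\<in>sphere 0 r. u x)))"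
  define P1 where "P1 \<longleftrightarrow> \<alpha> > 0 \<and> (\<exists>u_inf. (u \<longlongrightarrow> u_inf) at_infinity \<and>
          (\<exists>a>0. ((\<lambda>x. (u x - u_inf) / \<Phi> x) \<longlongrightarrow> a) at_infinity))"
  define P2 where "P2 \<longleftrightarrow> \<alpha>d > 0 \<and> (\<exists>u_inf. (u \<longlongrightarrow> u_inf) at_infinity \<and>
          (\<exists>a>0. ((\<lambda>x. (u x - u_inf) / (- \<Phi>d x)) \<longlongrightarrow> a) at_infinity))"
  define P3 where "P3 \<longleftrightarrow> \<alpha> \<le> 0 \<and>
        (\<exists>a>0. \<exists>C>0. \<forall>x\<in>- ball 0 2. a * \<Phi> x - C \<le> u x \<and> u x \<le> a * \<Phi> x + C)"
  define P4 where "P4 \<longleftrightarrow> \<alpha>d \<le> 0 \<and>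
        (\<exists>a>0. \<exists>C>0. \<forall>x\<in>- ball 0 2. - a * \<Phi>d x - C \<le> u x \<and> u x \<le> - a * \<Phi>d x + C)"
  have E0: "\<exists>l. (u \<longlongrightarrow> l) at_infinity \<and> \<not> (\<forall>\<^sub>F x in at_infinity. u x > l) \<and> \<not> (\<forall>\<^sub>F x in at_infinity. u x < l)" if p: P0
  proof -
    obtain l where l: "(u \<longlongrightarrow> l) at_infinity"
      "\<And>r. r > 1 \<Longrightarrow> (INF x\<in>sphere 0 r. u x) \<le> l" "\<And>r. r > 1 \<Longrightarrow> l \<le> (SUP x\<in>sphere 0 r. u x)"
      using p unfolding P0_def by blast
    have "\<not> (\<forall>\<^sub>F x in at_infinity. - u x > - l)"
      by (rule not_eventually_gt_of_INF_le[OF cud]) (use l(3) in \<open>simp add: INF_uminus\<close>)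
    then show ?thesis using l(1) not_eventually_gt_of_INF_le[OF cu l(2)] by auto
  qed
  have E1: "\<exists>l. (u \<longlongrightarrow> l) at_infinity \<and> (\<forall>\<^sub>F x in at_infinity. u x > l)" if p: P1
  proof -
    obtain l a where l: "\<alpha> > 0" "(u \<longlongrightarrow> l) at_infinity" "a > 0" "((\<lambda>x. (u x - l) / \<Phi> x) \<longlongrightarrow> a) at_infinity"
      using p unfolding P1_def by blast
    then show ?thesis using eventually_pos_of_ratio_limit[OF \<Phi>(1) l(1,3,4)] by auto
  qed
  have E2: "\<exists>l. (u \<longlongrightarrow> l) at_infinity \<and> (\<forall>\<^sub>F x in at_infinity. u x < l)" if p: P2
  proof -
    obtain l a where l: "\<alpha>d > 0" "(u \<longlongrightarrow> l) at_infinity" "a > 0" "((\<lambda>x. (u x - l) / (- \<Phi>d x)) \<longlongrightarrow> a) at_infinity"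
      using p unfolding P2_def by blast
    have "(\<lambda>x. (u x - l) / (- \<Phi>d x)) = (\<lambda>x. (l - u x) / \<Phi>d x)"
      by (simp add: fun_eq_iff minus_divide_left)
    then show ?thesis using l eventually_pos_of_ratio_limit[OF \<Phi>d(1) l(1,3), of "\<lambda>x. l - u x"] by auto
  qed
  have E3: "filterlim u at_bot at_infinity" if P3
    using that filterlim_at_bot_of_le_H_plus[OF \<Phi>(1), of _ u] unfolding P3_def by blast
  have E4: "filterlim u at_top at_infinity" if p: P4
  proof -
    obtain a C where a: "\<alpha>d \<le> 0" "a > 0" "\<And>x. x \<in> - ball 0 2 \<Longrightarrow> - a * \<Phi>d x - C \<le> u x"
      using p unfolding P4_def by blast
    have "filterlim (\<lambda>x. - u x) at_bot at_infinity"
      by (rule filterlim_at_bot_of_le_H_plus[OF \<Phi>d(1) a(1,2), of _ C]) (use a(3) in force)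
    then show ?thesis by (simp add: filterlim_uminus_at_top)
  qed
  have nb: "(at_infinity :: (real ^ 'n) filter) \<noteq> bot" by (rule trivial_limit_at_infinity)
  have uniq: "l = l'" if "(u \<longlongrightarrow> l) at_infinity" "(u \<longlongrightarrow> l') at_infinity" for l l'
    using tendsto_unique[OF nb that] .
  have excl: "\<not> (P0 \<and> P1)" "\<not> (P0 \<and> P2)" "\<not> (P1 \<and> P2)" "\<not> ((P0 \<or> P1 \<or> P2) \<and> (P3 \<or> P4))" "\<not> (P3 \<and> P4)"
  proof -
    show "\<not> (P0 \<and> P1)" "\<not> (P0 \<and> P2)" using E0 E1 E2 uniq by blast+
    show "\<not> (P1 \<and> P2)"
    proof
      assume "P1 \<and> P2"
      then obtain l l' where l: "(u \<longlongrightarrow> l) at_infinity" "\<forall>\<^sub>F x in at_infinity. u x > l"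
        "(u \<longlongrightarrow> l') at_infinity" "\<forall>\<^sub>F x in at_infinity. u x < l'" using E1 E2 by blast
      have l': "\<forall>\<^sub>F x in at_infinity. u x < l" using l(4) uniq[OF l(3,1)] by simp
      have "\<forall>\<^sub>F x :: real ^ 'n in at_infinity. False" using l(2) l' by eventually_elim simp
      then show False using nb by (simp add: eventually_False)
    qed
    have inf: "filterlim u at_infinity at_infinity" if "P3 \<or> P4"
      using that E3 E4 filterlim_at_top_imp_at_infinity filterlim_at_bot_imp_at_infinity by blast
    show "\<not> ((P0 \<or> P1 \<or> P2) \<and> (P3 \<or> P4))"
      using inf E0 E1 E2 not_tendsto_and_filterlim_at_infinity[OF nb] by blast
    show "\<not> (P3 \<and> P4)"
    proof
      assume "P3 \<and> P4"
      then have "\<forall>\<^sub>F x in at_infinity. u x \<le> 0" "\<forall>\<^sub>F x in at_infinity. u x \<ge> 1"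
        using E3 E4 unfolding filterlim_at_bot filterlim_at_top by blast+
      then have "\<forall>\<^sub>F x :: real ^ 'n in at_infinity. False" by eventually_elim simp
      then show False using nb by (simp add: eventually_False)
    qed
  qed
  have lim_case: "P0 \<or> P1 \<or> P2" if l: "(u \<longlongrightarrow> l) at_infinity" for l
  proof (cases "\<forall>r>1. (INF x\<in>sphere 0 r. u x) \<le> l \<and> l \<le> (SUP x\<in>sphere 0 r. u x)")
    case True
    then show ?thesis using l unfolding P0_def by blast
  next
    case False
    then obtain r where r: "r > 1" "l < (INF x\<in>sphere 0 r. u x) \<or> (SUP x\<in>sphere 0 r. u x) < l" by force
    from r(2) show ?thesis
    proof
      assume "l < (INF x\<in>sphere 0 r. u x)"
      then have "\<And>x. norm x = r \<Longrightarrow> l < u x" using INF_gt_imp[OF csph(1)[OF r(1)]] by blast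
      then have P1 unfolding P1_def using asymptotics_above_limit[OF n \<Phi> u l r(1)] l by blast
      then show ?thesis by blast
    next
      assume "(SUP x\<in>sphere 0 r. u x) < l"
      then have "- l < (INF x\<in>sphere 0 r. - u x)" by (simp add: INF_uminus)
      then have "\<And>x. norm x = r \<Longrightarrow> - l < - u x" using INF_gt_imp[OF csph(2)[OF r(1)]] by blast
      from d.asymptotics_above_limit[OF n \<Phi>d ud tendsto_minus[OF l] r(1) this]
      obtain a where a: "\<alpha>d > 0" "a > 0" "((\<lambda>x. (- u x - - l) / \<Phi>d x) \<longlongrightarrow> a) at_infinity" by blast
      have "(\<lambda>x. (- u x - - l) / \<Phi>d x) = (\<lambda>x. (u x - l) / (- \<Phi>d x))"
        by (simp add: fun_eq_iff minus_divide_left)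
      then have P2 unfolding P2_def using a l by auto
      then show ?thesis by blast
    qed
  qed
  have ex: "P0 \<or> P1 \<or> P2 \<or> P3 \<or> P4"
    using assms(8)
  proof
    assume "bdd_below (u ` (- ball 0 1))"
    then obtain c0 where "\<And>x. x \<in> - ball 0 1 \<Longrightarrow> c0 \<le> u x" unfolding bdd_below_def by blast
    then have "c0 \<le> u x" if "1 < norm x" for x using that by auto
    from limit_or_infinity[OF n u this] show ?thesis
    proof
      assume "\<exists>l. (u \<longlongrightarrow> l) at_infinity"
      then show ?thesis using lim_case by blast
    next
      assume "\<forall>K. \<exists>R. \<forall>x. R \<le> norm x \<longrightarrow> K \<le> u x"
      then obtain a C where a: "\<alpha>d \<le> 0" "a > 0" "C > 0"
        "\<And>x. 2 \<le> norm x \<Longrightarrow> - a * \<Phi>d x - C \<le> u x \<and> u x \<le> - a * \<Phi>d x + C"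
        using asymptotics_at_infinity[OF n \<Phi>d u] by blast
      have "- a * \<Phi>d x - C \<le> u x \<and> u x \<le> - a * \<Phi>d x + C" if "x \<in> - ball 0 2" for x
        using a(4)[of x] that by simp
      then have P4 unfolding P4_def using a(1-3) by blast
      then show ?thesis by blast
    qed
  next
    assume "bdd_above (u ` (- ball 0 1))"
    then obtain c0 where "\<And>x. x \<in> - ball 0 1 \<Longrightarrow> u x \<le> c0" unfolding bdd_above_def by blast
    then have "- c0 \<le> - u x" if "1 < norm x" for x using that by auto
    from d.limit_or_infinity[OF n ud this] show ?thesis
    proof
      assume "\<exists>l. ((\<lambda>x. - u x) \<longlongrightarrow> l) at_infinity"
      then obtain l where "((\<lambda>x. - u x) \<longlongrightarrow> l) at_infinity" by blast
      from tendsto_minus[OF this] have "(u \<longlongrightarrow> - l) at_infinity" by simp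
      then show ?thesis using lim_case by blast
    next
      assume inf: "\<forall>K. \<exists>R. \<forall>x. R \<le> norm x \<longrightarrow> K \<le> - u x"
      \<comment> \<open>For the dual operator applied to \<open>- u\<close>, the growing solution is
        minus the fundamental solution of the dual of the dual, which is \<open>F\<close>
        again.\<close>
      have \<Phi>': "soln (dual_operator (dual_operator F)) (- {0}) \<Phi>" using \<Phi>(2) by simp
      obtain a C where a: "\<alpha> \<le> 0" "a > 0" "C > 0"
        "\<And>x. 2 \<le> norm x \<Longrightarrow> - a * \<Phi> x - C \<le> - u x \<and> - u x \<le> - a * \<Phi> x + C"
        using d.asymptotics_at_infinity[OF n \<Phi>(1) \<Phi>' ud] inf by blast
      have "a * \<Phi> x - C \<le> u x \<and> u x \<le> a * \<Phi> x + C" if "x \<in> - ball 0 2" for x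
        using a(4)[of x] that by simp
      then have P3 unfolding P3_def using a(1-3) by blast
      then show ?thesis by blast
    qed
  qed
  have "\<exists>!i::nat. i < 5 \<and> [P0, P1, P2, P3, P4] ! i"
    by (rule ex1_nth_5[OF ex excl])
  then show ?thesis unfolding P0_def P1_def P2_def P3_def P4_def \<alpha>_def \<alpha>d_def .
qed

end
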